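(* Let $u\in\mathcal{E}$ and $0<p<\infty$. The closed unit ball $$B_{u,p}(1)=\{f\in H^p_u(\mathbb{D}):\|f\|_{H^p_u}\le1\}$$ in $H^p_u(\mathbb{D})$ is closed in $H^p(\mathbb{D})$.
   Context: $\mathbb{D}=\{z\in\mathbb{C}:|z|<1\}$, $\mathbb{T}=\partial\mathbb{D}$, and $\lambda$ is the normalized Lebesgue measure on $\mathbb{T}$. $\Delta$ is the distributional Laplace operator normalized so that $\Delta\log|z|=\delta_0$; for a subharmonic function $v$, $\Delta v$ is a positive measure. $\mathcal{E}$ is the set of continuous subharmonic functions $u:\mathbb{D}\to[-\infty,0)$ such that $u(z)\to0$ as $|z|\to1$ and $\int_{\mathbb{D}}\Delta u<\infty$. For $u\in\mathcal{E}$ and $r<0$ put $B_{u,r}=\{z\in\mathbb{D}:u(z)<r\}$, $S_{u,r}=\{z\in\mathbb{D}:u(z)=r\}$, $u_r=\max\{u,r\}$, and $\mu_{u,r}=\Delta u_r-\chi_{\mathbb{D}\setminus B_{u,r}}\Delta u$; this is a positive measure supported by $S_{u,r}$. For every non-negative subharmonic $\phi$ on $\mathbb{D}$ the function $r\mapsto\int\phi\,d\mu_{u,r}$ is increasing on $(-\infty,0)$ (Demailly). For $0<p<\infty$, $H^p_u(\mathbb{D})$ is the space of analytic functions $f$ on $\mathbb{D}$ with $\|f\|^p_{H^p_u}=\lim_{r\to0^-}\int_{S_{u,r}}|f|^p\,d\mu_{u,r}<\infty$. $H^p(\mathbb{D})$ is the classical Hardy space (the case $u=\log|z|$), with $\|f\|^p_{H^p}=\sup_{0\le\rho<1}\int_{\mathbb{T}}|f(\rho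 e^{i\theta})|^p\,d\lambda(\theta)$; convergence $f_j\to f$ in $H^p(\mathbb{D})$ means $\|f_j-f\|_{H^p}\to0$. It is known that $H^p_u(\mathbb{D})\subset H^p(\mathbb{D})$. *)

theory Defs
  imports "HOL-Complex_Analysis.Complex_Analysis"
begin

text \<open>
  Functions on the unit disc are represented by total functions on \<^typ>\<open>complex\<close>; no definition
  below depends on their values outside the disc.
\<close>

abbreviation unit_disc :: "complex set" where
  "unit_disc \<equiv> ball 0 1"

definition circle_measure :: "complex measure" where
  "circle_measure = distr (uniform_measure lborel {0..2 * pi}) borel cis"

text \<open>
  Integral of an extended-real function.  It is meaningful unless both parts are infinite; for an
  upper semicontinuous function without the value \<^term>\<open>\<infinity> :: ereal\<close> on a circle the positive part
  is finite.
\<close>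

definition ereal_integral :: "'a measure \<Rightarrow> ('a \<Rightarrow> ereal) \<Rightarrow> ereal" where
  "ereal_integral M g =
     enn2ereal (\<integral>\<^sup>+ x. e2ennreal (g x) \<partial>M) - enn2ereal (\<integral>\<^sup>+ x. e2ennreal (- g x) \<partial>M)"

definition upper_semicontinuous_on :: "complex set \<Rightarrow> (complex \<Rightarrow> ereal) \<Rightarrow> bool" where
  "upper_semicontinuous_on S v \<longleftrightarrow>
     (\<forall>a\<in>S. \<forall>c. v a < c \<longrightarrow> eventually (\<lambda>z. v z < c) (at a within S))"

definition subharmonic_on :: "complex set \<Rightarrow> (complex \<Rightarrow> ereal) \<Rightarrow> bool" where
  "subharmonic_on S v \<longleftrightarrow>
     (\<forall>z\<in>S. v z < \<infinity>) \<and> upper_semicontinuous_on S v \<and>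
     (\<forall>a \<rho>. 0 < \<rho> \<and> cball a \<rho> \<subseteq> S \<longrightarrow>
        v a \<le> ereal_integral circle_measure (\<lambda>\<zeta>. v (a + complex_of_real \<rho> * \<zeta>)))"

fun higher_differentiable :: "nat \<Rightarrow> (complex \<Rightarrow> real) \<Rightarrow> bool" where
  "higher_differentiable 0 \<phi> \<longleftrightarrow> continuous_on UNIV \<phi>"
| "higher_differentiable (Suc n) \<phi> \<longleftrightarrow>
     (\<forall>z. \<phi> differentiable (at z)) \<and>
     (\<forall>w. higher_differentiable n (\<lambda>z. frechet_derivative \<phi> (at z) w))"

definition test_function_on :: "complex set \<Rightarrow> (complex \<Rightarrow> real) \<Rightarrow> bool" where
  "test_function_on S \<phi> \<longleftrightarrow>
     (\<forall>n. higher_differentiable n \<phi>) \<and>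
     compact (closure {z. \<phi> z \<noteq> 0}) \<and> closure {z. \<phi> z \<noteq> 0} \<subseteq> S"

definition directional_deriv :: "complex \<Rightarrow> (complex \<Rightarrow> real) \<Rightarrow> complex \<Rightarrow> real" where
  "directional_deriv w \<phi> z = frechet_derivative \<phi> (at z) w"

definition laplacian :: "(complex \<Rightarrow> real) \<Rightarrow> complex \<Rightarrow> real" where
  "laplacian \<phi> z =
     directional_deriv 1 (directional_deriv 1 \<phi>) z +
     directional_deriv \<i> (directional_deriv \<i> \<phi>) z"

definition locally_integrable_on :: "complex set \<Rightarrow> (complex \<Rightarrow> ereal) \<Rightarrow> bool" where
  "locally_integrable_on S v \<longleftrightarrow>
     v \<in> borel_measurable (restrict_space borel S) \<and>
     (\<forall>K. compact K \<and> K \<subseteq> S \<longrightarrow> (\<integral>\<^sup>+ z\<in>K. e2ennreal \<bar>v z\<bar> \<partial>lborel) < \<infinity>)"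

text \<open>
  The measure \<open>M\<close> represents the distribution \<open>\<Delta>v\<close> on the disc.  It is a Borel measure on the plane
  that vanishes off the disc.  The factor \<open>1 / (2\<pi>)\<close> is the normalization for which
  \<open>\<Delta> log |z|\<close> is the Dirac measure at the origin.  Local integrability makes \<open>v\<close> finite almost
  everywhere, so that \<^const>\<open>real_of_ereal\<close> alters it only on a null set.
\<close>

definition is_distr_laplacian :: "(complex \<Rightarrow> ereal) \<Rightarrow> complex measure \<Rightarrow> bool" where
  "is_distr_laplacian v M \<longleftrightarrow>
     locally_integrable_on unit_disc v \<and>
     sets M = sets borel \<and> emeasure M (- unit_disc) = 0 \<and>
     (\<forall>K. compact K \<and> K \<subseteq> unit_disc \<longrightarrow> emeasure M K < \<infinity>) \<and>
     (\<forall>\<phi>. test_function_on unit_disc \<phi> \<longrightarrow>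
        (\<integral>z. \<phi> z \<partial>M) =
        1 / (2 * pi) * (LINT z:unit_disc|lborel. real_of_ereal (v z) * laplacian \<phi> z))"

definition distr_laplacian :: "(complex \<Rightarrow> ereal) \<Rightarrow> complex measure" where
  "distr_laplacian v = (THE M. is_distr_laplacian v M)"

definition exhaustions :: "(complex \<Rightarrow> ereal) set" where
  "exhaustions = {u.
     (\<forall>z\<in>unit_disc. u z < 0) \<and>
     continuous_on unit_disc u \<and> subharmonic_on unit_disc u \<and>
     (u \<longlongrightarrow> 0) (filtercomap norm (at_left 1)) \<and>
     emeasure (distr_laplacian u) unit_disc < \<infinity>}"

definition sublevel :: "(complex \<Rightarrow> ereal) \<Rightarrow> real \<Rightarrow> complex set" where
  "sublevel u r = {z \<in> unit_disc. u z < ereal r}"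

definition level :: "(complex \<Rightarrow> ereal) \<Rightarrow> real \<Rightarrow> complex set" where
  "level u r = {z \<in> unit_disc. u z = ereal r}"

text \<open>
  \<^const>\<open>diff_measure\<close> subtracts in \<^typ>\<open>ennreal\<close>, hence truncates.  For \<open>u\<close> in
  \<^const>\<open>exhaustions\<close> the subtrahend is finite and lies below the minuend.
\<close>

definition demailly_measure :: "(complex \<Rightarrow> ereal) \<Rightarrow> real \<Rightarrow> complex measure" where
  "demailly_measure u r =
     diff_measure (distr_laplacian (\<lambda>z. max (u z) (ereal r)))
       (density (distr_laplacian u) (indicator (unit_disc - sublevel u r)))"

text \<open>
  (Quasi-)norms take values in \<^typ>\<open>ennreal\<close>, so that an infinite norm is not confused with \<open>0\<close>.
\<close>

definition ennreal_root :: "real \<Rightarrow> ennreal \<Rightarrow> ennreal" where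
  "ennreal_root p x = (if x = \<infinity> then \<infinity> else ennreal (enn2real x powr (1 / p)))"

definition hardy_norm :: "real \<Rightarrow> (complex \<Rightarrow> complex) \<Rightarrow> ennreal" where
  "hardy_norm p f = ennreal_root p
     (SUP \<rho>\<in>{0..<1}. \<integral>\<^sup>+ \<zeta>. ennreal (norm (f (complex_of_real \<rho> * \<zeta>)) powr p) \<partial>circle_measure)"

definition hardy_space :: "real \<Rightarrow> (complex \<Rightarrow> complex) set" where
  "hardy_space p = {f. f holomorphic_on unit_disc \<and> hardy_norm p f < \<infinity>}"

definition level_integral ::
  "(complex \<Rightarrow> ereal) \<Rightarrow> real \<Rightarrow> (complex \<Rightarrow> complex) \<Rightarrow> real \<Rightarrow> ennreal" where
  "level_integral u p f r = (\<integral>\<^sup>+ z\<in>level u r. ennreal (norm (f z) powr p) \<partial>demailly_measure u r)"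

definition hardy_norm_u :: "(complex \<Rightarrow> ereal) \<Rightarrow> real \<Rightarrow> (complex \<Rightarrow> complex) \<Rightarrow> ennreal" where
  "hardy_norm_u u p f = ennreal_root p (Lim (at_left 0) (level_integral u p f))"

definition hardy_space_u :: "(complex \<Rightarrow> ereal) \<Rightarrow> real \<Rightarrow> (complex \<Rightarrow> complex) set" where
  "hardy_space_u u p = {f. f holomorphic_on unit_disc \<and>
     (\<exists>L. (level_integral u p f \<longlongrightarrow> L) (at_left 0) \<and> L < \<infinity>)}"

definition hardy_unit_ball_u :: "(complex \<Rightarrow> ereal) \<Rightarrow> real \<Rightarrow> (complex \<Rightarrow> complex) set" where
  "hardy_unit_ball_u u p = {f \<in> hardy_space_u u p. hardy_norm_u u p f \<le> 1}"

definition closed_in_hardy_space :: "real \<Rightarrow> (complex \<Rightarrow> complex) set \<Rightarrow> bool" where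
  "closed_in_hardy_space p A \<longleftrightarrow>
     (\<forall>F f. (\<forall>j::nat. F j \<in> A) \<and> f \<in> hardy_space p \<and>
        (\<lambda>j. hardy_norm p (\<lambda>z. F j z - f z)) \<longlonglongrightarrow> 0 \<longrightarrow> f \<in> A)"

end

theory Submission
  imports Defs
begin

text \<open>
  Convergence in \<open>H\<^sup>p\<close> forces pointwise convergence on the disc.  It therefore suffices to describe
  the unit ball of \<open>H\<^sup>p\<^sub>u\<close> by conditions that survive pointwise limits.  Such conditions are
  \<open>\<integral>\<^bsub>S(r)\<^esub> |f|\<^sup>p d\<mu>\<^sub>r \<le> 1\<close> for every \<open>r < 0\<close>: each of them passes to the limit by Fatou's lemma for the
  single measure \<open>\<mu>\<^sub>r\<close>.  That they describe the ball is Demailly's monotonicity theorem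
  (\<open>level_integral_mono\<close>): the level integrals increase with \<open>r\<close>, so their limit at \<open>0\<close> exists and is
  their supremum (\<open>mem_hardy_unit_ball_u_iff\<close>).

  Monotonicity is Green's formula.  With \<open>u\<^sub>r = max u r\<close> and \<open>r < s < 0\<close>,
  \<open>\<mu>\<^sub>s - \<mu>\<^sub>r = \<Delta>(u\<^sub>s - u\<^sub>r) + \<chi>\<^bsub>{r \<le> u < s}\<^esub> \<Delta>u\<close>, where \<open>u\<^sub>s - u\<^sub>r\<close> is nonnegative and vanishes off the
  relatively compact set \<open>{u < s}\<close>.  Against a smooth nonnegative \<open>\<phi>\<close> with \<open>\<Delta>\<phi> \<ge> 0\<close> the first term
  gives a positive multiple of \<open>\<integral> (u\<^sub>s - u\<^sub>r) \<Delta>\<phi> \<ge> 0\<close> and the second is nonnegative.  The function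
  \<open>|f|\<^sup>p\<close> is not smooth at the zeros of \<open>f\<close> and is defined on the disc only; it is approximated by
  \<open>(|P|\<^sup>2 + \<epsilon>)\<close> to the power \<open>p / 2\<close> with Taylor polynomials \<open>P\<close> of \<open>f\<close>, whose Laplacian is computed
  to be nonnegative.

  The measures in this argument have to be constructed.  The sub-mean value inequality makes
  \<open>\<psi> \<mapsto> \<integral> v \<Delta>\<psi>\<close> a positive functional on test functions (\<open>laplacian_integral_nonneg\<close>); a Riesz
  representation theorem (locale \<open>positive_functional\<close>) turns such functionals into measures, and a
  measure that is finite on compact sets is determined by its values on test functions.  The
  difference that defines \<open>\<mu>\<^sub>r\<close> is a difference of comparable measures (\<open>\<Delta>_above_le_Lap\<close>) because
  \<open>\<Delta>u\<^sub>s = \<Delta>u\<close> on \<open>{u > s} \<supseteq> {u \<ge> r}\<close> for \<open>s < r\<close>, and \<open>\<Delta>u\<^sub>s \<rightarrow> \<Delta>u\<^sub>r\<close> weakly as \<open>s \<rightarrow> r\<close>.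

  Pointwise convergence rests on Cauchy's formula, which bounds \<open>|g a|\<close> by a mean of \<open>|g|\<close> over a
  circle.  For \<open>p \<ge> 1\<close> a mean of \<open>|g|\<close> is controlled by one of \<open>|g|\<^sup>p\<close>; for \<open>p < 1\<close> the estimate is
  applied at a point that maximizes a weighted modulus of \<open>g\<close>, where it improves itself.
\<close>

section \<open>Smooth functions and test functions\<close>

abbreviation smooth :: "(complex \<Rightarrow> real) \<Rightarrow> bool" where
  "smooth \<phi> \<equiv> \<forall>n. higher_differentiable n \<phi>"

declare higher_differentiable.simps(2) [simp del]

lemma frechet_derivative_eqI:
  assumes "(f has_derivative f') (at z)"
  shows "frechet_derivative f (at z) w = f' w"
  using frechet_derivative_at[OF assms] by simp

lemma higher_differentiable_SucI:
  assumes "\<And>z. (f has_derivative D z) (at z)" "\<And>w. higher_differentiable n (\<lambda>z. D z w)"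
  shows "higher_differentiable (Suc n) f"
proof -
  have "(\<lambda>z. frechet_derivative f (at z) w) = (\<lambda>z. D z w)" for w
    using frechet_derivative_eqI[OF assms(1)] by blast
  then show ?thesis
    using assms by (auto simp: differentiable_def higher_differentiable.simps(2))
qed

lemma has_derivative_frechet:
  assumes "higher_differentiable (Suc n) f"
  shows "(f has_derivative frechet_derivative f (at z)) (at z)"
  using assms by (simp add: frechet_derivative_works[symmetric] higher_differentiable.simps(2))

lemma higher_differentiable_frechet:
  assumes "higher_differentiable (Suc n) f"
  shows "higher_differentiable n (\<lambda>z. frechet_derivative f (at z) w)"
  using assms by (simp add: higher_differentiable.simps(2))

lemma higher_differentiable_SucD: "higher_differentiable (Suc n) f \<Longrightarrow> higher_differentiable n f"
proof (induction n arbitrary: f)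
  case 0
  then show ?case
    by (auto simp: continuous_on_eq_continuous_at higher_differentiable.simps(2)
        intro: differentiable_imp_continuous_within)
next
  case (Suc n)
  show ?case
    by (rule higher_differentiable_SucI[OF has_derivative_frechet[OF Suc.prems]])
       (rule Suc.IH, rule higher_differentiable_frechet[OF Suc.prems])
qed

lemma higher_differentiable_continuous:
  "higher_differentiable n f \<Longrightarrow> continuous_on UNIV f"
  by (induction n) (auto dest: higher_differentiable_SucD)

lemma higher_differentiable_const: "higher_differentiable n (\<lambda>z. c)"
proof (induction n arbitrary: c)
  case (Suc n)
  show ?case
    by (rule higher_differentiable_SucI[where D = "\<lambda>_ _. 0"]) (auto intro: Suc)
qed simp

lemma higher_differentiable_add:
  "higher_differentiable n f \<Longrightarrow> higher_differentiable n g \<Longrightarrow> higher_differentiable n (\<lambda>z. f z + g z)"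
proof (induction n arbitrary: f g)
  case (Suc n)
  note has_derivative_frechet[OF Suc.prems(1), derivative_intros]
       has_derivative_frechet[OF Suc.prems(2), derivative_intros]
  show ?case
    by (rule higher_differentiable_SucI, (rule derivative_intros)+)
       (intro Suc.IH higher_differentiable_frechet Suc.prems)
qed (simp add: continuous_on_add)

lemma higher_differentiable_mult:
  "higher_differentiable n f \<Longrightarrow> higher_differentiable n g \<Longrightarrow> higher_differentiable n (\<lambda>z. f z * g z)"
proof (induction n arbitrary: f g)
  case (Suc n)
  note has_derivative_frechet[OF Suc.prems(1), derivative_intros]
       has_derivative_frechet[OF Suc.prems(2), derivative_intros]
  show ?case
    by (rule higher_differentiable_SucI, (rule derivative_intros)+)
       (intro Suc.IH higher_differentiable_add higher_differentiable_frechet 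
              higher_differentiable_SucD[OF Suc.prems(1)] higher_differentiable_SucD[OF Suc.prems(2)]
              Suc.prems)
qed (simp add: continuous_on_mult)

text \<open>
  The induction on the order replaces the outer function by its derivative, so it has to run over a
  whole family \<open>\<F>\<close> that is closed under differentiation.
\<close>

lemma higher_differentiable_compose:
  assumes "\<And>h. h \<in> \<F> \<Longrightarrow> \<exists>h'\<in>\<F>. \<forall>t\<in>I. (h has_real_derivative h' t) (at t)"
    and "h \<in> \<F>" and "\<And>z. g z \<in> I"
  shows "higher_differentiable n g \<Longrightarrow> higher_differentiable n (\<lambda>z. h (g z))"
  using assms(2)
proof (induction n arbitrary: h)
  case 0
  have "continuous_on I h"
    using assms(1)[OF 0(2)] by (auto simp: continuous_on_eq_continuous_within
        intro!: continuous_at_imp_continuous_within DERIV_isCont)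
  then show ?case
    using 0 assms(3) by (auto intro!: continuous_on_compose2[where f = g])
next
  case (Suc n)
  obtain h' where h': "h' \<in> \<F>" "\<And>t. t \<in> I \<Longrightarrow> (h has_real_derivative h' t) (at t)"
    using assms(1)[OF Suc(3)] by blast
  show ?case
  proof (rule higher_differentiable_SucI)
    fix z
    show "((\<lambda>z. h (g z)) has_derivative (\<lambda>w. h' (g z) * frechet_derivative g (at z) w)) (at z)"
      using has_derivative_compose[OF has_derivative_frechet[OF Suc.prems(1)]
          h'(2)[OF assms(3), unfolded has_field_derivative_def]] by simp
  next
    fix w
    show "higher_differentiable n (\<lambda>z. h' (g z) * frechet_derivative g (at z) w)"
      by (rule higher_differentiable_mult[OF Suc.IH[OF higher_differentiable_SucD[OF Suc.prems(1)] h'(1)]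
            higher_differentiable_frechet[OF Suc.prems(1)]])
  qed
qed

lemma higher_differentiable_powr:
  assumes "higher_differentiable n g" "\<And>z. g z > 0"
  shows "higher_differentiable n (\<lambda>z. g z powr a)"
proof (rule higher_differentiable_compose[where \<F> = "{\<lambda>t. c * t powr a | c a. True}" and I = "{0<..}"
        and h = "\<lambda>t. t powr a"])
  fix h :: "real \<Rightarrow> real" assume "h \<in> {\<lambda>t. c * t powr a | c a. True}"
  then obtain c a where h: "h = (\<lambda>t. c * t powr a)" by blast
  show "\<exists>h'\<in>{\<lambda>t. c * t powr a | c a. True}. \<forall>t\<in>{0<..}. (h has_real_derivative h' t) (at t)"
    unfolding h
  proof (rule bexI[of _ "\<lambda>t. (c * a) * t powr (a - 1)"])
    show "\<forall>t\<in>{0<..}. ((\<lambda>t. c * t powr a) has_real_derivative c * a * t powr (a - 1)) (at t)"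
      by (auto intro!: DERIV_cmult[THEN DERIV_cong] has_real_derivative_powr)
  qed blast
next
  show "(\<lambda>t. t powr a) \<in> {\<lambda>t. c * t powr a | c a. True}"
    by (rule CollectI, rule exI[of _ 1], rule exI[of _ a]) simp
qed (use assms in auto)

lemma higher_differentiable_divide:
  assumes "higher_differentiable n f" "higher_differentiable n g" "\<And>z. g z > 0"
  shows "higher_differentiable n (\<lambda>z. f z / g z)"
proof -
  have "higher_differentiable n (\<lambda>z. f z * g z powr - 1)"
    by (intro higher_differentiable_mult higher_differentiable_powr assms)
  then show ?thesis
    using assms(3) by (simp add: powr_minus_divide less_imp_le)
qed

lemma higher_differentiable_minus:
  "higher_differentiable n f \<Longrightarrow> higher_differentiable n (\<lambda>z. - f z)"
  using higher_differentiable_mult[OF higher_differentiable_const[of n "- 1"]] by simp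

lemma higher_differentiable_diff:
  "higher_differentiable n f \<Longrightarrow> higher_differentiable n g \<Longrightarrow> higher_differentiable n (\<lambda>z. f z - g z)"
  using higher_differentiable_add[OF _ higher_differentiable_minus, of n f g] by simp

lemma higher_differentiable_linear:
  assumes "bounded_linear f" shows "higher_differentiable n f"
proof (cases n)
  case (Suc m)
  show ?thesis
    unfolding Suc
    by (rule higher_differentiable_SucI[where D = "\<lambda>_. f"])
       (auto intro: higher_differentiable_const bounded_linear_imp_has_derivative assms)
qed (simp add: assms linear_continuous_on)

lemma higher_differentiable_entire:
  assumes "f holomorphic_on UNIV"
  shows "higher_differentiable n (\<lambda>z. Re (f z)) \<and> higher_differentiable n (\<lambda>z. Im (f z))"
  using assms
proof (induction n arbitrary: f)
  case 0
  then show ?case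
    by (auto intro!: continuous_intros holomorphic_on_imp_continuous_on)
next
  case (Suc n)
  have d: "(f has_derivative (\<lambda>w. deriv f z * w)) (at z)" for z
    using holomorphic_derivI[OF Suc.prems, of z] by (simp add: has_field_derivative_def)
  have h: "(\<lambda>z. deriv f z * w) holomorphic_on UNIV" for w
    by (intro holomorphic_intros Suc.prems) auto
  show ?case
  proof
    show "higher_differentiable (Suc n) (\<lambda>z. Re (f z))"
      by (rule higher_differentiable_SucI[OF has_derivative_Re[OF d]]) (use Suc.IH[OF h] in blast)
    show "higher_differentiable (Suc n) (\<lambda>z. Im (f z))"
      by (rule higher_differentiable_SucI[OF has_derivative_Im[OF d]]) (use Suc.IH[OF h] in blast)
  qed
qed

text \<open>
  The polynomial factor is there to make the family closed under differentiation; the case \<open>q = 1\<close> is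
  the standard function that is flat at \<open>0\<close>.
\<close>

definition flat_exp :: "real poly \<Rightarrow> real \<Rightarrow> real" where
  "flat_exp q t = (if t > 0 then poly q (1 / t) * exp (- (1 / t)) else 0)"

lemma poly_exp_tendsto_0: "((\<lambda>x. poly q x * exp (- x)) \<longlongrightarrow> 0) (at_top :: real filter)"
proof (induction q)
  case (pCons a q)
  have "((\<lambda>x. poly q x * (x * exp (- x))) \<longlongrightarrow> 0) at_top" for q :: "real poly"
  proof -
    have "((\<lambda>x. \<Sum>i\<le>degree q. coeff q i * (x ^ Suc i / exp x)) \<longlongrightarrow> (\<Sum>i\<le>degree q. coeff q i * 0)) at_top"
      by (intro tendsto_sum tendsto_mult tendsto_const tendsto_power_div_exp_0)
    then show ?thesis
      by (simp add: poly_altdef sum_distrib_left sum_distrib_right exp_minus divide_inverse mult_ac)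
  qed
  moreover have "((\<lambda>x. a * exp (- x)) \<longlongrightarrow> 0) (at_top :: real filter)"
    by (rule tendsto_mult_right_zero, rule filterlim_compose[OF exp_at_bot filterlim_uminus_at_bot_at_top])
  ultimately have "((\<lambda>x. a * exp (- x) + poly q x * (x * exp (- x))) \<longlongrightarrow> 0 + 0) at_top"
    by (intro tendsto_add)
  then show ?case by (simp add: algebra_simps)
qed simp

lemma flat_exp_tendsto_0: "((\<lambda>t. poly q (1 / t) * exp (- (1 / t))) \<longlongrightarrow> 0) (at_right (0::real))"
proof -
  have "filterlim (\<lambda>t::real. 1 / t) at_top (at_right 0)"
    using filterlim_inverse_at_top_right by (simp add: inverse_eq_divide)
  from filterlim_compose[OF poly_exp_tendsto_0 this] show ?thesis .
qed

lemma flat_exp_deriv: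
  "(flat_exp q has_real_derivative flat_exp ([:0, 0, 1:] * (q - pderiv q)) t) (at t)"
proof -
  consider "t > 0" | "t < 0" | "t = 0" by linarith
  then show ?thesis
  proof cases
    case 1
    have "((\<lambda>t. poly q (1 / t) * exp (- (1 / t))) has_real_derivative
         (- (1 / t\<^sup>2) * poly (pderiv q) (1 / t)) * exp (- (1 / t)) + poly q (1/t) * (exp (- (1 / t)) * (1 / t\<^sup>2))) (at t)"
      using 1 by (auto intro!: derivative_eq_intros simp: power2_eq_square field_simps)
    also have "(- (1 / t\<^sup>2) * poly (pderiv q) (1 / t)) * exp (- (1 / t)) + poly q (1/t) * (exp (- (1 / t)) * (1 / t\<^sup>2))
        = flat_exp ([:0, 0, 1:] * (q - pderiv q)) t"
      using 1 by (simp add: flat_exp_def power2_eq_square field_simps)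
    finally show ?thesis
      by (rule has_field_derivative_transform_within_open[where S = "{0<..}"])
         (use 1 in \<open>auto simp: flat_exp_def\<close>)
  next
    case 2
    have "((\<lambda>_. 0::real) has_real_derivative 0) (at t)" by simp
    then have "(flat_exp q has_real_derivative 0) (at t)"
      by (rule has_field_derivative_transform_within_open[where S = "{..<0}"])
         (use 2 in \<open>auto simp: flat_exp_def\<close>)
    then show ?thesis using 2 by (simp add: flat_exp_def)
  next
    case 3
    have r: "((\<lambda>h. flat_exp q h / h) \<longlongrightarrow> 0) (at_right 0)"
      by (rule Lim_transform_eventually[OF flat_exp_tendsto_0[of "pCons 0 q"]])
         (auto simp: flat_exp_def eventually_at_right_less intro!: eventually_mono[OF eventually_at_right_less])
    have l: "((\<lambda>h. flat_exp q h / h) \<longlongrightarrow> 0) (at_left 0)"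
      by (rule Lim_transform_eventually[OF tendsto_const])
         (auto simp: flat_exp_def eventually_at_filter)
    have "((\<lambda>h. flat_exp q h / h) \<longlongrightarrow> 0) (at 0)"
      using l r by (simp add: filterlim_at_split)
    then show ?thesis
      using 3 by (simp add: DERIV_def flat_exp_def)
  qed
qed

lemma higher_differentiable_flat_exp:
  assumes "higher_differentiable n g"
  shows "higher_differentiable n (\<lambda>z. flat_exp q (g z))"
  by (rule higher_differentiable_compose[where \<F> = "range flat_exp" and I = UNIV])
     (use assms flat_exp_deriv in auto)

definition smooth_step :: "real \<Rightarrow> real" where
  "smooth_step t = flat_exp 1 t / (flat_exp 1 t + flat_exp 1 (1 - t))"

lemma flat_exp_1: "flat_exp 1 t \<ge> 0" "flat_exp 1 t > 0 \<longleftrightarrow> t > 0"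
  by (auto simp: flat_exp_def)

lemma flat_exp_1_sum_pos: "flat_exp 1 t + flat_exp 1 (1 - t) > 0"
proof (cases "t > 0")
  case True
  then show ?thesis using flat_exp_1[of t] flat_exp_1[of "1 - t"] by linarith
next
  case False
  then show ?thesis using flat_exp_1[of t] flat_exp_1(2)[of "1 - t"] by auto
qed

lemma smooth_step_nonneg: "0 \<le> smooth_step t"
  and smooth_step_le_1: "smooth_step t \<le> 1"
  and smooth_step_eq_0: "t \<le> 0 \<Longrightarrow> smooth_step t = 0"
  and smooth_step_eq_1: "t \<ge> 1 \<Longrightarrow> smooth_step t = 1"
  using flat_exp_1_sum_pos[of t] flat_exp_1[of t] flat_exp_1[of "1 - t"]
  by (auto simp: smooth_step_def divide_simps flat_exp_def split: if_splits)

lemma higher_differentiable_smooth_step: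
  assumes "higher_differentiable n g"
  shows "higher_differentiable n (\<lambda>z. smooth_step (g z))"
  unfolding smooth_step_def
  by (intro higher_differentiable_divide higher_differentiable_add higher_differentiable_flat_exp
        higher_differentiable_diff higher_differentiable_const assms flat_exp_1_sum_pos)

lemma higher_differentiable_norm_square: "higher_differentiable n (\<lambda>z. (norm (z - a))\<^sup>2)"
proof -
  have "higher_differentiable n (\<lambda>z. (Re z - Re a) * (Re z - Re a) + (Im z - Im a) * (Im z - Im a))"
    by (intro higher_differentiable_add higher_differentiable_mult higher_differentiable_diff
        higher_differentiable_const higher_differentiable_linear bounded_linear_Re bounded_linear_Im)
  then show ?thesis by (simp add: cmod_power2 flip: power2_eq_square)
qed

abbreviation supp :: "(complex \<Rightarrow> real) \<Rightarrow> complex set" where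
  "supp \<phi> \<equiv> closure {z. \<phi> z \<noteq> 0}"

lemma test_functionI:
  assumes "smooth \<phi>" "compact K" "K \<subseteq> S" "\<And>z. z \<notin> K \<Longrightarrow> \<phi> z = 0"
  shows "test_function_on S \<phi>"
proof -
  have "supp \<phi> \<subseteq> K"
    using assms by (intro closure_minimal) (auto simp: compact_imp_closed)
  moreover from this have "compact (supp \<phi>)"
    using compact_Int_closed[OF assms(2) closed_closure[of "{z. \<phi> z \<noteq> 0}"]] by (simp add: Int_absorb1)
  ultimately show ?thesis
    unfolding test_function_on_def using assms(1,3) by blast
qed

lemma test_function_smooth: "test_function_on S \<phi> \<Longrightarrow> smooth \<phi>"
  by (simp add: test_function_on_def)

lemma test_function_continuous: "test_function_on S \<phi> \<Longrightarrow> continuous_on UNIV \<phi>"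
  using test_function_smooth higher_differentiable_continuous by blast

lemma test_function_compact: "test_function_on S \<phi> \<Longrightarrow> compact (supp \<phi>)"
  and test_function_supp: "test_function_on S \<phi> \<Longrightarrow> supp \<phi> \<subseteq> S"
  by (simp_all add: test_function_on_def)

lemma notin_supp: "z \<notin> supp \<phi> \<Longrightarrow> \<phi> z = 0"
  using closure_subset[of "{z. \<phi> z \<noteq> 0}"] by blast

lemma test_function_mono: "test_function_on S \<phi> \<Longrightarrow> S \<subseteq> T \<Longrightarrow> test_function_on T \<phi>"
  unfolding test_function_on_def by blast

lemma test_function_mult:
  assumes "test_function_on S \<phi>" "smooth g"
  shows "test_function_on S (\<lambda>z. \<phi> z * g z)"
proof (rule test_functionI[OF _ test_function_compact[OF assms(1)] test_function_supp[OF assms(1)]])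
  show "smooth (\<lambda>z. \<phi> z * g z)"
    using assms(2) test_function_smooth[OF assms(1)] by (blast intro: higher_differentiable_mult)
  show "\<phi> z * g z = 0" if "z \<notin> supp \<phi>" for z
    using notin_supp[OF that] by simp
qed

lemma test_function_add:
  assumes "test_function_on S \<phi>" "test_function_on S \<psi>"
  shows "test_function_on S (\<lambda>z. \<phi> z + \<psi> z)"
proof (rule test_functionI)
  show "smooth (\<lambda>z. \<phi> z + \<psi> z)"
    using assms[THEN test_function_smooth] by (blast intro: higher_differentiable_add)
  show "compact (supp \<phi> \<union> supp \<psi>)"
    using assms[THEN test_function_compact] by (rule compact_Un)
  show "supp \<phi> \<union> supp \<psi> \<subseteq> S"
    using assms[THEN test_function_supp] by blast
  show "\<phi> z + \<psi> z = 0" if "z \<notin> supp \<phi> \<union> supp \<psi>" for z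
    using notin_supp[of z \<phi>] notin_supp[of z \<psi>] that by simp
qed

lemma test_function_cmult:
  assumes "test_function_on S \<phi>"
  shows "test_function_on S (\<lambda>z. c * \<phi> z)"
  using test_function_mult[OF assms, of "\<lambda>_. c"] by (simp add: higher_differentiable_const mult.commute)

lemma test_function_diff:
  assumes "test_function_on S \<phi>" "test_function_on S \<psi>"
  shows "test_function_on S (\<lambda>z. \<phi> z - \<psi> z)"
  using test_function_add[OF assms(1) test_function_cmult[OF assms(2), of "- 1"]] by simp

lemma test_function_zero: "test_function_on S (\<lambda>z. 0)"
  by (rule test_functionI[where K = "{}"]) (auto intro: higher_differentiable_const)

lemma test_function_sum:
  assumes "\<And>i. i \<in> A \<Longrightarrow> test_function_on S (\<phi> i)"
  shows "test_function_on S (\<lambda>z. \<Sum>i\<in>A. \<phi> i z)"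
  using assms
  by (induction A rule: infinite_finite_induct) (auto intro: test_function_add test_function_zero)

lemma test_function_bounded:
  assumes "test_function_on S \<phi>"
  obtains C where "0 \<le> C" "\<And>z. \<bar>\<phi> z\<bar> \<le> C"
proof -
  have "bounded (\<phi> ` supp \<phi>)"
    using test_function_continuous[OF assms] test_function_compact[OF assms]
    by (meson compact_continuous_image compact_imp_bounded continuous_on_subset subset_UNIV)
  then obtain B where B: "\<And>z. z \<in> supp \<phi> \<Longrightarrow> norm (\<phi> z) \<le> B"
    by (auto simp: bounded_iff)
  have "\<bar>\<phi> z\<bar> \<le> max B 0" for z
  proof (cases "z \<in> supp \<phi>")
    case True
    from B[OF this] show ?thesis by simp
  next
    case False
    from notin_supp[OF this] show ?thesis by simp
  qed
  then show thesis using that[of "max B 0"] by simp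
qed

lemma bump_exists:
  assumes "r > 0"
  obtains b where "smooth b" "\<And>z. 0 \<le> b z" "\<And>z. b z \<le> 1" "\<And>z. z \<in> ball a (r / 2) \<Longrightarrow> b z = 1"
    "\<And>z. z \<notin> cball a r \<Longrightarrow> b z = 0"
proof
  define b where "b = (\<lambda>z. 1 - smooth_step (4 / r\<^sup>2 * (norm (z - a))\<^sup>2 - 1))"
  show "smooth b"
    unfolding b_def by (intro allI higher_differentiable_diff higher_differentiable_const
        higher_differentiable_smooth_step higher_differentiable_mult higher_differentiable_norm_square)
  show "0 \<le> b z" "b z \<le> 1" for z
    by (auto simp: b_def smooth_step_nonneg smooth_step_le_1)
  show "b z = 1" if "z \<in> ball a (r / 2)" for z
  proof -
    have "(norm (z - a))\<^sup>2 \<le> (r / 2)\<^sup>2"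
      using that by (intro power_mono) (auto simp: dist_norm norm_minus_commute)
    then have "4 / r\<^sup>2 * (norm (z - a))\<^sup>2 - 1 \<le> 0"
      using assms by (simp add: field_simps)
    then show ?thesis by (simp add: b_def smooth_step_eq_0)
  qed
  show "b z = 0" if "z \<notin> cball a r" for z
  proof -
    have "(norm (z - a))\<^sup>2 \<ge> r\<^sup>2"
      using that assms by (intro power_mono) (auto simp: dist_norm norm_minus_commute)
    then have "(norm (z - a))\<^sup>2 / r\<^sup>2 \<ge> 1"
      using assms by (simp add: le_divide_eq_1)
    then have "4 / r\<^sup>2 * (norm (z - a))\<^sup>2 - 1 \<ge> 1"
      by simp
    then show ?thesis by (simp add: b_def smooth_step_eq_1)
  qed
qed

text \<open>
  Finitely many bumps \<open>b\<^sub>a\<close> that are \<open>1\<close> on half-size balls cover \<open>K\<close>.  The function \<open>1 - \<Prod> (1 - b\<^sub>a)\<close> is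
  \<open>1\<close> wherever one of them is, and it stays between \<open>0\<close> and \<open>1\<close> without any normalization.
\<close>

lemma smooth_Urysohn:
  assumes "compact K" "open U" "K \<subseteq> U"
  obtains g W where "test_function_on U g" "\<And>z. 0 \<le> g z" "\<And>z. g z \<le> 1"
    "open W" "K \<subseteq> W" "W \<subseteq> U" "\<And>z. z \<in> W \<Longrightarrow> g z = 1"
proof -
  have "\<forall>a\<in>K. \<exists>r>0. cball a r \<subseteq> U"
    using assms open_contains_cball by blast
  then obtain r where r: "\<And>a. a \<in> K \<Longrightarrow> r a > 0" "\<And>a. a \<in> K \<Longrightarrow> cball a (r a) \<subseteq> U"
    by metis
  have "\<exists>b. smooth b \<and> (\<forall>z. 0 \<le> b z \<and> b z \<le> 1) \<and> (\<forall>z \<in> ball a (r a / 2). b z = 1) \<and>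
    (\<forall>z. z \<notin> cball a (r a) \<longrightarrow> b z = 0)" if "a \<in> K" for a
    using bump_exists[OF r(1)[OF that]] by metis
  then obtain b where b: "\<And>a. a \<in> K \<Longrightarrow> smooth (b a)" "\<And>a z. a \<in> K \<Longrightarrow> 0 \<le> b a z \<and> b a z \<le> 1"
     "\<And>a z. a \<in> K \<Longrightarrow> z \<in> ball a (r a / 2) \<Longrightarrow> b a z = 1"
     "\<And>a z. a \<in> K \<Longrightarrow> z \<notin> cball a (r a) \<Longrightarrow> b a z = 0"
    by metis
  have "K \<subseteq> (\<Union>a\<in>K. ball a (r a / 2))"
    using r(1) by force
  then obtain C where C: "C \<subseteq> K" "finite C" "K \<subseteq> (\<Union>a\<in>C. ball a (r a / 2))"
    using compactE_image[OF assms(1), of K "\<lambda>a. ball a (r a / 2)"] by blast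
  define g where "g = (\<lambda>z. 1 - (\<Prod>a\<in>C. 1 - b a z))"
  have g01: "0 \<le> (\<Prod>a\<in>C. 1 - b a z)" "(\<Prod>a\<in>C. 1 - b a z) \<le> 1" for z
    using b(2) C(1) by (auto intro!: prod_nonneg prod_le_1)
  show thesis
  proof
    have sm: "smooth (\<lambda>z. \<Prod>a\<in>C. 1 - b a z)"
      using C(2,1)
      by (induction C rule: finite_induct)
         (auto simp: b(1) intro!: higher_differentiable_mult higher_differentiable_diff higher_differentiable_const)
    show "test_function_on U g"
    proof (rule test_functionI[where K = "\<Union>a\<in>C. cball a (r a)"])
      show "smooth g"
        unfolding g_def using sm by (auto intro: higher_differentiable_diff higher_differentiable_const)
      show "g z = 0" if "z \<notin> (\<Union>a\<in>C. cball a (r a))" for z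
      proof -
        have "b a z = 0" if "a \<in> C" for a
          using b(4) C(1) that \<open>z \<notin> _\<close> by blast
        then show ?thesis by (simp add: g_def)
      qed
      show "compact (\<Union>a\<in>C. cball a (r a))"
        using C(2) by (intro compact_UN) auto
      show "(\<Union>a\<in>C. cball a (r a)) \<subseteq> U"
        using C(1) r(2) by (intro UN_least) blast
    qed
    show "0 \<le> g z" "g z \<le> 1" for z
      using g01[of z] by (auto simp: g_def)
    show "open (\<Union>a\<in>C. ball a (r a / 2))" "K \<subseteq> (\<Union>a\<in>C. ball a (r a / 2))" using C by auto
    show "(\<Union>a\<in>C. ball a (r a / 2)) \<subseteq> U"
    proof safe
      fix a z assume "a \<in> C" "z \<in> ball a (r a / 2)"
      moreover from this have "z \<in> cball a (r a)"
        using r(1)[of a] C(1) by auto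
      ultimately show "z \<in> U" using r(2) C(1) by blast
    qed
    show "g z = 1" if z: "z \<in> (\<Union>a\<in>C. ball a (r a / 2))" for z
    proof -
      obtain a where "a \<in> C" "z \<in> ball a (r a / 2)" using z by blast
      then have "1 - b a z = 0" using b(3)[of a z] C(1) by auto
      then have "(\<Prod>a\<in>C. 1 - b a z) = 0"
        using \<open>a \<in> C\<close> C(2) by (auto intro: prod_zero)
      then show ?thesis by (simp add: g_def)
    qed
  qed
qed

lemma test_function_restrict: "test_function_on S \<phi> \<Longrightarrow> supp \<phi> \<subseteq> T \<Longrightarrow> test_function_on T \<phi>"
  unfolding test_function_on_def by blast

lemma smooth_const: "smooth (\<lambda>z. c)"
  using higher_differentiable_const by blast

lemma smooth_add: "smooth f \<Longrightarrow> smooth g \<Longrightarrow> smooth (\<lambda>z. f z + g z)"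
  using higher_differentiable_add by blast

lemma smooth_mult: "smooth f \<Longrightarrow> smooth g \<Longrightarrow> smooth (\<lambda>z. f z * g z)"
  using higher_differentiable_mult by blast

lemma smooth_diff: "smooth f \<Longrightarrow> smooth g \<Longrightarrow> smooth (\<lambda>z. f z - g z)"
  using higher_differentiable_diff by blast

section \<open>A Riesz representation theorem on test functions\<close>

text \<open>
  A positive functional on the test functions on \<open>S\<close> is integration against a measure.  The measure of
  an open set is read off from the functions below its indicator; outer approximation and
  Caratheodory's criterion extend it to Borel sets.
\<close>

locale positive_functional =
  fixes S :: "complex set" and \<Lambda> :: "(complex \<Rightarrow> real) \<Rightarrow> real"
  assumes open_S: "open S"
    and Lin_add: "test_function_on S \<phi> \<Longrightarrow> test_function_on S \<psi> \<Longrightarrow> \<Lambda> (\<lambda>z. \<phi> z + \<psi> z) = \<Lambda> \<phi> + \<Lambda> \<psi>"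
    and Lin_cmult: "test_function_on S \<phi> \<Longrightarrow> \<Lambda> (\<lambda>z. c * \<phi> z) = c * \<Lambda> \<phi>"
    and Lin_nonneg: "test_function_on S \<phi> \<Longrightarrow> (\<And>z. 0 \<le> \<phi> z) \<Longrightarrow> 0 \<le> \<Lambda> \<phi>"
begin

lemma Lin_diff: "test_function_on S \<phi> \<Longrightarrow> test_function_on S \<psi> \<Longrightarrow> \<Lambda> (\<lambda>z. \<phi> z - \<psi> z) = \<Lambda> \<phi> - \<Lambda> \<psi>"
  using Lin_add[of \<phi> "\<lambda>z. - 1 * \<psi> z"] Lin_cmult[of \<psi> "- 1"] test_function_cmult[of S \<psi> "- 1"] by simp

lemma Lin_mono:
  assumes "test_function_on S \<phi>" "test_function_on S \<psi>" "\<And>z. \<phi> z \<le> \<psi> z"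
  shows "\<Lambda> \<phi> \<le> \<Lambda> \<psi>"
  using Lin_nonneg[OF test_function_diff[OF assms(2,1)]] assms by (simp add: Lin_diff)

lemma Lin_zero: "\<Lambda> (\<lambda>z. 0) = 0"
  using Lin_cmult[OF test_function_zero, of 0] by simp

lemma Lin_sum:
  assumes "\<And>i. i \<in> A \<Longrightarrow> test_function_on S (\<phi> i)"
  shows "\<Lambda> (\<lambda>z. \<Sum>i\<in>A. \<phi> i z) = (\<Sum>i\<in>A. \<Lambda> (\<phi> i))"
  using assms
  by (induction A rule: infinite_finite_induct) (simp_all add: Lin_add test_function_sum Lin_zero)

definition below :: "complex set \<Rightarrow> (complex \<Rightarrow> real) set" where
  "below U = {\<psi>. test_function_on (U \<inter> S) \<psi> \<and> (\<forall>z. 0 \<le> \<psi> z \<and> \<psi> z \<le> 1)}"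

definition content :: "complex set \<Rightarrow> ennreal" where
  "content U = (SUP \<psi>\<in>below U. ennreal (\<Lambda> \<psi>))"

text \<open>
  Only \<open>A \<inter> S\<close> has to be covered.  Points on the boundary of \<open>S\<close> have neighbourhoods of infinite
  content in general, and this choice makes the complement of \<open>S\<close> null nevertheless.
\<close>

definition outer :: "complex set \<Rightarrow> ennreal" where
  "outer A = (INF U\<in>{U. open U \<and> A \<inter> S \<subseteq> U}. content U)"

lemma belowD:
  assumes "\<psi> \<in> below U"
  shows "test_function_on S \<psi>" "0 \<le> \<psi> z" "\<psi> z \<le> 1" "supp \<psi> \<subseteq> U" "z \<notin> U \<Longrightarrow> \<psi> z = 0"
proof -
  show "test_function_on S \<psi>" "0 \<le> \<psi> z" "\<psi> z \<le> 1"
    using assms by (auto simp: below_def intro: test_function_mono)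
  show "supp \<psi> \<subseteq> U"
    using assms test_function_supp[of "U \<inter> S" \<psi>] unfolding below_def by blast
  then show "z \<notin> U \<Longrightarrow> \<psi> z = 0"
    using notin_supp[of z \<psi>] by blast
qed

lemma below_mono: "U \<inter> S \<subseteq> V \<Longrightarrow> below U \<subseteq> below V"
  unfolding below_def using test_function_mono[of "U \<inter> S" _ "V \<inter> S"] by blast

lemma content_mono: "U \<inter> S \<subseteq> V \<Longrightarrow> content U \<le> content V"
  unfolding content_def using below_mono by (blast intro: SUP_subset_mono)

lemma content_upper: "\<psi> \<in> below U \<Longrightarrow> ennreal (\<Lambda> \<psi>) \<le> content U"
  unfolding content_def by (rule SUP_upper)

lemma content_le:
  assumes "test_function_on S g" "\<And>z. 0 \<le> g z" "\<And>z. z \<in> U \<Longrightarrow> 1 \<le> g z"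
  shows "content U \<le> ennreal (\<Lambda> g)"
  unfolding content_def
proof (rule SUP_least)
  fix \<psi> assume \<psi>: "\<psi> \<in> below U"
  have "\<psi> z \<le> g z" for z
    using belowD(2,3,5)[OF \<psi>, of z] assms(2,3)[of z] by (cases "z \<in> U") auto
  then show "ennreal (\<Lambda> \<psi>) \<le> ennreal (\<Lambda> g)"
    using belowD(1)[OF \<psi>] assms(1) by (intro ennreal_leI Lin_mono)
qed

lemma content_empty: "content {} = 0"
  using content_le[OF test_function_zero, of "{}"] Lin_zero by simp

lemma outer_open: "open U \<Longrightarrow> outer U = content U"
  unfolding outer_def
  by (rule antisym, rule INF_lower) (auto intro!: INF_greatest content_mono)

text \<open>
  A function below the indicator of \<open>U \<union> V\<close> splits into one below that of \<open>U\<close> and one below that of \<open>V\<close>.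
  A single cutoff does it: the part of the support outside \<open>V\<close> is a compact subset of \<open>U\<close>.
\<close>

lemma content_Un:
  assumes "open U" "open V"
  shows "content (U \<union> V) \<le> content U + content V"
  unfolding content_def[of "U \<union> V"]
proof (rule SUP_least)
  fix \<psi> assume \<psi>: "\<psi> \<in> below (U \<union> V)"
  note test = belowD(1)[OF \<psi>]
  have K: "compact (supp \<psi>)" "supp \<psi> \<subseteq> S" "supp \<psi> \<subseteq> U \<union> V"
    using test_function_compact[OF test] test_function_supp[OF test] belowD(4)[OF \<psi>] by auto
  have "compact (supp \<psi> - V)" "supp \<psi> - V \<subseteq> U \<inter> S"
    using K assms(2) by (auto intro: compact_diff)
  then obtain g W where g: "test_function_on (U \<inter> S) g" "\<And>z. 0 \<le> g z" "\<And>z. g z \<le> 1"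
    "open W" "supp \<psi> - V \<subseteq> W" "W \<subseteq> U \<inter> S" "\<And>z. z \<in> W \<Longrightarrow> g z = 1"
    using smooth_Urysohn[of "supp \<psi> - V" "U \<inter> S"] assms(1) open_S by (metis open_Int)
  have sg: "smooth g" "smooth (\<lambda>z. 1 - g z)"
    using test_function_smooth[OF g(1)] smooth_diff[OF smooth_const] by blast+
  have "(\<lambda>z. \<psi> z * g z) \<in> below U"
    using test_function_mult[OF g(1) test_function_smooth[OF test]] belowD(2,3)[OF \<psi>] g(2,3)
    by (auto simp: below_def mult.commute mult_le_one)
  note g1 = this
  have g2: "(\<lambda>z. \<psi> z * (1 - g z)) \<in> below V"
  proof -
    have "test_function_on (V \<inter> S) (\<lambda>z. \<psi> z * (1 - g z))"
    proof (rule test_functionI)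
      show "smooth (\<lambda>z. \<psi> z * (1 - g z))"
        using test_function_smooth[OF test] sg by (intro smooth_mult)
      show "compact (supp \<psi> - W)" using K g(4) by (auto intro: compact_diff)
      show "supp \<psi> - W \<subseteq> V \<inter> S" using K g(5) by blast
      show "\<psi> z * (1 - g z) = 0" if "z \<notin> supp \<psi> - W" for z
        using g(7)[of z] notin_supp[of z \<psi>] that by auto
    qed
    then show ?thesis
      using belowD(2,3)[OF \<psi>] g(2,3) by (auto simp: below_def mult_le_one)
  qed
  have "\<Lambda> \<psi> = \<Lambda> (\<lambda>z. \<psi> z * g z) + \<Lambda> (\<lambda>z. \<psi> z * (1 - g z))"
    using Lin_add[OF test_function_mult[OF test sg(1)] test_function_mult[OF test sg(2)]]
    by (simp add: algebra_simps)
  also have "ennreal \<dots> = ennreal (\<Lambda> (\<lambda>z. \<psi> z * g z)) + ennreal (\<Lambda> (\<lambda>z. \<psi> z * (1 - g z)))"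
    by (intro ennreal_plus Lin_nonneg belowD(1,2)[OF g1] belowD(1,2)[OF g2])
  also have "\<dots> \<le> content U + content V"
    by (intro add_mono content_upper g1 g2)
  finally show "ennreal (\<Lambda> \<psi>) \<le> content U + content V" .
qed

lemma content_UN_finite:
  assumes "\<And>i. open (U i)"
  shows "content (\<Union>i<n. U i) \<le> (\<Sum>i<(n::nat). content (U i))"
proof (induction n)
  case (Suc n)
  have "content (\<Union>i<Suc n. U i) \<le> content (\<Union>i<n. U i) + content (U n)"
    using content_Un[of "\<Union>i<n. U i" "U n"] assms by (simp add: lessThan_Suc Un_commute open_UN)
  also have "\<dots> \<le> (\<Sum>i<Suc n. content (U i))"
    using Suc by (simp add: add_right_mono)
  finally show ?case .
qed (simp add: content_empty)

lemma content_UN: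
  assumes "\<And>i. open (U i)"
  shows "content (\<Union>i. U i) \<le> (\<Sum>i. content (U (i::nat)))"
  unfolding content_def[of "\<Union>i. U i"]
proof (rule SUP_least)
  fix \<psi> assume \<psi>: "\<psi> \<in> below (\<Union>i. U i)"
  note test = belowD(1)[OF \<psi>]
  obtain C where C: "finite C" "supp \<psi> \<subseteq> (\<Union>i\<in>C. U i)"
    by (rule compactE_image[OF test_function_compact[OF test] assms belowD(4)[OF \<psi>]])
  obtain n where n: "C \<subseteq> {..<n}"
    using C(1) unfolding finite_nat_iff_bounded by blast
  have "supp \<psi> \<subseteq> (\<Union>i<n. U i) \<inter> S"
    using order_trans[OF C(2) UN_mono[OF n subset_refl]] test_function_supp[OF test] by (rule Int_greatest)
  then have "\<psi> \<in> below (\<Union>i<n. U i)"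
    using test_function_restrict[OF test] belowD(2,3)[OF \<psi>] by (simp add: below_def)
  then have "ennreal (\<Lambda> \<psi>) \<le> content (\<Union>i<n. U i)"
    by (rule content_upper)
  also have "\<dots> \<le> (\<Sum>i<n. content (U i))"
    by (rule content_UN_finite) (rule assms)
  also have "\<dots> \<le> (\<Sum>i. content (U i))"
    by (rule sum_le_suminf) auto
  finally show "ennreal (\<Lambda> \<psi>) \<le> (\<Sum>i. content (U i))" .
qed

lemma outer_mono: "A \<subseteq> B \<Longrightarrow> outer A \<le> outer B"
  unfolding outer_def by (rule INF_superset_mono) auto

lemma outer_countably_subadditive: "outer (\<Union>i. A i) \<le> (\<Sum>i. outer (A (i::nat)))"
proof (rule ennreal_le_epsilon)
  fix e :: real assume "0 < e" "(\<Sum>n. outer (A n)) < top"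
  then have "outer (A n) < outer (A n) + e * (1/2)^Suc n" for n
    by (auto simp add: less_top dest!: ennreal_suminf_lessD)
  then have "\<exists>U. open U \<and> A n \<inter> S \<subseteq> U \<and> content U < outer (A n) + e * (1/2)^Suc n" for n
    by (auto simp add: outer_def INF_less_iff)
  then obtain U where U: "\<And>n. open (U n)" "\<And>n. A n \<inter> S \<subseteq> U n"
    "\<And>n. content (U n) < outer (A n) + e * (1/2)^Suc n"
    by metis
  have "outer (\<Union>i. A i) \<le> content (\<Union>i. U i)"
    unfolding outer_def using U by (intro INF_lower) (auto intro!: open_UN)
  also have "\<dots> \<le> (\<Sum>i. content (U i))"
    by (intro content_UN U)
  also have "\<dots> \<le> (\<Sum>n. outer (A n) + e * (1/2)^Suc n)"
    using U(3) by (intro suminf_le) (auto intro: less_imp_le)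
  also have "... = (\<Sum>n. outer (A n)) + (\<Sum>n. ennreal e * ennreal ((1/2) ^ Suc n))"
      using \<open>0 < e\<close> by (subst suminf_add[symmetric])
                       (auto simp del: ennreal_suminf_cmult simp add: ennreal_mult[symmetric])
  also have "\<dots> = (\<Sum>n. outer (A n)) + e"
      unfolding ennreal_suminf_cmult
      by (subst suminf_ennreal_eq[OF zero_le_power power_half_series]) auto
  finally show "outer (\<Union>i. A i) \<le> (\<Sum>n. outer (A n)) + e" .
qed

lemma outer_empty: "outer {} = 0"
  by (simp only: outer_open[OF open_empty] content_empty)

lemma outer_measure_space_outer: "outer_measure_space UNIV outer"
  unfolding outer_measure_space_def positive_def increasing_def countably_subadditive_def
  by (intro conjI allI ballI impI outer_empty outer_mono outer_countably_subadditive)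

text \<open>
  A function \<open>\<psi>\<close> that nearly exhausts the content of \<open>U \<inter> V\<close> has compact support, so a second function
  can be chosen below the indicator of the open set \<open>U - supp \<psi>\<close>; their sum is still below that of \<open>U\<close>.
\<close>

lemma open_in_lambda_system:
  assumes "open V"
  shows "V \<in> lambda_system UNIV UNIV outer"
proof -
  have ge: "outer (V \<inter> A) + outer ((UNIV - V) \<inter> A) \<le> outer A" for A
    unfolding outer_def[of A]
  proof (rule INF_greatest, clarify)
    fix U assume U: "open U" "A \<inter> S \<subseteq> U"
    have "outer (V \<inter> A) \<le> content (U \<inter> V)"
      unfolding outer_def using U assms by (intro INF_lower) auto
    then have "outer (V \<inter> A) + outer ((UNIV - V) \<inter> A) \<le> content (U \<inter> V) + outer ((UNIV - V) \<inter> A)"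
      by (rule add_right_mono)
    also have "\<dots> = (SUP \<psi>\<in>below (U \<inter> V). ennreal (\<Lambda> \<psi>) + outer ((UNIV - V) \<inter> A))"
    proof -
      have "(\<lambda>_. 0) \<in> below (U \<inter> V)"
        by (auto simp: below_def test_function_zero)
      then show ?thesis
        unfolding content_def by (subst ennreal_SUP_add_left) auto
    qed
    also have "\<dots> \<le> content U"
    proof (rule SUP_least)
      fix \<psi> assume \<psi>: "\<psi> \<in> below (U \<inter> V)"
      have "outer ((UNIV - V) \<inter> A) \<le> content (U - supp \<psi>)"
        unfolding outer_def using U belowD(4)[OF \<psi>] by (intro INF_lower) auto
      then have "ennreal (\<Lambda> \<psi>) + outer ((UNIV - V) \<inter> A) \<le> ennreal (\<Lambda> \<psi>) + content (U - supp \<psi>)"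
        by (rule add_left_mono)
      also have "\<dots> = (SUP \<phi>\<in>below (U - supp \<psi>). ennreal (\<Lambda> \<psi>) + ennreal (\<Lambda> \<phi>))"
      proof -
        have "(\<lambda>_. 0) \<in> below (U - supp \<psi>)"
          by (auto simp: below_def test_function_zero)
        then show ?thesis
          unfolding content_def by (subst ennreal_SUP_add_right) auto
      qed
      also have "\<dots> \<le> content U"
      proof (rule SUP_least)
        fix \<phi> assume \<phi>: "\<phi> \<in> below (U - supp \<psi>)"
        have "\<psi> z + \<phi> z \<le> 1" for z
          using belowD(3)[OF \<psi>, of z] belowD(3)[OF \<phi>, of z] belowD(5)[OF \<phi>, of z]
          notin_supp[of z \<psi>] by (cases "z \<in> supp \<psi>") auto
        moreover have "test_function_on (U \<inter> S) (\<lambda>z. \<psi> z + \<phi> z)"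
          using \<psi> \<phi> by (intro test_function_add) (auto simp: below_def elim!: test_function_mono)
        ultimately have "(\<lambda>z. \<psi> z + \<phi> z) \<in> below U"
          using belowD(2)[OF \<psi>] belowD(2)[OF \<phi>] by (auto simp: below_def)
        from content_upper[OF this] show "ennreal (\<Lambda> \<psi>) + ennreal (\<Lambda> \<phi>) \<le> content U"
          using Lin_nonneg[OF belowD(1,2)[OF \<psi>]] Lin_nonneg[OF belowD(1,2)[OF \<phi>]]
          by (simp add: Lin_add[OF belowD(1)[OF \<psi>] belowD(1)[OF \<phi>]] ennreal_plus)
      qed
      finally show "ennreal (\<Lambda> \<psi>) + outer ((UNIV - V) \<inter> A) \<le> content U" .
    qed
    finally show "outer (V \<inter> A) + outer ((UNIV - V) \<inter> A) \<le> content U" .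
  qed
  have le: "outer A \<le> outer (V \<inter> A) + outer ((UNIV - V) \<inter> A)" for A
  proof -
    have "(\<Union>i. binaryset (V \<inter> A) ((UNIV - V) \<inter> A) i) = A"
      by (auto simp: UN_binaryset_eq)
    then have "outer A \<le> (\<Sum>i. outer (binaryset (V \<inter> A) ((UNIV - V) \<inter> A) i))"
      using outer_countably_subadditive[of "binaryset (V \<inter> A) ((UNIV - V) \<inter> A)"] by simp
    also have "\<dots> = outer (V \<inter> A) + outer ((UNIV - V) \<inter> A)"
      by (rule suminf_binaryset_eq) (rule outer_empty)
    finally show ?thesis .
  qed
  show ?thesis
    unfolding lambda_system_def using ge le by (auto intro: antisym)
qed

definition rep_measure :: "complex measure" where
  "rep_measure = measure_of UNIV (sets borel) outer"

lemma sets_rep_measure [measurable_cong, simp]: "sets rep_measure = sets borel"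
  using sets.sigma_sets_eq[of "borel :: complex measure"] by (simp add: rep_measure_def)

lemma emeasure_rep_measure: "A \<in> sets borel \<Longrightarrow> emeasure rep_measure A = outer A"
proof -
  interpret sigma_algebra UNIV "UNIV :: complex set set"
    using sigma_algebra_Pow[of "UNIV :: complex set"] by simp
  have L: "measure_space UNIV (lambda_system UNIV UNIV outer) outer"
    by (rule caratheodory_lemma[OF outer_measure_space_outer])
  have "sigma_algebra UNIV (lambda_system UNIV UNIV outer)"
    using L by (simp add: measure_space_def)
  then have "sigma_sets UNIV {S. open S} \<subseteq> lambda_system UNIV UNIV outer"
    using open_in_lambda_system by (intro sigma_algebra.sigma_sets_subset) auto
  then have "sets (borel :: complex measure) \<subseteq> lambda_system UNIV UNIV outer"
    by (simp add: borel_def)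
  moreover have sb: "sigma_algebra UNIV (sets (borel :: complex measure))"
    using sets.sigma_algebra_axioms[of borel] by simp
  ultimately have "measure_space UNIV (sets borel) outer"
    using measure_down[OF L] by blast
  then show "emeasure rep_measure A = outer A" if "A \<in> sets borel"
    unfolding rep_measure_def using that
    by (intro emeasure_measure_of_sigma) (auto simp: measure_space_def)
qed

lemma emeasure_rep_measure_open: "open U \<Longrightarrow> emeasure rep_measure U = content U"
  by (simp add: emeasure_rep_measure outer_open)

lemma emeasure_rep_measure_outside: "emeasure rep_measure (- S) = 0"
proof -
  have "outer (- S) \<le> content {}"
    unfolding outer_def by (intro INF_lower) auto
  then show ?thesis
    using open_S by (simp add: emeasure_rep_measure content_empty borel_open)
qed

lemma emeasure_rep_measure_compact:
  assumes "compact K" "K \<subseteq> S"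
  shows "emeasure rep_measure K < \<infinity>"
proof -
  obtain g W where g: "test_function_on S g" "\<And>z. 0 \<le> g z" "open W" "K \<subseteq> W" "\<And>z. z \<in> W \<Longrightarrow> g z = 1"
    using smooth_Urysohn[OF assms(1) open_S assms(2)] by metis
  have "emeasure rep_measure K \<le> emeasure rep_measure W"
    using g(3,4) by (intro emeasure_mono) auto
  also have "\<dots> \<le> ennreal (\<Lambda> g)"
    using g by (simp add: emeasure_rep_measure_open content_le)
  finally show ?thesis
    by (auto simp: less_top[symmetric] top_unique)
qed

end

lemma integrable_compact_support:
  fixes f :: "complex \<Rightarrow> real"
  assumes "sets M = sets borel" "compact K" "emeasure M K < \<infinity>" "continuous_on UNIV f"
    "\<And>z. z \<notin> K \<Longrightarrow> f z = 0"
  shows "integrable M f"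
proof -
  have "bounded (f ` K)"
    using assms by (meson compact_continuous_image compact_imp_bounded continuous_on_subset subset_UNIV)
  then obtain B where "\<And>z. z \<in> K \<Longrightarrow> norm (f z) \<le> B"
    by (auto simp: bounded_iff)
  moreover have "f \<in> borel_measurable M"
    using borel_measurable_continuous_onI[OF assms(4)] assms(1) by (simp cong: measurable_cong_sets)
  ultimately show ?thesis
    using assms by (intro integrableI_bounded_set[where A = K and B = B])
      (auto simp: borel_compact)
qed

lemma integrable_test_function:
  assumes "sets M = sets borel" "\<And>K. compact K \<Longrightarrow> K \<subseteq> S \<Longrightarrow> emeasure M K < \<infinity>" "test_function_on S \<phi>"
  shows "integrable M \<phi>"
  by (rule integrable_compact_support[OF assms(1) test_function_compact[OF assms(3)]
        assms(2)[OF test_function_compact[OF assms(3)] test_function_supp[OF assms(3)]]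
        test_function_continuous[OF assms(3)]]) (rule notin_supp)

text \<open>
  A staircase of smooth unit steps differs from the identity by at most one step.  The argument
  \<open>2 (x - i) - 1\<close> lets the step rise only in the upper half of \<open>[i, i + 1]\<close>, so that as a function of a
  continuous \<open>x\<close> its support lies inside the open set \<open>{x > i}\<close>.
\<close>

lemma sum_steps_approx:
  assumes "0 \<le> x" "x \<le> real N"
  shows "\<bar>(\<Sum>i<N. smooth_step (2 * (x - real i) - 1)) - x\<bar> \<le> 1"
proof -
  have full: "(\<Sum>i<n. smooth_step (2 * (x - real i) - 1)) = real n" if "x \<ge> real n" for n
    using that by (induction n) (auto simp: smooth_step_eq_1)
  show ?thesis
    using assms(2)
  proof (induction N)
    case (Suc N)
    show ?case
    proof (cases "x \<le> real N")
      case True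
      then show ?thesis using Suc.IH by (simp add: smooth_step_eq_0)
    next
      case False
      then show ?thesis
        using full[of N] Suc.prems smooth_step_nonneg[of "2 * (x - real N) - 1"]
          smooth_step_le_1[of "2 * (x - real N) - 1"] by auto
    qed
  qed (use assms in auto)
qed

context positive_functional
begin

text \<open>
  A layer-cake argument.  The layers \<open>g\<^sub>i\<close> of height \<open>\<delta>\<close> satisfy \<open>1\<^bsub>U(i+1)\<^esub> \<le> g\<^sub>i \<le> 1\<^bsub>U(i)\<^esub>\<close> with
  \<open>U(i) = {\<psi> > \<delta> i}\<close>, so the functional and the integral of each of them lie between the measures of
  the two open sets.  The sum of these gaps telescopes and \<open>\<psi>\<close> differs from the sum of the layers by at
  most \<open>\<delta>\<close>; both errors vanish with \<open>\<delta>\<close>.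
\<close>

lemma integral_rep_measure_nonneg:
  assumes \<psi>: "test_function_on S \<psi>" "\<And>z. 0 \<le> \<psi> z"
  shows "(\<integral>z. \<psi> z \<partial>rep_measure) = \<Lambda> \<psi>"
proof -
  have int: "integrable rep_measure \<phi>" if "test_function_on S \<phi>" for \<phi>
    using sets_rep_measure emeasure_rep_measure_compact that by (rule integrable_test_function)
  obtain \<eta> W where \<eta>: "test_function_on S \<eta>" "\<And>z. 0 \<le> \<eta> z" "supp \<psi> \<subseteq> W" "\<And>z. z \<in> W \<Longrightarrow> \<eta> z = 1"
    using smooth_Urysohn[OF test_function_compact[OF \<psi>(1)] open_S test_function_supp[OF \<psi>(1)]] by metis
  obtain B where B: "0 \<le> B" "\<And>z. \<bar>\<psi> z\<bar> \<le> B"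
    using test_function_bounded[OF \<psi>(1)] by metis
  define m where "m = measure rep_measure {z. \<psi> z > 0}"
  have op: "open {z. \<psi> z > c}" for c
    using test_function_continuous[OF \<psi>(1)] by (intro open_Collect_less) auto
  have sub: "{z. \<psi> z > 0} \<subseteq> supp \<psi>"
  proof
    fix z assume "z \<in> {z. \<psi> z > 0}"
    then show "z \<in> supp \<psi>" using notin_supp[of z \<psi>] by auto
  qed
  have fin: "emeasure rep_measure {z. \<psi> z > 0} < \<infinity>"
    using emeasure_mono[OF sub, of rep_measure] emeasure_rep_measure_compact[OF test_function_compact[OF \<psi>(1)] test_function_supp[OF \<psi>(1)]]
    by (auto simp: borel_closed)
  have est: "\<bar>\<Lambda> \<psi> - (\<integral>z. \<psi> z \<partial>rep_measure)\<bar> \<le> \<delta> * (\<Lambda> \<eta> + (\<integral>z. \<eta> z \<partial>rep_measure) + m)" if "\<delta> > 0" for \<delta>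
  proof -
    obtain N where N0: "B / \<delta> \<le> real N"
      using real_arch_simple by blast
    have N: "\<psi> z / \<delta> \<le> real N" for z
    proof -
      have "\<psi> z / \<delta> \<le> B / \<delta>"
        using B(2)[of z] that by (intro divide_right_mono) auto
      then show ?thesis using N0 by simp
    qed
    define U where "U i = {z. \<psi> z > \<delta> * real i}" for i
    define g where "g i z = smooth_step (2 * (\<psi> z / \<delta> - real i) - 1)" for i z
    have g01: "0 \<le> g i z" "g i z \<le> 1" for i z
      by (simp_all add: g_def smooth_step_nonneg smooth_step_le_1)
    have cont: "continuous_on UNIV \<psi>"
      by (rule test_function_continuous[OF \<psi>(1)])
    have g_below: "g i \<in> below (U i)" for i
    proof -
      have "test_function_on (U i \<inter> S) (g i)"
      proof (rule test_functionI)
        have "smooth (\<lambda>z. 2 * (\<psi> z * (1 / \<delta>) - real i) - 1)"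
          by (intro smooth_diff smooth_mult smooth_const test_function_smooth[OF \<psi>(1)])
        then show "smooth (g i)"
          unfolding g_def using higher_differentiable_smooth_step by simp
        have "closed {z. \<psi> z \<ge> \<delta> * (real i + 1 / 2)}"
          using cont by (intro closed_Collect_le) auto
        then show "compact (supp \<psi> \<inter> {z. \<psi> z \<ge> \<delta> * (real i + 1 / 2)})"
          using test_function_compact[OF \<psi>(1)] by (intro compact_Int_closed) 
        show "supp \<psi> \<inter> {z. \<psi> z \<ge> \<delta> * (real i + 1 / 2)} \<subseteq> U i \<inter> S"
          using test_function_supp[OF \<psi>(1)] that by (auto simp: U_def algebra_simps)
        show "g i z = 0" if "z \<notin> supp \<psi> \<inter> {z. \<psi> z \<ge> \<delta> * (real i + 1 / 2)}" for z
        proof -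
          have "\<psi> z \<le> \<delta> * (real i + 1 / 2)"
            using that notin_supp[of z \<psi>] \<open>\<delta> > 0\<close> by auto
          then have "2 * (\<psi> z / \<delta> - real i) - 1 \<le> 0"
            using \<open>\<delta> > 0\<close> by (simp add: field_simps)
          then show ?thesis by (simp add: g_def smooth_step_eq_0)
        qed
      qed
      then show ?thesis using g01 by (simp add: below_def)
    qed
    have g1: "g i z = 1" if "z \<in> U (Suc i)" for i z
    proof -
      have "2 * (\<psi> z / \<delta> - real i) - 1 \<ge> 1"
        using that \<open>\<delta> > 0\<close> by (simp add: U_def field_simps)
      then show ?thesis by (simp add: g_def smooth_step_eq_1)
    qed
    have U_sub: "U i \<subseteq> {z. \<psi> z > 0}" for i
      using that by (auto simp: U_def intro: le_less_trans[rotated])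
    have U_open: "open (U i)" for i
      using op by (simp add: U_def)
    have U_fin: "emeasure rep_measure (U i) < \<infinity>" for i
      using fin emeasure_mono[OF U_sub[of i], of rep_measure] op by (auto simp: borel_open)
    define M where "M i = measure rep_measure (U i)" for i
    have M: "content (U i) = ennreal (M i)" for i
      using U_fin[of i] unfolding M_def
      by (simp add: emeasure_rep_measure_open[OF U_open, symmetric] emeasure_eq_ennreal_measure less_top)
    have M0: "0 \<le> M i" for i by (simp add: M_def)
    have testg: "test_function_on S (g i)" for i by (rule belowD(1)[OF g_below])
    have ind: "integrable rep_measure (indicat_real (U i))" for i
      using U_fin[of i] U_open[of i] by (simp add: borel_open)
    have L: "M (Suc i) \<le> \<Lambda> (g i)" "\<Lambda> (g i) \<le> M i" for i
    proof -
      show "\<Lambda> (g i) \<le> M i"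
        using content_upper[OF g_below[of i]] M0 by (simp add: M)
      have "content (U (Suc i)) \<le> ennreal (\<Lambda> (g i))"
        using testg g01 g1 by (intro content_le) auto
      then show "M (Suc i) \<le> \<Lambda> (g i)"
        using Lin_nonneg[OF testg g01(1)] by (simp add: M)
    qed
    have I: "M (Suc i) \<le> (\<integral>z. g i z \<partial>rep_measure)" "(\<integral>z. g i z \<partial>rep_measure) \<le> M i" for i
    proof -
      have "g i z \<le> indicator (U i) z" for z
        using g01[of i z] belowD(5)[OF g_below, of z i] by (cases "z \<in> U i") auto
      then have "(\<integral>z. g i z \<partial>rep_measure) \<le> (\<integral>z. indicator (U i) z \<partial>rep_measure)"
        by (intro integral_mono int[OF testg] ind)
      then show "(\<integral>z. g i z \<partial>rep_measure) \<le> M i"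
        using U_open[of i] by (simp add: M_def borel_open)
      have "indicator (U (Suc i)) z \<le> g i z" for z
        using g01[of i z] g1[of z i] by (cases "z \<in> U (Suc i)") auto
      then have "(\<integral>z. indicator (U (Suc i)) z \<partial>rep_measure) \<le> (\<integral>z. g i z \<partial>rep_measure)"
        by (intro integral_mono int[OF testg] ind)
      then show "M (Suc i) \<le> (\<integral>z. g i z \<partial>rep_measure)"
        using U_open[of "Suc i"] by (simp add: M_def borel_open)
    qed
    define G where "G z = (\<Sum>i<N. g i z)" for z
    have testG: "test_function_on S G"
      unfolding G_def using testg by (intro test_function_sum)
    have tel: "(\<Sum>i<N. M i) - (\<Sum>i<N. M (Suc i)) \<le> m"
    proof -
      have "(\<Sum>i<N. M i) - (\<Sum>i<N. M (Suc i)) = M 0 - M N"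
        using sum_lessThan_telescope'[of M N] by (simp add: sum_subtractf)
      moreover have "M 0 = m" by (simp add: M_def m_def U_def)
      ultimately show ?thesis using M0[of N] by simp
    qed
    have "\<Lambda> G = (\<Sum>i<N. \<Lambda> (g i))" "(\<integral>z. G z \<partial>rep_measure) = (\<Sum>i<N. \<integral>z. g i z \<partial>rep_measure)"
      unfolding G_def using testg int[OF testg] by (auto intro: Lin_sum)
    moreover have "(\<Sum>i<N. M (Suc i)) \<le> (\<Sum>i<N. \<Lambda> (g i))" "(\<Sum>i<N. \<Lambda> (g i)) \<le> (\<Sum>i<N. M i)"
      "(\<Sum>i<N. M (Suc i)) \<le> (\<Sum>i<N. \<integral>z. g i z \<partial>rep_measure)" 
      "(\<Sum>i<N. \<integral>z. g i z \<partial>rep_measure) \<le> (\<Sum>i<N. M i)"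
      using L I by (intro sum_mono; blast)+
    ultimately have GG: "\<bar>\<Lambda> G - (\<integral>z. G z \<partial>rep_measure)\<bar> \<le> m"
      using tel by linarith
    have close: "\<bar>G z - \<psi> z / \<delta>\<bar> \<le> \<eta> z" for z
    proof (cases "z \<in> supp \<psi>")
      case True
      then have "\<eta> z = 1" using \<eta>(3,4) by blast
      then show ?thesis
        using sum_steps_approx[of "\<psi> z / \<delta>" N] N[of z] \<psi>(2)[of z] that by (simp add: G_def g_def)
    next
      case False
      then have "\<psi> z = 0" by (rule notin_supp)
      then show ?thesis using \<eta>(2)[of z] by (simp add: G_def g_def smooth_step_eq_0)
    qed
    have c: "G z - \<eta> z \<le> 1 / \<delta> * \<psi> z" "1 / \<delta> * \<psi> z \<le> G z + \<eta> z" for z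
      using close[of z] by (auto simp: abs_le_iff)
    note t = test_function_diff[OF testG \<eta>(1)] test_function_add[OF testG \<eta>(1)] test_function_cmult[OF \<psi>(1), of "1 / \<delta>"]
    have "\<Lambda> (\<lambda>z. G z - \<eta> z) \<le> \<Lambda> (\<lambda>z. 1 / \<delta> * \<psi> z)" "\<Lambda> (\<lambda>z. 1 / \<delta> * \<psi> z) \<le> \<Lambda> (\<lambda>z. G z + \<eta> z)"
      using c t by (blast intro: Lin_mono)+
    then have 1: "\<bar>\<Lambda> G - \<Lambda> \<psi> / \<delta>\<bar> \<le> \<Lambda> \<eta>"
      using testG \<eta>(1) \<psi>(1) by (simp add: Lin_add Lin_diff Lin_cmult[of _ "1 / \<delta>", simplified] abs_le_iff)
    have "(\<integral>z. G z - \<eta> z \<partial>rep_measure) \<le> (\<integral>z. 1 / \<delta> * \<psi> z \<partial>rep_measure)"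
      "(\<integral>z. 1 / \<delta> * \<psi> z \<partial>rep_measure) \<le> (\<integral>z. G z + \<eta> z \<partial>rep_measure)"
      using c t by (blast intro: integral_mono int)+
    then have 2: "\<bar>(\<integral>z. G z \<partial>rep_measure) - (\<integral>z. \<psi> z \<partial>rep_measure) / \<delta>\<bar> \<le> (\<integral>z. \<eta> z \<partial>rep_measure)"
      using int[OF testG] int[OF \<eta>(1)] int[OF \<psi>(1)] by (simp add: abs_le_iff)
    have "\<bar>\<Lambda> \<psi> / \<delta> - (\<integral>z. \<psi> z \<partial>rep_measure) / \<delta>\<bar> \<le> \<Lambda> \<eta> + (\<integral>z. \<eta> z \<partial>rep_measure) + m"
      using 1 2 GG by linarith
    then show ?thesis
      using that by (simp add: abs_le_iff field_simps)
  qed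
  show ?thesis
  proof (rule ccontr)
    assume ne: "(\<integral>z. \<psi> z \<partial>rep_measure) \<noteq> \<Lambda> \<psi>"
    define C where "C = \<Lambda> \<eta> + (\<integral>z. \<eta> z \<partial>rep_measure) + m"
    define d where "d = \<bar>\<Lambda> \<psi> - (\<integral>z. \<psi> z \<partial>rep_measure)\<bar>"
    have C: "0 \<le> C"
      unfolding C_def m_def using Lin_nonneg[OF \<eta>(1,2)] \<eta>(2) by (intro add_nonneg_nonneg) auto
    have d: "d > 0" using ne by (simp add: d_def)
    have "d \<le> d / (2 * (C + 1)) * C"
      using est[of "d / (2 * (C + 1))"] d C by (simp add: C_def[symmetric] d_def[symmetric])
    moreover have "0 \<le> C * d" using C d by simp
    ultimately show False
      using d C by (simp add: field_simps)
  qed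
qed

text \<open>
  A multiple of a cutoff that is \<open>1\<close> on the support of \<open>\<psi>\<close> makes \<open>\<psi>\<close> nonnegative.
\<close>

theorem integral_rep_measure:
  assumes \<psi>: "test_function_on S \<psi>"
  shows "(\<integral>z. \<psi> z \<partial>rep_measure) = \<Lambda> \<psi>"
proof -
  have int: "integrable rep_measure \<phi>" if "test_function_on S \<phi>" for \<phi>
    using sets_rep_measure emeasure_rep_measure_compact that by (rule integrable_test_function)
  obtain \<eta> W where \<eta>: "test_function_on S \<eta>" "\<And>z. 0 \<le> \<eta> z" "supp \<psi> \<subseteq> W" "\<And>z. z \<in> W \<Longrightarrow> \<eta> z = 1"
    using smooth_Urysohn[OF test_function_compact[OF \<psi>(1)] open_S test_function_supp[OF \<psi>(1)]] by metis
  obtain B where B: "0 \<le> B" "\<And>z. \<bar>\<psi> z\<bar> \<le> B"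
    using test_function_bounded[OF \<psi>(1)] by metis
  have nn: "0 \<le> \<psi> z + B * \<eta> z" for z
  proof (cases "z \<in> supp \<psi>")
    case True
    then have "\<eta> z = 1" using \<eta>(3,4) by blast
    then show ?thesis using B(2)[of z] by simp
  next
    case False
    from notin_supp[OF this] show ?thesis using \<eta>(2)[of z] B(1) by simp
  qed
  have "(\<integral>z. \<psi> z + B * \<eta> z \<partial>rep_measure) = \<Lambda> (\<lambda>z. \<psi> z + B * \<eta> z)"
    by (rule integral_rep_measure_nonneg[OF test_function_add[OF \<psi> test_function_cmult[OF \<eta>(1)]] nn])
  then show ?thesis
    using integral_rep_measure_nonneg[OF \<eta>(1,2)] int[OF \<psi>] int[OF \<eta>(1)]
      Lin_add[OF \<psi> test_function_cmult[OF \<eta>(1), of B]] Lin_cmult[OF \<eta>(1), of B] by simp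
qed

end

text \<open>
  Test functions that are \<open>1\<close> on a compact \<open>K\<close> and have supports shrinking to \<open>K\<close> give the inequality
  for \<open>K\<close> by dominated convergence.  Inner regularity of the finite measures obtained by restriction to
  an exhaustion of \<open>G\<close> by compact sets extends it to Borel sets.
\<close>

lemma emeasure_le_of_test_functions:
  assumes G: "open G" and sM: "sets M = sets borel" and sN: "sets N = sets borel"
    and fM: "\<And>K. compact K \<Longrightarrow> K \<subseteq> G \<Longrightarrow> emeasure M K < \<infinity>"
    and fN: "\<And>K. compact K \<Longrightarrow> K \<subseteq> G \<Longrightarrow> emeasure N K < \<infinity>"
    and le: "\<And>\<psi>. test_function_on G \<psi> \<Longrightarrow> (\<And>z. 0 \<le> \<psi> z) \<Longrightarrow> (\<integral>z. \<psi> z \<partial>N) \<le> (\<integral>z. \<psi> z \<partial>M)"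
    and A: "A \<in> sets borel" "A \<subseteq> G"
  shows "emeasure N A \<le> emeasure M A"
proof -
  have compact: "emeasure N K \<le> emeasure M K" if K: "compact K" "K \<subseteq> G" for K
  proof (cases "K = {}")
    case False
    obtain g W where g: "test_function_on G g" "open W" "K \<subseteq> W" "\<And>z. z \<in> W \<Longrightarrow> g z = 1"
      using smooth_Urysohn[OF K(1) G K(2)] by metis
    define L where "L = supp g"
    have L: "compact L" "L \<subseteq> G"
      using test_function_compact[OF g(1)] test_function_supp[OF g(1)] by (simp_all add: L_def)
    have W: "W \<subseteq> L" using g(4) closure_subset[of "{z. g z \<noteq> 0}"] by (force simp: L_def)
    define V where "V n = W \<inter> {z. infdist z K < 1 / real (Suc n)}" for n
    have V: "open (V n)" "K \<subseteq> V n" for n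
    proof -
      show "open (V n)" unfolding V_def using g(2) by (intro open_Int open_Collect_less continuous_intros)
      show "K \<subseteq> V n" using g(3) by (auto simp: V_def)
    qed
    have "\<exists>\<psi>. test_function_on (V n) \<psi> \<and> (\<forall>z. 0 \<le> \<psi> z \<and> \<psi> z \<le> 1) \<and> (\<forall>z\<in>K. \<psi> z = 1)" for n
      using smooth_Urysohn[OF K(1) V] by (metis subsetD)
    then obtain \<psi> where \<psi>: "\<And>n. test_function_on (V n) (\<psi> n)" "\<And>n z. 0 \<le> \<psi> n z \<and> \<psi> n z \<le> 1"
      "\<And>n z. z \<in> K \<Longrightarrow> \<psi> n z = 1"
      by metis
    have VG: "V n \<subseteq> G" for n using W L by (auto simp: V_def)
    have zero: "\<psi> n z = 0" if "z \<notin> V n" for n z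
      using that test_function_supp[OF \<psi>(1)[of n]] notin_supp[of z "\<psi> n"] by blast
    have lim: "(\<lambda>n. \<psi> n z) \<longlonglongrightarrow> indicator K z" for z
    proof (cases "z \<in> K")
      case True
      then show ?thesis using \<psi>(3) by simp
    next
      case False
      then have "infdist z K > 0"
        using K(1) \<open>K \<noteq> {}\<close> by (simp add: infdist_pos_not_in_closed compact_imp_closed)
      then obtain n0 where n0: "1 / real (Suc n0) < infdist z K"
        using nat_approx_posE by blast
      have "z \<notin> V n" if "n \<ge> n0" for n
      proof -
        have "1 / real (Suc n) \<le> 1 / real (Suc n0)" using that by (intro divide_left_mono) auto
        then show ?thesis using n0 by (auto simp: V_def)
      qed
      then have "eventually (\<lambda>n. \<psi> n z = 0) sequentially"
        using zero by (auto simp: eventually_sequentially)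
      then show ?thesis using False by (simp add: tendsto_eventually)
    qed
    have conv: "(\<lambda>n. \<integral>z. \<psi> n z \<partial>Q) \<longlonglongrightarrow> measure Q K"
      if Q: "sets Q = sets borel" "\<And>K. compact K \<Longrightarrow> K \<subseteq> G \<Longrightarrow> emeasure Q K < \<infinity>" for Q
    proof -
      have "(\<lambda>n. \<integral>z. \<psi> n z \<partial>Q) \<longlonglongrightarrow> (\<integral>z. indicator K z \<partial>Q)"
      proof (rule integral_dominated_convergence)
        show "(indicat_real K) \<in> borel_measurable Q" 
          using K(1) Q(1) by (intro borel_measurable_indicator) (simp add: borel_compact)
        show "\<psi> n \<in> borel_measurable Q" for n
          using borel_measurable_continuous_onI[OF test_function_continuous[OF \<psi>(1)[of n]]] Q(1)
          by (simp cong: measurable_cong_sets)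
        show "integrable Q (indicat_real L)"
          using L Q by (simp add: borel_compact)
        show "AE z in Q. (\<lambda>n. \<psi> n z) \<longlonglongrightarrow> indicator K z"
          using lim by simp
        show "AE z in Q. norm (\<psi> n z) \<le> indicator L z" for n
        proof (rule AE_I2)
          fix z
          show "norm (\<psi> n z) \<le> indicator L z"
            using zero[of z n] \<psi>(2)[of n z] W by (cases "z \<in> V n") (auto simp: V_def)
        qed
      qed
      then show ?thesis using K(1) Q(1) by (simp add: borel_compact)
    qed
    have "measure N K \<le> measure M K"
      by (rule LIMSEQ_le[OF conv[OF sN fN] conv[OF sM fM]])
         (use le[OF test_function_mono[OF \<psi>(1) VG]] \<psi>(2) in auto)
    then show ?thesis
      using fM[OF K] fN[OF K] by (simp add: emeasure_eq_ennreal_measure less_top)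
  qed simp
  obtain C where C: "\<And>n. compact (C n)" "\<And>n. C n \<subseteq> G" "\<And>n. C n \<subseteq> interior (C (Suc n))" "\<Union>(range C) = G"
    using open_Union_compact_subsets[OF G] by metis
  have part: "emeasure N (C n \<inter> A) \<le> emeasure M A" for n
  proof -
    define N' where "N' = density N (indicator (C n))"
    have Cn: "C n \<in> sets N" using C(1) sN by (simp add: borel_compact)
    have N': "emeasure N' X = emeasure N (C n \<inter> X)" if "X \<in> sets borel" for X
      unfolding N'_def using that Cn sN by (intro emeasure_restricted) auto
    have "emeasure N' A = (SUP K\<in>{K. K \<subseteq> A \<and> compact K}. emeasure N' K)"
    proof (rule inner_regular)
      show "sets N' = sets borel" using sN by (simp add: N'_def)
      have "space N' = UNIV" using sets_eq_imp_space_eq[OF sN] by (simp add: N'_def)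
      then show "emeasure N' (space N') \<noteq> \<infinity>"
        using N'[of UNIV] fN[OF C(1,2), of n] by (simp add: less_top)
    qed (rule A)
    also have "\<dots> \<le> emeasure M A"
    proof (rule SUP_least, clarify)
      fix K assume K: "K \<subseteq> A" "compact K"
      have "emeasure N' K = emeasure N (C n \<inter> K)"
        using N' K by (simp add: borel_compact)
      also have "\<dots> \<le> emeasure M (C n \<inter> K)"
        using C(1)[of n] C(2)[of n] K by (intro compact compact_Int) auto
      also have "\<dots> \<le> emeasure M A"
        using K A sM by (intro emeasure_mono) auto
      finally show "emeasure N' K \<le> emeasure M A" .
    qed
    finally show ?thesis using N' A by simp
  qed
  have "incseq C"
    using C(3) interior_subset by (intro incseq_SucI) blast
  then have "(SUP n. emeasure N (C n \<inter> A)) = emeasure N (\<Union>n. C n \<inter> A)"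
    using A C(1) sN by (intro SUP_emeasure_incseq) (auto simp: incseq_def borel_compact)
  moreover have "(\<Union>n. C n \<inter> A) = A" using C(4) A(2) by blast
  ultimately show ?thesis using part by (metis SUP_least)
qed

lemma emeasure_eq_of_test_functions:
  assumes "open G" "sets M = sets borel" "sets N = sets borel"
    "\<And>K. compact K \<Longrightarrow> K \<subseteq> G \<Longrightarrow> emeasure M K < \<infinity>"
    "\<And>K. compact K \<Longrightarrow> K \<subseteq> G \<Longrightarrow> emeasure N K < \<infinity>"
    "\<And>\<psi>. test_function_on G \<psi> \<Longrightarrow> (\<integral>z. \<psi> z \<partial>N) = (\<integral>z. \<psi> z \<partial>M)"
    "A \<in> sets borel" "A \<subseteq> G"
  shows "emeasure N A = emeasure M A"
  using assms by (intro antisym emeasure_le_of_test_functions[of G]) auto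

section \<open>Circle means and directional derivatives\<close>

lemma sets_circle_measure [measurable_cong, simp]: "sets circle_measure = sets borel"
  by (simp add: circle_measure_def)

lemma space_circle_measure [simp]: "space circle_measure = UNIV"
  by (simp add: circle_measure_def)

lemma cis_borel_measurable [measurable]: "cis \<in> borel_measurable borel"
  by (intro borel_measurable_continuous_onI continuous_intros)

lemma emeasure_circle_measure: "emeasure circle_measure UNIV = 1"
  unfolding circle_measure_def by (subst emeasure_distr) (auto intro!: emeasure_uniform_measure_1)

lemma finite_measure_circle_measure: "finite_measure circle_measure"
  by (rule finite_measureI) (simp add: emeasure_circle_measure)

text \<open>
  Continuity is required on the unit circle only, because the measure lives there.
\<close>

lemma integral_circle_measure:
  fixes f :: "complex \<Rightarrow> 'a::euclidean_space"
  assumes [measurable]: "f \<in> borel_measurable borel" and f: "continuous_on (sphere 0 1) f"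
  shows "(\<integral>\<zeta>. f \<zeta> \<partial>circle_measure) = (1 / (2 * pi)) *\<^sub>R integral {0..2 * pi} (\<lambda>t. f (cis t))"
proof -
  have "(\<integral>\<zeta>. f \<zeta> \<partial>circle_measure) = (\<integral>t. f (cis t) \<partial>uniform_measure lborel {0..2 * pi})"
    unfolding circle_measure_def by (rule integral_distr) auto
  also have "uniform_measure lborel {0..2 * pi} = density lborel (\<lambda>t. ennreal (indicator {0..2 * pi} t / (2 * pi)))"
    unfolding uniform_measure_def
    by (intro arg_cong2[where f = density] refl ext) (auto simp: indicator_def divide_ennreal[symmetric])
  also have "(\<integral>t. f (cis t) \<partial>\<dots>) = (\<integral>t. (indicator {0..2 * pi} t / (2 * pi)) *\<^sub>R f (cis t) \<partial>lborel)"
    by (rule integral_density) auto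
  also have "\<dots> = (1 / (2 * pi)) *\<^sub>R (LINT t:{0..2 * pi}|lborel. f (cis t))"
    unfolding set_lebesgue_integral_def by (subst integral_scaleR_right[symmetric]) (simp add: mult.commute)
  also have "(LINT t:{0..2 * pi}|lborel. f (cis t)) = integral {0..2 * pi} (\<lambda>t. f (cis t))"
  proof (rule set_borel_integral_eq_integral)
    show "set_integrable lborel {0..2 * pi} (\<lambda>t. f (cis t))"
      by (intro borel_integrable_atLeastAtMost' continuous_on_compose2[OF f] continuous_intros) auto
  qed
  finally show ?thesis .
qed

lemma AE_circle_measure: "AE \<zeta> in circle_measure. norm \<zeta> = 1"
  unfolding circle_measure_def by (subst AE_distr_iff) auto

lemma circle_moments:
  shows "(\<integral>\<zeta>. Re \<zeta> \<partial>circle_measure) = 0" "(\<integral>\<zeta>. Im \<zeta> \<partial>circle_measure) = 0"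
    "(\<integral>\<zeta>. Re \<zeta> * Im \<zeta> \<partial>circle_measure) = 0"
    "(\<integral>\<zeta>. (Re \<zeta>)\<^sup>2 \<partial>circle_measure) = 1 / 2" "(\<integral>\<zeta>. (Im \<zeta>)\<^sup>2 \<partial>circle_measure) = 1 / 2"
proof -
  have I: "(\<integral>\<zeta>. f \<zeta> \<partial>circle_measure) = (F (2 * pi) - F 0) / (2 * pi)"
    if "continuous_on UNIV f" "\<And>t. (F has_real_derivative f (cis t)) (at t)" for f :: "complex \<Rightarrow> real" and F
  proof -
    have "((\<lambda>t. f (cis t)) has_integral (F (2 * pi) - F 0)) {0..2 * pi}"
      using that(2) by (intro fundamental_theorem_of_calculus)
        (auto simp: has_real_derivative_iff_has_vector_derivative[symmetric] intro: has_field_derivative_at_within)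
    then show ?thesis
      using that(1) by (subst integral_circle_measure)
        (auto intro: borel_measurable_continuous_onI continuous_on_subset dest!: integral_unique)
  qed
  show "(\<integral>\<zeta>. Re \<zeta> \<partial>circle_measure) = 0"
    by (subst I[where F = sin]) (auto intro!: continuous_intros derivative_eq_intros)
  show "(\<integral>\<zeta>. Im \<zeta> \<partial>circle_measure) = 0"
    by (subst I[where F = "\<lambda>t. - cos t"]) (auto intro!: continuous_intros derivative_eq_intros)
  show "(\<integral>\<zeta>. Re \<zeta> * Im \<zeta> \<partial>circle_measure) = 0"
    by (subst I[where F = "\<lambda>t. (sin t)\<^sup>2 / 2"]) (auto intro!: continuous_intros derivative_eq_intros)
  have e: "sin t * sin t = 1 - cos t * cos t" for t :: real
    by (metis sin_cos_squared_add3 add_diff_cancel_left' add_diff_cancel_right')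
  show "(\<integral>\<zeta>. (Re \<zeta>)\<^sup>2 \<partial>circle_measure) = 1 / 2"
  proof (subst I[where F = "\<lambda>t. (t + sin t * cos t) / 2"])
    show "((\<lambda>t. (t + sin t * cos t) / 2) has_real_derivative (Re (cis t))\<^sup>2) (at t)" for t
      by (rule derivative_eq_intros refl | simp)+ (simp add: e power2_eq_square field_simps)
  qed (auto intro!: continuous_intros)
  show "(\<integral>\<zeta>. (Im \<zeta>)\<^sup>2 \<partial>circle_measure) = 1 / 2"
  proof (subst I[where F = "\<lambda>t. (t - sin t * cos t) / 2"])
    show "((\<lambda>t. (t - sin t * cos t) / 2) has_real_derivative (Im (cis t))\<^sup>2) (at t)" for t
      by (rule derivative_eq_intros refl | simp)+ (simp add: e power2_eq_square field_simps)
  qed (auto intro!: continuous_intros)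
qed

lemma smooth_has_derivative:
  assumes "smooth \<phi>" shows "(\<phi> has_derivative (\<lambda>v. directional_deriv v \<phi> z)) (at z)"
  using has_derivative_frechet[of 0 \<phi> z] assms by (simp add: directional_deriv_def)

lemma directional_derivI:
  "(\<phi> has_derivative D) (at z) \<Longrightarrow> directional_deriv v \<phi> z = D v"
  unfolding directional_deriv_def by (rule frechet_derivative_eqI)

lemma smooth_directional_deriv: "smooth \<phi> \<Longrightarrow> smooth (directional_deriv v \<phi>)"
  unfolding directional_deriv_def using higher_differentiable_frechet by blast

lemma directional_deriv_linear:
  assumes "smooth \<phi>"
  shows "directional_deriv v \<phi> z = Re v * directional_deriv 1 \<phi> z + Im v * directional_deriv \<i> \<phi> z"
proof -
  interpret bounded_linear "\<lambda>v. directional_deriv v \<phi> z"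
    using smooth_has_derivative[OF assms] by (rule has_derivative_bounded_linear)
  have "v = Re v *\<^sub>R 1 + Im v *\<^sub>R \<i>"
    by (simp add: complex_eq_iff)
  then have "directional_deriv v \<phi> z = directional_deriv (Re v *\<^sub>R 1 + Im v *\<^sub>R \<i>) \<phi> z"
    by simp
  then show ?thesis by (simp add: add scaleR)
qed

lemma directional_deriv_add:
  assumes "smooth \<phi>" "smooth \<psi>"
  shows "directional_deriv v (\<lambda>z. \<phi> z + \<psi> z) = (\<lambda>z. directional_deriv v \<phi> z + directional_deriv v \<psi> z)"
  by (rule ext, rule directional_derivI) (intro has_derivative_add smooth_has_derivative assms)

lemma directional_deriv_mult:
  assumes "smooth \<phi>" "smooth \<psi>"
  shows "directional_deriv v (\<lambda>z. \<phi> z * \<psi> z) = (\<lambda>z. \<phi> z * directional_deriv v \<psi> z + directional_deriv v \<phi> z * \<psi> z)"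
  by (rule ext, rule directional_derivI) (intro has_derivative_mult smooth_has_derivative assms)

lemma directional_deriv_cmult:
  assumes "smooth \<phi>"
  shows "directional_deriv v (\<lambda>z. c * \<phi> z) = (\<lambda>z. c * directional_deriv v \<phi> z)"
  by (rule ext, rule directional_derivI) (intro has_derivative_mult_right smooth_has_derivative assms)

lemma directional_deriv_cong_open:
  assumes "open U" "z \<in> U" "\<And>y. y \<in> U \<Longrightarrow> f y = g y"
  shows "directional_deriv v f z = directional_deriv v g z"
proof -
  have "(f has_derivative D) (at z) \<longleftrightarrow> (g has_derivative D) (at z)" for D
    using has_derivative_transform_within_open[OF _ assms(1,2), of f D UNIV g]
      has_derivative_transform_within_open[OF _ assms(1,2), of g D UNIV f] assms(3) by auto
  then show ?thesis
    by (simp add: directional_deriv_def frechet_derivative_def)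
qed

lemma laplacian_cong_open:
  assumes "open U" "z \<in> U" "\<And>y. y \<in> U \<Longrightarrow> f y = g y"
  shows "laplacian f z = laplacian g z"
  unfolding laplacian_def
  using directional_deriv_cong_open[OF assms(1) _ assms(3)]
  by (intro arg_cong2[where f = "(+)"] directional_deriv_cong_open[OF assms(1,2)]) auto

lemma laplacian_add:
  "smooth \<phi> \<Longrightarrow> smooth \<psi> \<Longrightarrow> laplacian (\<lambda>z. \<phi> z + \<psi> z) z = laplacian \<phi> z + laplacian \<psi> z"
  by (simp add: laplacian_def directional_deriv_add smooth_directional_deriv)

lemma laplacian_cmult: "smooth \<phi> \<Longrightarrow> laplacian (\<lambda>z. c * \<phi> z) z = c * laplacian \<phi> z"
  by (simp add: laplacian_def directional_deriv_cmult smooth_directional_deriv algebra_simps)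

lemma test_function_directional_deriv:
  assumes "test_function_on S \<phi>"
  shows "test_function_on S (directional_deriv v \<phi>)"
proof (rule test_functionI[OF _ test_function_compact[OF assms] test_function_supp[OF assms]])
  show "smooth (directional_deriv v \<phi>)"
    by (rule smooth_directional_deriv[OF test_function_smooth[OF assms]])
  show "directional_deriv v \<phi> z = 0" if "z \<notin> supp \<phi>" for z
  proof -
    have "directional_deriv v \<phi> z = directional_deriv v (\<lambda>_. 0) z"
    proof (rule directional_deriv_cong_open)
      show "open (- supp \<phi>)" "z \<in> - supp \<phi>" using that by auto
      show "\<phi> y = 0" if "y \<in> - supp \<phi>" for y using that by (intro notin_supp) simp
    qed
    also have "\<dots> = 0" by (rule directional_derivI) simp
    finally show ?thesis .
  qed
qed

lemma test_function_laplacian: "test_function_on S \<phi> \<Longrightarrow> test_function_on S (laplacian \<phi>)"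
  unfolding laplacian_def [abs_def] by (intro test_function_add test_function_directional_deriv)

lemma directional_deriv_bounded:
  assumes "test_function_on S \<phi>"
  obtains C where "0 \<le> C" "\<And>v z. norm v = 1 \<Longrightarrow> \<bar>directional_deriv v \<phi> z\<bar> \<le> C"
proof -
  obtain C1 where C1: "0 \<le> C1" "\<And>z. \<bar>directional_deriv 1 \<phi> z\<bar> \<le> C1"
    using test_function_bounded[OF test_function_directional_deriv[OF assms]] by metis
  obtain C2 where C2: "0 \<le> C2" "\<And>z. \<bar>directional_deriv \<i> \<phi> z\<bar> \<le> C2"
    using test_function_bounded[OF test_function_directional_deriv[OF assms]] by metis
  show thesis
  proof (rule that[of "C1 + C2"])
    fix v z :: complex assume v: "norm v = 1"
    have "\<bar>Re v\<bar> \<le> 1" "\<bar>Im v\<bar> \<le> 1"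
      using abs_Re_le_cmod[of v] abs_Im_le_cmod[of v] v by auto
    then have "\<bar>Re v * directional_deriv 1 \<phi> z\<bar> \<le> 1 * C1" "\<bar>Im v * directional_deriv \<i> \<phi> z\<bar> \<le> 1 * C2"
      unfolding abs_mult using C1 C2 by (intro mult_mono; simp)+
    then show "\<bar>directional_deriv v \<phi> z\<bar> \<le> C1 + C2"
      unfolding directional_deriv_linear[OF test_function_smooth[OF assms], of v] by linarith
  qed (use C1 C2 in auto)
qed

lemma second_directional_deriv:
  assumes "smooth \<phi>"
  shows "directional_deriv v (directional_deriv v \<phi>) = (\<lambda>z. (Re v)\<^sup>2 * directional_deriv 1 (directional_deriv 1 \<phi>) z
     + (Re v * Im v) * (directional_deriv 1 (directional_deriv \<i> \<phi>) z + directional_deriv \<i> (directional_deriv 1 \<phi>) z)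
     + (Im v)\<^sup>2 * directional_deriv \<i> (directional_deriv \<i> \<phi>) z)"
proof
  fix z
  note sm = smooth_directional_deriv[OF assms]
  have e: "directional_deriv v \<phi> = (\<lambda>z. Re v * directional_deriv 1 \<phi> z + Im v * directional_deriv \<i> \<phi> z)"
    using directional_deriv_linear[OF assms] by blast
  have "directional_deriv v (directional_deriv v \<phi>) z =
     Re v * directional_deriv v (directional_deriv 1 \<phi>) z + Im v * directional_deriv v (directional_deriv \<i> \<phi>) z"
    by (simp only: e) (simp add: directional_deriv_add[OF smooth_mult[OF smooth_const sm] smooth_mult[OF smooth_const sm]]
        directional_deriv_cmult[OF sm])
  then show "directional_deriv v (directional_deriv v \<phi>) z = (Re v)\<^sup>2 * directional_deriv 1 (directional_deriv 1 \<phi>) z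
     + (Re v * Im v) * (directional_deriv 1 (directional_deriv \<i> \<phi>) z + directional_deriv \<i> (directional_deriv 1 \<phi>) z)
     + (Im v)\<^sup>2 * directional_deriv \<i> (directional_deriv \<i> \<phi>) z"
    unfolding directional_deriv_linear[OF sm, of v] by (simp add: algebra_simps power2_eq_square)
qed

text \<open>
  The bound is uniform in the direction \<open>v\<close>: the third derivative is a polynomial in the coordinates
  of \<open>v\<close> whose coefficients are test functions.
\<close>

lemma third_directional_deriv_bounded:
  assumes "test_function_on S \<phi>"
  obtains C where "0 \<le> C"
    "\<And>v z. norm v = 1 \<Longrightarrow> \<bar>directional_deriv v (directional_deriv v (directional_deriv v \<phi>)) z\<bar> \<le> C"
proof -
  define P where "P = directional_deriv 1 (directional_deriv 1 \<phi>)"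
  define Q where "Q = (\<lambda>z. directional_deriv 1 (directional_deriv \<i> \<phi>) z + directional_deriv \<i> (directional_deriv 1 \<phi>) z)"
  define R where "R = directional_deriv \<i> (directional_deriv \<i> \<phi>)"
  have t: "test_function_on S P" "test_function_on S Q" "test_function_on S R"
    unfolding P_def Q_def R_def by (intro test_function_add test_function_directional_deriv assms)+
  note sm = t[THEN test_function_smooth]
  obtain C1 where C1: "0 \<le> C1" "\<And>v z. norm v = 1 \<Longrightarrow> \<bar>directional_deriv v P z\<bar> \<le> C1"
    using directional_deriv_bounded[OF t(1)] by metis
  obtain C2 where C2: "0 \<le> C2" "\<And>v z. norm v = 1 \<Longrightarrow> \<bar>directional_deriv v Q z\<bar> \<le> C2"
    using directional_deriv_bounded[OF t(2)] by metis
  obtain C3 where C3: "0 \<le> C3" "\<And>v z. norm v = 1 \<Longrightarrow> \<bar>directional_deriv v R z\<bar> \<le> C3"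
    using directional_deriv_bounded[OF t(3)] by metis
  show thesis
  proof (rule that[of "C1 + C2 + C3"])
    fix v z :: complex assume v: "norm v = 1"
    have v1: "\<bar>Re v\<bar> \<le> 1" "\<bar>Im v\<bar> \<le> 1"
      using abs_Re_le_cmod[of v] abs_Im_le_cmod[of v] v by auto
    have v2: "\<bar>(Re v)\<^sup>2\<bar> \<le> 1" "\<bar>Re v * Im v\<bar> \<le> 1" "\<bar>(Im v)\<^sup>2\<bar> \<le> 1"
      using v1 by (auto simp: abs_mult abs_square_le_1 mult_le_one)
    have "directional_deriv v (directional_deriv v \<phi>) = (\<lambda>z. (Re v)\<^sup>2 * P z + (Re v * Im v) * Q z + (Im v)\<^sup>2 * R z)"
      unfolding P_def Q_def R_def by (rule second_directional_deriv[OF test_function_smooth[OF assms]])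
    then have e: "directional_deriv v (directional_deriv v (directional_deriv v \<phi>)) z =
       (Re v)\<^sup>2 * directional_deriv v P z + (Re v * Im v) * directional_deriv v Q z + (Im v)\<^sup>2 * directional_deriv v R z"
      by (simp add: directional_deriv_add directional_deriv_cmult sm smooth_add smooth_mult smooth_const)
    have "\<bar>(Re v)\<^sup>2 * directional_deriv v P z\<bar> \<le> 1 * C1" "\<bar>(Re v * Im v) * directional_deriv v Q z\<bar> \<le> 1 * C2"
      "\<bar>(Im v)\<^sup>2 * directional_deriv v R z\<bar> \<le> 1 * C3"
      unfolding abs_mult[of "(Re v)\<^sup>2"] abs_mult[of "Re v * Im v"] abs_mult[of "(Im v)\<^sup>2"]
      using C1(2)[OF v, of z] C2(2)[OF v, of z] C3(2)[OF v, of z] v2 by (intro mult_mono; simp)+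
    then show "\<bar>directional_deriv v (directional_deriv v (directional_deriv v \<phi>)) z\<bar> \<le> C1 + C2 + C3"
      unfolding e by linarith
  qed (use C1 C2 C3 in auto)
qed

lemma smooth_taylor:
  assumes "smooth \<phi>" "\<And>z. \<bar>directional_deriv v (directional_deriv v (directional_deriv v \<phi>)) z\<bar> \<le> C"
    and "0 < \<rho>"
  shows "\<bar>\<phi> (z + of_real \<rho> * v) - \<phi> z - \<rho> * directional_deriv v \<phi> z
      - \<rho>\<^sup>2 / 2 * directional_deriv v (directional_deriv v \<phi>) z\<bar> \<le> C * \<rho> ^ 3"
proof -
  define d where "d m t = ((directional_deriv v ^^ m) \<phi>) (z + of_real t * v)" for m t
  have sm: "smooth ((directional_deriv v ^^ m) \<phi>)" for m
    by (induction m) (use assms(1) smooth_directional_deriv in auto)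
  have D: "(d m has_real_derivative d (Suc m) t) (at t)" for m t
  proof -
    have "((\<lambda>t. z + of_real t * v) has_derivative (\<lambda>h. of_real h * v)) (at t)"
      by (auto intro!: derivative_eq_intros)
    from has_derivative_compose[OF this smooth_has_derivative[OF sm[of m]]]
    have "(d m has_derivative (\<lambda>h. directional_deriv (of_real h * v) ((directional_deriv v ^^ m) \<phi>) (z + of_real t * v))) (at t)"
      unfolding d_def .
    moreover have "directional_deriv (of_real h * v) ((directional_deriv v ^^ m) \<phi>) (z + of_real t * v) = d (Suc m) t * h" for h
    proof -
      interpret bounded_linear "\<lambda>w. directional_deriv w ((directional_deriv v ^^ m) \<phi>) (z + of_real t * v)"
        using smooth_has_derivative[OF sm[of m]] by (rule has_derivative_bounded_linear)
      show ?thesis using scaleR[of h v] by (simp add: d_def scaleR_conv_of_real)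
    qed
    ultimately show ?thesis
      by (simp add: has_field_derivative_def)
  qed
  obtain t where "d 0 \<rho> = (\<Sum>m<3. d m 0 / fact m * \<rho> ^ m) + d 3 t / fact 3 * \<rho> ^ 3"
    using Maclaurin2[OF assms(3), of d "d 0" 3] D by blast
  then have "d 0 \<rho> - d 0 0 - \<rho> * d 1 0 - \<rho>\<^sup>2 / 2 * d 2 0 = d 3 t / 6 * \<rho> ^ 3"
    by (simp add: eval_nat_numeral algebra_simps)
  moreover have "\<bar>d 3 t\<bar> \<le> C"
    using assms(2) by (simp add: d_def eval_nat_numeral)
  then have "\<bar>d 3 t / 6 * \<rho> ^ 3\<bar> \<le> C * \<rho> ^ 3"
    unfolding abs_mult using assms(3) by (intro mult_mono) auto
  ultimately show ?thesis
    by (simp add: d_def eval_nat_numeral)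
qed

section \<open>The sub-mean value inequality and the Laplacian\<close>

lemma integrable_on_circle:
  assumes "f \<in> borel_measurable borel" "\<And>\<zeta>. norm \<zeta> = 1 \<Longrightarrow> \<bar>f \<zeta>\<bar> \<le> B"
  shows "integrable circle_measure (f :: complex \<Rightarrow> real)"
proof (rule finite_measure.integrable_const_bound[OF finite_measure_circle_measure, of f B])
  show "AE \<zeta> in circle_measure. norm (f \<zeta>) \<le> B"
    using AE_circle_measure by eventually_elim (use assms(2) in auto)
  show "f \<in> borel_measurable circle_measure"
    using assms(1) by simp
qed

lemma integrable_bounded_times_test_function:
  assumes [measurable]: "w \<in> borel_measurable borel" and B: "\<And>z. \<bar>w z\<bar> \<le> B" and \<phi>: "test_function_on S \<phi>"
  shows "integrable lborel (\<lambda>z. w z * \<phi> z :: real)"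
proof -
  have int: "integrable lborel \<phi>"
    by (rule integrable_test_function[OF _ _ \<phi>]) (simp, rule emeasure_bounded_finite, rule compact_imp_bounded)
  have m [measurable]: "\<phi> \<in> borel_measurable borel"
    by (rule borel_measurable_continuous_onI[OF test_function_continuous[OF \<phi>]])
  show ?thesis
  proof (rule Bochner_Integration.integrable_bound)
    show "integrable lborel (\<lambda>z. B * \<phi> z)" using int by simp
    show "(\<lambda>z. w z * \<phi> z) \<in> borel_measurable lborel" by simp
    show "AE z in lborel. norm (w z * \<phi> z) \<le> norm (B * \<phi> z)"
      using B by (auto simp: abs_mult intro!: mult_right_mono order_trans[OF B])
  qed
qed

lemma lborel_integral_translation:
  fixes f :: "complex \<Rightarrow> real"
  assumes [measurable]: "f \<in> borel_measurable borel"
  shows "(\<integral>z. f (z + c) \<partial>lborel) = (\<integral>z. f z \<partial>lborel)"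
proof -
  have "(\<integral>z. f z \<partial>lborel) = (\<integral>z. f z \<partial>distr lborel borel ((+) c))"
    by (simp add: lborel_distr_plus)
  also have "\<dots> = (\<integral>z. f (c + z) \<partial>lborel)"
    by (rule integral_distr) auto
  finally show ?thesis by (simp add: add.commute)
qed

text \<open>
  The mean of \<open>\<psi> (z - \<rho> \<zeta>)\<close> over the circle is \<open>\<psi> z + \<rho>\<^sup>2 / 4 \<Delta>\<psi> z + O(\<rho>\<^sup>3)\<close>, uniformly in \<open>z\<close>.  Integrating
  this against \<open>w\<close> and moving the translation from \<open>\<psi>\<close> to \<open>w\<close> turns the left side into the integral of
  \<open>\<psi>\<close> against circle means of \<open>w\<close>, which dominates \<open>\<integral> w \<psi>\<close> by the sub-mean value inequality.  What is
  left after division by \<open>\<rho>\<^sup>2\<close> is the claim.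
\<close>

proposition laplacian_integral_nonneg:
  assumes [measurable]: "w \<in> borel_measurable borel" and B: "\<And>z. \<bar>w z\<bar> \<le> B"
    and S: "open S"
    and sub: "\<And>a \<rho>. 0 < \<rho> \<Longrightarrow> cball a \<rho> \<subseteq> S \<Longrightarrow> w a \<le> (\<integral>\<zeta>. w (a + complex_of_real \<rho> * \<zeta>) \<partial>circle_measure)"
    and \<psi>: "test_function_on S \<psi>" "\<And>z. 0 \<le> \<psi> z"
  shows "0 \<le> (\<integral>z. w z * laplacian \<psi> z \<partial>lborel)"
proof -
  define a where "a \<phi> = (\<integral>z. w z * \<phi> z \<partial>lborel)" for \<phi>
  note int = integrable_bounded_times_test_function[OF assms(1) B]
  note sm = test_function_smooth[OF \<psi>(1)]
  define P where "P = directional_deriv 1 (directional_deriv 1 \<psi>)"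
  define Q where "Q = (\<lambda>z. directional_deriv 1 (directional_deriv \<i> \<psi>) z + directional_deriv \<i> (directional_deriv 1 \<psi>) z)"
  define R where "R = directional_deriv \<i> (directional_deriv \<i> \<psi>)"
  have t: "test_function_on S P" "test_function_on S Q" "test_function_on S R"
    unfolding P_def Q_def R_def by (intro test_function_add test_function_directional_deriv \<psi>)+
  note t1 = test_function_directional_deriv[OF \<psi>(1)]
  obtain C where C: "0 \<le> C"
    "\<And>v z. norm v = 1 \<Longrightarrow> \<bar>directional_deriv v (directional_deriv v (directional_deriv v \<psi>)) z\<bar> \<le> C"
    using third_directional_deriv_bounded[OF \<psi>(1)] by metis
  obtain C0 where C0: "0 \<le> C0" "\<And>z. \<bar>\<psi> z\<bar> \<le> C0"
    using test_function_bounded[OF \<psi>(1)] by metis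
  obtain \<epsilon> where \<epsilon>: "\<epsilon> > 0" "(\<Union>z\<in>supp \<psi>. cball z \<epsilon>) \<subseteq> S"
    using compact_subset_open_imp_cball_epsilon_subset[OF test_function_compact[OF \<psi>(1)] S test_function_supp[OF \<psi>(1)]]
    by metis
  obtain r where r: "\<And>z. z \<in> supp \<psi> \<Longrightarrow> norm z \<le> r"
    using compact_imp_bounded[OF test_function_compact[OF \<psi>(1)]] by (auto simp: bounded_iff)
  \<comment> \<open>For radius at most 1 the translates of the support stay in this ball, so all integrands vanish off it.\<close>
  define L where "L = cball (0::complex) (r + 1)"
  define m where "m = measure lborel L"
  have L: "compact L" "integrable lborel (indicat_real L)"
    using emeasure_lborel_cball_finite[of "0::complex" "r + 1"] by (auto simp: L_def)
  have B0: "0 \<le> B" using B[of 0] by simp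
  have m\<psi> [measurable]: "\<psi> \<in> borel_measurable borel"
    by (rule borel_measurable_continuous_onI[OF test_function_continuous[OF \<psi>(1)]])

  define E where "E \<rho> \<zeta> = (\<integral>z. w (z + complex_of_real \<rho> * \<zeta>) * \<psi> z \<partial>lborel)" for \<rho> \<zeta>
  have upper: "E \<rho> \<zeta> \<le> a \<psi> - \<rho> * (Re \<zeta> * a (directional_deriv 1 \<psi>) + Im \<zeta> * a (directional_deriv \<i> \<psi>))
      + \<rho>\<^sup>2 / 2 * ((Re \<zeta>)\<^sup>2 * a P + (Re \<zeta> * Im \<zeta>) * a Q + (Im \<zeta>)\<^sup>2 * a R) + B * C * \<rho> ^ 3 * m"
    if \<rho>: "0 < \<rho>" "\<rho> \<le> 1" and \<zeta>: "norm \<zeta> = 1" for \<rho> \<zeta>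
  proof -
    define T where "T = (\<lambda>z. \<psi> z - \<rho> * (Re \<zeta> * directional_deriv 1 \<psi> z + Im \<zeta> * directional_deriv \<i> \<psi> z)
      + \<rho>\<^sup>2 / 2 * ((Re \<zeta>)\<^sup>2 * P z + (Re \<zeta> * Im \<zeta>) * Q z + (Im \<zeta>)\<^sup>2 * R z))"
    have testT: "test_function_on S T"
      unfolding T_def by (intro test_function_add test_function_diff test_function_cmult \<psi> t t1)
    have "E \<rho> \<zeta> = (\<integral>z. w z * \<psi> (z - complex_of_real \<rho> * \<zeta>) \<partial>lborel)"
      unfolding E_def
      using lborel_integral_translation[of "\<lambda>z. w z * \<psi> (z - complex_of_real \<rho> * \<zeta>)" "complex_of_real \<rho> * \<zeta>"] by simp
    also have "\<dots> \<le> (\<integral>z. w z * T z + B * C * \<rho> ^ 3 * indicator L z \<partial>lborel)"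
    proof (rule integral_mono)
      have out: "\<psi> (z - complex_of_real \<rho> * \<zeta>) = 0" if "z \<notin> L" for z
      proof (rule notin_supp, rule notI)
        assume "z - complex_of_real \<rho> * \<zeta> \<in> supp \<psi>"
        from r[OF this] have "norm z \<le> r + norm (complex_of_real \<rho> * \<zeta>)"
          by (metis add_right_mono diff_add_cancel norm_triangle_ineq order_trans)
        then show False using that \<rho> \<zeta> by (simp add: L_def norm_mult)
      qed
      have outT: "T z = 0" if "z \<notin> L" for z
      proof -
        have z: "z \<notin> supp \<psi>" using r[of z] that by (auto simp: L_def)
        have "directional_deriv v \<psi> z = 0" "directional_deriv v (directional_deriv v' \<psi>) z = 0" "\<psi> z = 0" for v v'
        proof -
          have ts: "test_function_on (supp \<psi>) \<psi>"
            using test_function_restrict[OF \<psi>(1)] by blast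
          note ts' = test_function_directional_deriv[OF ts]
          from ts'[THEN test_function_supp] ts'[THEN test_function_directional_deriv, THEN test_function_supp] z
          show "directional_deriv v \<psi> z = 0" "directional_deriv v (directional_deriv v' \<psi>) z = 0" "\<psi> z = 0"
            by (intro notin_supp; blast)+
        qed
        then show ?thesis by (simp add: T_def P_def Q_def R_def)
      qed
      have e1: "directional_deriv (- \<zeta>) \<psi> z = - (Re \<zeta> * directional_deriv 1 \<psi> z + Im \<zeta> * directional_deriv \<i> \<psi> z)" for z
        unfolding directional_deriv_linear[OF sm, of "- \<zeta>"] by simp
      have e2: "directional_deriv (- \<zeta>) (directional_deriv (- \<zeta>) \<psi>) z = (Re \<zeta>)\<^sup>2 * P z + (Re \<zeta> * Im \<zeta>) * Q z + (Im \<zeta>)\<^sup>2 * R z" for z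
        using fun_cong[OF second_directional_deriv[OF sm, of "- \<zeta>"], of z] by (simp add: P_def Q_def R_def)
      have tay: "\<bar>\<psi> (z - complex_of_real \<rho> * \<zeta>) - T z\<bar> \<le> C * \<rho> ^ 3" for z
      proof -
        have "T z = \<psi> z + \<rho> * directional_deriv (- \<zeta>) \<psi> z
            + \<rho>\<^sup>2 / 2 * directional_deriv (- \<zeta>) (directional_deriv (- \<zeta>) \<psi>) z"
          unfolding e1 e2 T_def by (simp add: algebra_simps)
        then show ?thesis
          using smooth_taylor[OF sm C(2), of "- \<zeta>" \<rho> z] \<zeta> \<rho> by (simp add: diff_diff_eq)
      qed
      show "w z * \<psi> (z - complex_of_real \<rho> * \<zeta>) \<le> w z * T z + B * C * \<rho> ^ 3 * indicator L z" for z
      proof (cases "z \<in> L")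
        case True
        have "w z * (\<psi> (z - complex_of_real \<rho> * \<zeta>) - T z) \<le> \<bar>w z\<bar> * \<bar>\<psi> (z - complex_of_real \<rho> * \<zeta>) - T z\<bar>"
          by (metis abs_ge_self abs_mult)
        also have "\<dots> \<le> B * (C * \<rho> ^ 3)"
          using B tay B0 by (intro mult_mono) auto
        finally show ?thesis using True by (simp add: algebra_simps)
      qed (simp add: out outT)
      show "integrable lborel (\<lambda>z. w z * T z + B * C * \<rho> ^ 3 * indicator L z)"
        using int[OF testT] L by auto
      show "integrable lborel (\<lambda>z. w z * \<psi> (z - complex_of_real \<rho> * \<zeta>))"
      proof (rule Bochner_Integration.integrable_bound)
        show "integrable lborel (\<lambda>z. B * C0 * indicat_real L z)" using L by simp
        show "AE z in lborel. norm (w z * \<psi> (z - complex_of_real \<rho> * \<zeta>)) \<le> norm (B * C0 * indicat_real L z)"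
        proof (rule AE_I2)
          fix z
          show "norm (w z * \<psi> (z - complex_of_real \<rho> * \<zeta>)) \<le> norm (B * C0 * indicat_real L z)"
            using B[of z] C0 B0 out[of z] by (cases "z \<in> L") (auto simp: abs_mult intro!: mult_mono)
        qed
      qed simp
    qed
    also have "\<dots> = (\<integral>z. w z * T z \<partial>lborel) + B * C * \<rho> ^ 3 * m"
      using int[OF testT] L by (simp add: m_def)
    also have "(\<integral>z. w z * T z \<partial>lborel) = a \<psi> - \<rho> * (Re \<zeta> * a (directional_deriv 1 \<psi>) + Im \<zeta> * a (directional_deriv \<i> \<psi>))
      + \<rho>\<^sup>2 / 2 * ((Re \<zeta>)\<^sup>2 * a P + (Re \<zeta> * Im \<zeta>) * a Q + (Im \<zeta>)\<^sup>2 * a R)"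
    proof -
      have add: "a (\<lambda>z. \<phi>1 z + \<phi>2 z) = a \<phi>1 + a \<phi>2" if "test_function_on S \<phi>1" "test_function_on S \<phi>2" for \<phi>1 \<phi>2
        unfolding a_def using int[OF that(1)] int[OF that(2)] by (simp add: distrib_left)
      have diff: "a (\<lambda>z. \<phi>1 z - \<phi>2 z) = a \<phi>1 - a \<phi>2" if "test_function_on S \<phi>1" "test_function_on S \<phi>2" for \<phi>1 \<phi>2
        unfolding a_def using int[OF that(1)] int[OF that(2)] by (simp add: right_diff_distrib)
      have cmul: "a (\<lambda>z. c * \<phi> z) = c * a \<phi>" for c \<phi>
        unfolding a_def by (simp add: mult.left_commute[of _ c])
      show ?thesis
        unfolding a_def[symmetric] T_def
        by (simp only: add diff cmul test_function_add test_function_diff test_function_cmult \<psi>(1) t t1)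
    qed
    finally show ?thesis .
  qed

  have lower: "a \<psi> \<le> (\<integral>\<zeta>. E \<rho> \<zeta> \<partial>circle_measure)" and intE: "integrable circle_measure (E \<rho>)" if \<rho>: "0 < \<rho>" "\<rho> \<le> \<epsilon>" for \<rho>
  proof -
    interpret c: finite_measure circle_measure by (rule finite_measure_circle_measure)
    interpret pair_sigma_finite circle_measure lborel ..
    define f where "f = (\<lambda>\<zeta> z. w (z + complex_of_real \<rho> * \<zeta>) * \<psi> z)"
    have intf: "integrable (circle_measure \<Otimes>\<^sub>M lborel) (case_prod f)"
    proof (rule integrableI_bounded_set[where A = "UNIV \<times> supp \<psi>" and B = "B * C0"])
      have supp_borel: "supp \<psi> \<in> sets lborel" by (simp add: borel_closed)
      have [measurable]: "supp \<psi> \<in> sets borel" by (simp add: borel_closed)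
      show "UNIV \<times> supp \<psi> \<in> sets (circle_measure \<Otimes>\<^sub>M lborel)" by simp
      show "case_prod f \<in> borel_measurable (circle_measure \<Otimes>\<^sub>M lborel)"
        unfolding f_def by measurable
      have "emeasure (circle_measure \<Otimes>\<^sub>M lborel) (UNIV \<times> supp \<psi>) = emeasure circle_measure UNIV * emeasure lborel (supp \<psi>)"
        using supp_borel by (intro lborel.emeasure_pair_measure_Times) auto
      also have "\<dots> < \<infinity>"
        using emeasure_bounded_finite[OF compact_imp_bounded[OF test_function_compact[OF \<psi>(1)]]] by (simp add: emeasure_circle_measure)
      finally show "emeasure (circle_measure \<Otimes>\<^sub>M lborel) (UNIV \<times> supp \<psi>) < \<infinity>" .
      show "AE x in circle_measure \<Otimes>\<^sub>M lborel. x \<in> UNIV \<times> supp \<psi> \<longrightarrow> norm (case_prod f x) \<le> B * C0"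
        using B C0 B0 by (intro AE_I2) (auto simp: f_def abs_mult intro!: mult_mono)
      show "AE x in circle_measure \<Otimes>\<^sub>M lborel. x \<notin> UNIV \<times> supp \<psi> \<longrightarrow> case_prod f x = 0"
      proof (rule AE_I2, rule impI)
        fix x :: "complex \<times> complex" assume "x \<notin> UNIV \<times> supp \<psi>"
        then have "snd x \<notin> supp \<psi>" by (cases x) simp
        then have "\<psi> (snd x) = 0" by (rule notin_supp)
        then show "case_prod f x = 0" by (simp add: f_def case_prod_beta)
      qed
    qed
    have fE: "(\<lambda>\<zeta>. \<integral>z. f \<zeta> z \<partial>lborel) = E \<rho>"
      by (simp add: f_def E_def fun_eq_iff)
    show "integrable circle_measure (E \<rho>)"
      using integrable_fst[OF intf] by (simp add: fE)
    have "a \<psi> \<le> (\<integral>z. (\<integral>\<zeta>. f \<zeta> z \<partial>circle_measure) \<partial>lborel)"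
      unfolding a_def
    proof (rule integral_mono)
      show "integrable lborel (\<lambda>z. w z * \<psi> z)" by (rule int[OF \<psi>(1)])
      show "integrable lborel (\<lambda>z. \<integral>\<zeta>. f \<zeta> z \<partial>circle_measure)" by (rule integrable_snd[OF intf])
      show "w z * \<psi> z \<le> (\<integral>\<zeta>. f \<zeta> z \<partial>circle_measure)" for z
      proof (cases "z \<in> supp \<psi>")
        case True
        then have "cball z \<rho> \<subseteq> cball z \<epsilon>" "cball z \<epsilon> \<subseteq> S" using \<epsilon>(2) \<rho> by auto
        then have "w z \<le> (\<integral>\<zeta>. w (z + complex_of_real \<rho> * \<zeta>) \<partial>circle_measure)"
          by (intro sub \<rho>) blast
        then show ?thesis
          unfolding f_def using mult_right_mono[OF _ \<psi>(2)[of z]] by simp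
      next
        case False
        from notin_supp[OF this] show ?thesis by (simp add: f_def)
      qed
    qed
    also have "\<dots> = (\<integral>\<zeta>. E \<rho> \<zeta> \<partial>circle_measure)"
      using Fubini_integral[OF intf] by (simp add: fE)
    finally show "a \<psi> \<le> (\<integral>\<zeta>. E \<rho> \<zeta> \<partial>circle_measure)" .
  qed

  have est: "0 \<le> (a P + a R) / 4 + B * C * m * \<rho>" if \<rho>: "0 < \<rho>" "\<rho> \<le> min 1 \<epsilon>" for \<rho>
  proof -
    have i: "integrable circle_measure (\<lambda>\<zeta>. Re \<zeta>)" "integrable circle_measure (\<lambda>\<zeta>. Im \<zeta>)"
      "integrable circle_measure (\<lambda>\<zeta>. Re \<zeta> * Im \<zeta>)" "integrable circle_measure (\<lambda>\<zeta>. (Re \<zeta>)\<^sup>2)"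
      "integrable circle_measure (\<lambda>\<zeta>. (Im \<zeta>)\<^sup>2)"
    proof -
      have bd: "\<bar>Re \<zeta>\<bar> \<le> 1" "\<bar>Im \<zeta>\<bar> \<le> 1" if "norm \<zeta> = 1" for \<zeta>
        using abs_Re_le_cmod[of \<zeta>] abs_Im_le_cmod[of \<zeta>] that by auto
      show "integrable circle_measure (\<lambda>\<zeta>. Re \<zeta>)" "integrable circle_measure (\<lambda>\<zeta>. Im \<zeta>)"
        "integrable circle_measure (\<lambda>\<zeta>. Re \<zeta> * Im \<zeta>)" "integrable circle_measure (\<lambda>\<zeta>. (Re \<zeta>)\<^sup>2)"
        "integrable circle_measure (\<lambda>\<zeta>. (Im \<zeta>)\<^sup>2)"
        using bd by (intro integrable_on_circle[where B = 1]; auto simp: abs_mult abs_square_le_1 mult_le_one)+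
    qed
    \<comment> \<open>The Taylor bound as a trigonometric polynomial on the circle; only the constant and the two squares survive integration.\<close>
    define k0 where "k0 = a \<psi> + B * C * \<rho> ^ 3 * m"
    define k1 where "k1 = - \<rho> * a (directional_deriv 1 \<psi>)"
    define k2 where "k2 = - \<rho> * a (directional_deriv \<i> \<psi>)"
    define k3 where "k3 = \<rho>\<^sup>2 / 2 * a P"
    define k4 where "k4 = \<rho>\<^sup>2 / 2 * a Q"
    define k5 where "k5 = \<rho>\<^sup>2 / 2 * a R"
    define G where "G = (\<lambda>\<zeta>. k0 + k1 * Re \<zeta> + k2 * Im \<zeta> + k3 * (Re \<zeta>)\<^sup>2 + k4 * (Re \<zeta> * Im \<zeta>) + k5 * (Im \<zeta>)\<^sup>2)"
    have intc: "integrable circle_measure (\<lambda>_. k0)"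
      by (rule finite_measure.integrable_const[OF finite_measure_circle_measure])
    have intG: "integrable circle_measure G"
      unfolding G_def by (intro Bochner_Integration.integrable_add integrable_mult_right intc i)
    have "a \<psi> \<le> (\<integral>\<zeta>. E \<rho> \<zeta> \<partial>circle_measure)"
      using \<rho> by (intro lower) auto
    also have "\<dots> \<le> (\<integral>\<zeta>. G \<zeta> \<partial>circle_measure)"
    proof (rule integral_mono_AE)
      show "integrable circle_measure (E \<rho>)" using \<rho> by (intro intE) auto
      have "E \<rho> \<zeta> \<le> G \<zeta>" if "norm \<zeta> = 1" for \<zeta>
        using upper[of \<rho> \<zeta>] that \<rho>
        by (simp add: G_def k0_def k1_def k2_def k3_def k4_def k5_def algebra_simps)
      then show "AE \<zeta> in circle_measure. E \<rho> \<zeta> \<le> G \<zeta>"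
        using AE_circle_measure by (rule eventually_mono[rotated])
    qed (rule intG)
    also have "\<dots> = k0 + k3 / 2 + k5 / 2"
      unfolding G_def using i intc
      by (simp add: circle_moments measure_def emeasure_circle_measure)
    also have "\<dots> = a \<psi> + \<rho>\<^sup>2 / 4 * (a P + a R) + B * C * \<rho> ^ 3 * m"
      by (simp add: k0_def k3_def k5_def algebra_simps)
    finally have "0 \<le> \<rho>\<^sup>2 * ((a P + a R) / 4 + B * C * m * \<rho>)"
      by (simp add: power2_eq_square power3_eq_cube algebra_simps)
    then show ?thesis using \<rho> by (simp add: zero_le_mult_iff)
  qed
  have "0 \<le> (a P + a R) / 4"
  proof (rule tendsto_lowerbound)
    show "((\<lambda>\<rho>. (a P + a R) / 4 + B * C * m * \<rho>) \<longlongrightarrow> (a P + a R) / 4) (at_right 0)"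
      by (auto intro!: tendsto_eq_intros)
    have "eventually (\<lambda>\<rho>. \<rho> \<in> {0<..<min 1 \<epsilon>}) (at_right (0::real))"
      using \<epsilon>(1) by (intro eventually_at_right_real) auto
    then show "eventually (\<lambda>\<rho>. 0 \<le> (a P + a R) / 4 + B * C * m * \<rho>) (at_right 0)"
      by eventually_elim (rule est; auto)
  qed simp
  also have "a P + a R = (\<integral>z. w z * laplacian \<psi> z \<partial>lborel)"
    using int[OF t(1)] int[OF t(3)] by (simp add: a_def laplacian_def P_def R_def distrib_left)
  finally show ?thesis by simp
qed

section \<open>Existence and uniqueness of the Laplacian, and truncations\<close>

lemma is_distr_laplacian_unique:
  assumes M: "is_distr_laplacian v M" and N: "is_distr_laplacian v N"
  shows "M = N"
proof (rule measure_eqI)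
  have s: "sets M = sets borel" "sets N = sets borel"
    using M N by (auto simp: is_distr_laplacian_def)
  then show "sets M = sets N" by simp
  fix A assume "A \<in> sets M"
  then have A: "A \<in> sets borel" using s by simp
  have "emeasure M (A \<inter> unit_disc) = emeasure N (A \<inter> unit_disc)"
    using M N A by (intro emeasure_eq_of_test_functions[of unit_disc]) (auto simp: is_distr_laplacian_def)
  moreover have "emeasure Q A = emeasure Q (A \<inter> unit_disc)" if "is_distr_laplacian v Q" for Q
  proof (rule emeasure_eq_AE)
    have sQ: "sets Q = sets borel" and Q: "emeasure Q (- unit_disc) = 0"
      using that by (auto simp: is_distr_laplacian_def)
    show "A \<in> sets Q" "A \<inter> unit_disc \<in> sets Q" using sQ A by auto
    have "AE z in Q. z \<notin> - unit_disc"
    proof (rule AE_not_in, rule null_setsI)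
      show "- unit_disc \<in> sets Q" unfolding sQ by (intro borel_comp borel_open) simp
    qed (rule Q)
    then show "AE z in Q. (z \<in> A) = (z \<in> A \<inter> unit_disc)"
      by eventually_elim auto
  qed
  ultimately show "emeasure M A = emeasure N A"
    using M N by simp
qed

lemma distr_laplacian_eqI: "is_distr_laplacian v M \<Longrightarrow> distr_laplacian v = M"
  unfolding distr_laplacian_def using is_distr_laplacian_unique by blast

lemma compact_subset_disc:
  assumes "compact K" "K \<subseteq> unit_disc"
  obtains R where "0 < R" "R < 1" "K \<subseteq> cball 0 R"
proof (cases "K = {}")
  case False
  have "compact (norm ` K)" using assms(1) by (intro compact_continuous_image continuous_intros)
  then obtain z where z: "z \<in> K" "\<And>y. y \<in> K \<Longrightarrow> norm y \<le> norm z"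
    using compact_attains_sup[of "norm ` K"] False by auto
  then have "norm z < 1" using assms(2) by auto
  then show thesis
    using z by (intro that[of "max (norm z) (1 / 2)"]) (auto simp: le_max_iff_disj)
qed (use that[of "1 / 2"] in auto)

text \<open>
  The function \<open>V\<close> is a real-valued representative of \<open>v\<close>, equal to it where \<open>v\<close> is finite in the disc.
\<close>

lemma is_distr_laplacian_of_nonneg:
  assumes loc: "locally_integrable_on unit_disc v"
    and int: "\<And>\<phi>. test_function_on unit_disc \<phi> \<Longrightarrow> integrable lborel (\<lambda>z. V z * \<phi> z)"
    and V: "\<And>\<psi>. (LINT z:unit_disc|lborel. real_of_ereal (v z) * laplacian \<psi> z) = (\<integral>z. V z * laplacian \<psi> z \<partial>lborel)"
    and nonneg: "\<And>\<psi>. test_function_on unit_disc \<psi> \<Longrightarrow> (\<And>z. 0 \<le> \<psi> z) \<Longrightarrow>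
          0 \<le> (\<integral>z. V z * laplacian \<psi> z \<partial>lborel)"
  shows "is_distr_laplacian v (distr_laplacian v)"
proof -
  define L where "L = (\<lambda>\<psi>. 1 / (2 * pi) * (\<integral>z. V z * laplacian \<psi> z \<partial>lborel))"
  note int = int[OF test_function_laplacian]
  interpret positive_functional unit_disc L
  proof
    show "open unit_disc" by simp
    fix \<phi> \<psi> :: "complex \<Rightarrow> real" and c
    assume \<phi>: "test_function_on unit_disc \<phi>"
    note sm = test_function_smooth
    show "L (\<lambda>z. c * \<phi> z) = c * L \<phi>"
      by (simp add: L_def laplacian_cmult[OF sm[OF \<phi>]] mult.left_commute[of _ c])
    show "0 \<le> L \<phi>" if "\<And>z. 0 \<le> \<phi> z"
      using nonneg[OF \<phi> that] by (simp add: L_def)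
    assume \<psi>: "test_function_on unit_disc \<psi>"
    show "L (\<lambda>z. \<phi> z + \<psi> z) = L \<phi> + L \<psi>"
      using int[OF \<phi>] int[OF \<psi>]
      by (simp add: L_def laplacian_add[OF sm[OF \<phi>] sm[OF \<psi>]] distrib_left add_divide_distrib)
  qed
  have "is_distr_laplacian v rep_measure"
    unfolding is_distr_laplacian_def V
  proof (intro conjI allI impI)
    show "integral\<^sup>L rep_measure \<psi> = 1 / (2 * pi) * (\<integral>z. V z * laplacian \<psi> z \<partial>lborel)"
      if "test_function_on unit_disc \<psi>" for \<psi>
      using integral_rep_measure[OF that] by (simp only: L_def)
  qed (use loc emeasure_rep_measure_compact in \<open>simp_all add: emeasure_rep_measure_outside\<close>)
  then show ?thesis by (simp add: distr_laplacian_eqI)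
qed

locale exhaustion =
  fixes u :: "complex \<Rightarrow> ereal"
  assumes exhaustion: "u \<in> exhaustions"
begin

lemma negative: "norm z < 1 \<Longrightarrow> u z < 0"
  and continuous: "continuous_on unit_disc u"
  and boundary: "(u \<longlongrightarrow> 0) (filtercomap norm (at_left 1))"
  and submean: "0 < \<rho> \<Longrightarrow> cball a \<rho> \<subseteq> unit_disc \<Longrightarrow>
        u a \<le> ereal_integral circle_measure (\<lambda>\<zeta>. u (a + complex_of_real \<rho> * \<zeta>))"
  using exhaustion by (auto simp: exhaustions_def subharmonic_on_def)

lemma near_boundary:
  assumes "r < 0"
  obtains R where "0 < R" "R < 1" "\<And>z. R < norm z \<Longrightarrow> norm z < 1 \<Longrightarrow> ereal r < u z"
proof -
  have "eventually (\<lambda>z. ereal r < u z) (filtercomap norm (at_left 1))"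
    using order_tendstoD(1)[OF boundary, of "ereal r"] assms by simp
  then obtain P where P: "eventually P (at_left (1::real))" "\<And>z. P (norm z) \<Longrightarrow> ereal r < u z"
    by (auto simp: eventually_filtercomap)
  then obtain b where b: "b < 1" "\<And>t. b < t \<Longrightarrow> t < 1 \<Longrightarrow> P t"
    by (auto simp: eventually_at_left_field)
  then show thesis
    using P(2) by (intro that[of "max b (1 / 2)"]) auto
qed

text \<open>
  Outside the disc the truncation is \<open>0\<close>, which makes it a bounded Borel function on the plane; the
  integrals below only see the disc.
\<close>

definition trunc :: "real \<Rightarrow> complex \<Rightarrow> real" where
  "trunc r z = (if norm z < 1 then real_of_ereal (max (u z) (ereal r)) else 0)"

lemma ereal_trunc:
  assumes "norm z < 1" "r < 0"
  shows "ereal (trunc r z) = max (u z) (ereal r)"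
  using negative[OF assms(1)] assms by (cases "u z") (auto simp: trunc_def max_def)

lemma trunc_bounds:
  assumes "r < 0"
  shows "r \<le> trunc r z" "trunc r z \<le> 0" "\<bar>trunc r z\<bar> \<le> \<bar>r\<bar>"
proof -
  have "r \<le> trunc r z \<and> trunc r z \<le> 0"
  proof (cases "norm z < 1")
    case True
    have "ereal r \<le> ereal (trunc r z)" "ereal (trunc r z) < 0"
      using ereal_trunc[OF True assms] negative[OF True] assms by auto
    then show ?thesis by simp
  qed (use assms in \<open>simp add: trunc_def\<close>)
  then show "r \<le> trunc r z" "trunc r z \<le> 0" "\<bar>trunc r z\<bar> \<le> \<bar>r\<bar>" by auto
qed

lemma continuous_on_trunc:
  assumes "r < 0" shows "continuous_on unit_disc (trunc r)"
proof -
  have "continuous_on unit_disc (\<lambda>z. ereal (trunc r z))"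
    using continuous_on_max[OF continuous continuous_on_const[of unit_disc "ereal r"]]
    by (rule continuous_on_cong[THEN iffD1, rotated -1]) (use assms ereal_trunc in auto)
  then show ?thesis by (simp add: continuous_on_iff_ereal comp_def)
qed

lemma borel_measurable_trunc [measurable]:
  assumes "r < 0" shows "trunc r \<in> borel_measurable borel"
proof -
  have "(\<lambda>z. indicat_real unit_disc z *\<^sub>R trunc r z) \<in> borel_measurable borel"
    by (rule borel_measurable_continuous_on_indicator) (auto intro: continuous_on_trunc assms)
  also have "(\<lambda>z. indicat_real unit_disc z *\<^sub>R trunc r z) = trunc r"
    by (auto simp: fun_eq_iff trunc_def indicator_def)
  finally show ?thesis .
qed

text \<open>
  All values are negative, so the positive part of the circle integral of \<open>u\<close> vanishes and the
  sub-mean value inequality compares negative parts, which the truncation only decreases.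
\<close>

lemma trunc_submean:
  assumes r: "r < 0" and \<rho>: "0 < \<rho>" "cball a \<rho> \<subseteq> unit_disc"
  shows "trunc r a \<le> (\<integral>\<zeta>. trunc r (a + complex_of_real \<rho> * \<zeta>) \<partial>circle_measure)"
proof -
  define w where "w \<zeta> = trunc r (a + complex_of_real \<rho> * \<zeta>)" for \<zeta>
  have [measurable]: "w \<in> borel_measurable borel"
    unfolding w_def using borel_measurable_trunc[OF r] by measurable
  have w0: "w \<zeta> \<le> 0" and w1: "r \<le> w \<zeta>" for \<zeta>
    using trunc_bounds[OF r] by (simp_all add: w_def)
  have int: "integrable circle_measure w"
    using trunc_bounds[OF r] by (intro integrable_on_circle[where B = "\<bar>r\<bar>"]) (auto simp: w_def)
  have disc: "norm (a + complex_of_real \<rho> * \<zeta>) < 1" if "norm \<zeta> = 1" for \<zeta>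
  proof -
    have "a + complex_of_real \<rho> * \<zeta> \<in> cball a \<rho>"
      using that \<rho> by (simp add: dist_norm norm_mult)
    then show ?thesis using \<rho>(2) by auto
  qed
  have a: "norm a < 1" using \<rho> by (auto simp: subset_iff dest!: spec[of _ a])
  have "(\<integral>\<^sup>+ \<zeta>. e2ennreal (u (a + complex_of_real \<rho> * \<zeta>)) \<partial>circle_measure) = (\<integral>\<^sup>+ \<zeta>. 0 \<partial>circle_measure)"
    using AE_circle_measure
    by (intro nn_integral_cong_AE, eventually_elim) (use negative disc in \<open>auto simp: e2ennreal_neg less_imp_le\<close>)
  then have pos: "enn2ereal (\<integral>\<^sup>+ \<zeta>. e2ennreal (u (a + complex_of_real \<rho> * \<zeta>)) \<partial>circle_measure) = 0"
    by (simp add: zero_ennreal.rep_eq)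
  have "ennreal (- (\<integral>\<zeta>. w \<zeta> \<partial>circle_measure)) = (\<integral>\<^sup>+ \<zeta>. ennreal (- w \<zeta>) \<partial>circle_measure)"
    using int w0 by (subst nn_integral_eq_integral) auto
  also have "\<dots> \<le> (\<integral>\<^sup>+ \<zeta>. e2ennreal (- u (a + complex_of_real \<rho> * \<zeta>)) \<partial>circle_measure)"
    using AE_circle_measure
  proof (intro nn_integral_mono_AE, eventually_elim)
    fix \<zeta> :: complex assume "norm \<zeta> = 1"
    then have "u (a + complex_of_real \<rho> * \<zeta>) \<le> ereal (w \<zeta>)"
      unfolding w_def using ereal_trunc[OF disc r] by simp
    then have "ereal (- w \<zeta>) \<le> - u (a + complex_of_real \<rho> * \<zeta>)"
      by (metis ereal_minus_le_minus uminus_ereal.simps(1))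
    then show "ennreal (- w \<zeta>) \<le> e2ennreal (- u (a + complex_of_real \<rho> * \<zeta>))"
      by (metis e2ennreal_ereal e2ennreal_mono)
  qed
  finally have "ereal (- (\<integral>\<zeta>. w \<zeta> \<partial>circle_measure)) \<le> enn2ereal (\<integral>\<^sup>+ \<zeta>. e2ennreal (- u (a + complex_of_real \<rho> * \<zeta>)) \<partial>circle_measure)"
    using Bochner_Integration.integral_nonneg[of circle_measure "\<lambda>\<zeta>. - w \<zeta>"] w0
    by (simp add: less_eq_ennreal.rep_eq enn2ereal_ennreal)
  then have "u a \<le> ereal (\<integral>\<zeta>. w \<zeta> \<partial>circle_measure)"
    using submean[OF \<rho>] unfolding ereal_integral_def pos
    by (metis (no_types, lifting) ereal_minus_le_minus ereal_uminus_uminus minus_ereal_def add_0 order_trans uminus_ereal.simps(1))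
  moreover have "r \<le> (\<integral>\<zeta>. w \<zeta> \<partial>circle_measure)"
  proof -
    have "(\<integral>\<zeta>. r \<partial>circle_measure) \<le> (\<integral>\<zeta>. w \<zeta> \<partial>circle_measure)"
      using int w1 finite_measure.integrable_const[OF finite_measure_circle_measure]
      by (intro integral_mono) auto
    then show ?thesis by (simp add: measure_def emeasure_circle_measure)
  qed
  ultimately have "ereal (trunc r a) \<le> ereal (\<integral>\<zeta>. w \<zeta> \<partial>circle_measure)"
    unfolding ereal_trunc[OF a r] by simp
  then show ?thesis by (simp add: w_def)
qed

lemma trunc_laplacian_nonneg:
  assumes "r < 0" "test_function_on unit_disc \<psi>" "\<And>z. 0 \<le> \<psi> z"
  shows "0 \<le> (\<integral>z. trunc r z * laplacian \<psi> z \<partial>lborel)"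
  by (rule laplacian_integral_nonneg[where S = unit_disc and B = "\<bar>r\<bar>"])
     (use assms trunc_bounds trunc_submean borel_measurable_trunc in auto)

definition Lap :: "real \<Rightarrow> complex measure" where
  "Lap r = distr_laplacian (\<lambda>z. max (u z) (ereal r))"

lemma integral_trunc:
  "(LINT z:unit_disc|lborel. real_of_ereal (max (u z) (ereal r)) * laplacian \<psi> z) = (\<integral>z. trunc r z * laplacian \<psi> z \<partial>lborel)"
  unfolding set_lebesgue_integral_def
  by (intro Bochner_Integration.integral_cong) (auto simp: trunc_def indicator_def)

lemma integrable_trunc:
  assumes "r < 0" "test_function_on S \<phi>"
  shows "integrable lborel (\<lambda>z. trunc r z * \<phi> z)"
  using assms trunc_bounds(3) borel_measurable_trunc
  by (intro integrable_bounded_times_test_function) auto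

lemma is_distr_laplacian_Lap:
  assumes r: "r < 0"
  shows "is_distr_laplacian (\<lambda>z. max (u z) (ereal r)) (Lap r)"
proof -
  have loc: "locally_integrable_on unit_disc (\<lambda>z. max (u z) (ereal r))"
    unfolding locally_integrable_on_def
  proof (intro conjI allI impI)
    show "(\<lambda>z. max (u z) (ereal r)) \<in> borel_measurable (restrict_space borel unit_disc)"
      by (intro borel_measurable_continuous_on_restrict continuous_on_max continuous continuous_on_const)
    fix K :: "complex set" assume K: "compact K \<and> K \<subseteq> unit_disc"
    have "(\<integral>\<^sup>+ z\<in>K. e2ennreal \<bar>max (u z) (ereal r)\<bar> \<partial>lborel) \<le> (\<integral>\<^sup>+ z. ennreal \<bar>r\<bar> * indicator K z \<partial>lborel)"
    proof (rule nn_integral_mono)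
      fix z
      show "e2ennreal \<bar>max (u z) (ereal r)\<bar> * indicator K z \<le> ennreal \<bar>r\<bar> * indicator K z"
      proof (cases "z \<in> K")
        case True
        then have "norm z < 1" using K by auto
        from ereal_trunc[OF this r] show ?thesis
          using True trunc_bounds(3)[OF r, of z] by (simp flip: ereal_trunc[OF \<open>norm z < 1\<close> r] add: ennreal_leI)
      qed simp
    qed
    also have "\<dots> = ennreal \<bar>r\<bar> * emeasure lborel K"
      using K by (intro nn_integral_cmult_indicator) (simp add: borel_compact)
    also have "\<dots> < \<infinity>"
      using emeasure_bounded_finite[OF compact_imp_bounded, of K] K by (simp add: ennreal_mult_less_top)
    finally show "(\<integral>\<^sup>+ z\<in>K. e2ennreal \<bar>max (u z) (ereal r)\<bar> \<partial>lborel) < \<infinity>" .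
  qed
  show ?thesis
    unfolding Lap_def
    by (rule is_distr_laplacian_of_nonneg[OF loc integrable_trunc[OF r] integral_trunc trunc_laplacian_nonneg[OF r]])
qed

end

section \<open>Local integrability and the Laplacian of an exhaustion\<close>

lemma smooth_norm_square: "smooth (\<lambda>z. (norm z)\<^sup>2)"
  using higher_differentiable_norm_square[of _ 0] by simp

lemma laplacian_norm_square: "laplacian (\<lambda>z. (norm z)\<^sup>2) z = 4"
proof -
  have e: "(\<lambda>z. (norm z)\<^sup>2) = (\<lambda>z. (Re z)\<^sup>2 + (Im z)\<^sup>2)"
    by (simp add: cmod_power2)
  have d: "directional_deriv v (\<lambda>z. (norm z)\<^sup>2) = (\<lambda>z. 2 * (Re z * Re v + Im z * Im v))" for v
    unfolding e by (rule ext, rule directional_derivI) (auto intro!: derivative_eq_intros)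
  have d2: "directional_deriv v (\<lambda>z. 2 * (Re z * a + Im z * b)) z = 2 * (Re v * a + Im v * b)" for v a b
    by (rule directional_derivI) (auto intro!: derivative_eq_intros)
  show ?thesis unfolding laplacian_def d d2 by simp
qed

context exhaustion
begin

text \<open>
  The bound must not depend on \<open>r\<close>.  It comes from testing the truncation against \<open>\<psi> = \<eta> |z|\<^sup>2\<close>, where the
  cutoff \<open>\<eta>\<close> is \<open>1\<close> on a disc so large that \<open>u > -1\<close> outside it.  On that disc \<open>\<Delta>\<psi> = 4\<close>; near the
  boundary \<open>\<Delta>\<psi>\<close> and the truncation are both bounded.  Nonnegativity of \<open>\<integral> trunc r \<Delta>\<psi>\<close> then bounds the
  mass of the truncation in the interior by that near the boundary.
\<close>

lemma trunc_integral_bound: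
  assumes K: "compact K" "K \<subseteq> unit_disc"
  shows "\<exists>C. \<forall>r<0. (\<integral>\<^sup>+ z\<in>K. ennreal (- trunc r z) \<partial>lborel) \<le> ennreal C"
proof -
  obtain R1 where R1: "0 < R1" "R1 < 1" "K \<subseteq> cball 0 R1" using compact_subset_disc[OF K] .
  obtain R2 where R2: "0 < R2" "R2 < 1" "\<And>z. R2 < norm z \<Longrightarrow> norm z < 1 \<Longrightarrow> ereal (- 1) < u z"
    using near_boundary[of "- 1"] by auto
  define R where "R = max R1 R2"
  have R: "0 < R" "R < 1" "K \<subseteq> cball 0 R" "\<And>z. R < norm z \<Longrightarrow> norm z < 1 \<Longrightarrow> ereal (- 1) < u z"
    using R1 R2 unfolding R_def by auto
  have cb: "cball 0 R \<subseteq> unit_disc" using R by auto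
  obtain \<eta> W where \<eta>: "test_function_on unit_disc \<eta>" "\<And>z. 0 \<le> \<eta> z" "open W" "cball 0 R \<subseteq> W" "\<And>z. z \<in> W \<Longrightarrow> \<eta> z = 1"
    using smooth_Urysohn[OF compact_cball open_ball cb] by metis
  define \<psi> where "\<psi> = (\<lambda>z. \<eta> z * (norm z)\<^sup>2)"
  have \<psi>: "test_function_on unit_disc \<psi>" "\<And>z. 0 \<le> \<psi> z"
    using test_function_mult[OF \<eta>(1) smooth_norm_square] \<eta>(2) by (auto simp: \<psi>_def)
  have lap4: "laplacian \<psi> z = 4" if "norm z \<le> R" for z
  proof -
    have "laplacian \<psi> z = laplacian (\<lambda>z. (norm z)\<^sup>2) z"
      using \<eta>(3-5) that by (intro laplacian_cong_open[of W]) (auto simp: \<psi>_def)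
    then show ?thesis by (simp add: laplacian_norm_square)
  qed
  obtain C1 where C1: "0 \<le> C1" "\<And>z. \<bar>laplacian \<psi> z\<bar> \<le> C1"
    using test_function_bounded[OF test_function_laplacian[OF \<psi>(1)]] by metis
  define C where "C = C1 * measure lborel (ball (0::complex) 1) / 4"
  have fin: "emeasure lborel (ball (0::complex) 1) < \<infinity>" "emeasure lborel (cball (0::complex) R) < \<infinity>"
    by (intro emeasure_bounded_finite; simp)+
  show ?thesis
  proof (intro exI[of _ C] allI impI)
    fix r :: real assume r: "r < 0"
    have [measurable]: "cball (0::complex) R \<in> sets borel" by simp
    have int1: "integrable lborel (\<lambda>z. trunc r z * indicat_real (cball 0 R) z)"
    proof (rule Bochner_Integration.integrable_bound)
      show "integrable lborel (\<lambda>z. r * indicat_real (cball (0::complex) R) z)" using fin by simp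
      show "(\<lambda>z. trunc r z * indicat_real (cball 0 R) z) \<in> borel_measurable lborel"
        using borel_measurable_trunc[OF r] by measurable
      show "AE z in lborel. norm (trunc r z * indicat_real (cball 0 R) z) \<le> norm (r * indicat_real (cball 0 R) z)"
        using trunc_bounds(3)[OF r] by (auto simp: indicator_def)
    qed
    have int2: "integrable lborel (\<lambda>z. C1 * indicat_real (ball (0::complex) 1) z)" using fin by simp
    have "0 \<le> (\<integral>z. trunc r z * laplacian \<psi> z \<partial>lborel)"
      by (rule trunc_laplacian_nonneg[OF r \<psi>])
    also have "\<dots> \<le> (\<integral>z. 4 * (trunc r z * indicat_real (cball 0 R) z) + C1 * indicat_real (ball 0 1) z \<partial>lborel)"
    proof (rule integral_mono)
      show "integrable lborel (\<lambda>z. trunc r z * laplacian \<psi> z)"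
        by (rule integrable_trunc[OF r test_function_laplacian[OF \<psi>(1)]])
      show "integrable lborel (\<lambda>z. 4 * (trunc r z * indicat_real (cball 0 R) z) + C1 * indicat_real (ball 0 1) z)"
        by (intro Bochner_Integration.integrable_add integrable_mult_right int1 int2[simplified])
           (use int2 in simp)
      fix z :: complex
      consider "norm z \<le> R" | "R < norm z" "norm z < 1" | "norm z \<ge> 1" by linarith
      then show "trunc r z * laplacian \<psi> z \<le> 4 * (trunc r z * indicat_real (cball 0 R) z) + C1 * indicat_real (ball 0 1) z"
      proof cases
        case 1
        then show ?thesis using lap4 C1 R by simp
      next
        case 2
        have "ereal (- 1) \<le> ereal (trunc r z)"
          using R(4)[OF 2] ereal_trunc[OF 2(2) r] by (simp add: le_max_iff_disj less_imp_le)
        then have "\<bar>trunc r z\<bar> \<le> 1" using trunc_bounds(2)[OF r, of z] by simp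
        then have "\<bar>trunc r z * laplacian \<psi> z\<bar> \<le> 1 * C1"
          unfolding abs_mult using C1 by (intro mult_mono) auto
        then show ?thesis using 2 by simp
      next
        case 3
        then show ?thesis by (simp add: trunc_def)
      qed
    qed
    also have "\<dots> = 4 * (\<integral>z. trunc r z * indicat_real (cball 0 R) z \<partial>lborel) + 4 * C"
      using int1 int2 fin by (simp add: C_def)
    finally have le: "(\<integral>z. - (trunc r z * indicat_real (cball 0 R) z) \<partial>lborel) \<le> C" by simp
    have "(\<integral>\<^sup>+ z\<in>K. ennreal (- trunc r z) \<partial>lborel) \<le> (\<integral>\<^sup>+ z. ennreal (- (trunc r z * indicat_real (cball 0 R) z)) \<partial>lborel)"
      using R(3) by (intro nn_integral_mono) (auto simp: indicator_def)
    also have "\<dots> = ennreal (\<integral>z. - (trunc r z * indicat_real (cball 0 R) z) \<partial>lborel)"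
      using int1 trunc_bounds(2)[OF r] by (intro nn_integral_eq_integral) (auto simp: indicator_def)
    also have "\<dots> \<le> ennreal C" using le by (rule ennreal_leI)
    finally show "(\<integral>\<^sup>+ z\<in>K. ennreal (- trunc r z) \<partial>lborel) \<le> ennreal C" .
  qed
qed

lemma trunc_tendsto:
  assumes "norm z < 1"
  shows "(\<lambda>n. ennreal (- trunc (- real (Suc n)) z)) \<longlonglongrightarrow> e2ennreal \<bar>u z\<bar>"
proof (cases "u z")
  case (real x)
  then have x: "x < 0" using negative[OF assms] by simp
  obtain N where "- x \<le> real N" using real_arch_simple by blast
  then have "eventually (\<lambda>n. ennreal (- trunc (- real (Suc n)) z) = e2ennreal \<bar>u z\<bar>) sequentially"
    using real x assms by (intro eventually_sequentiallyI[of N]) (auto simp: trunc_def max_def)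
  then show ?thesis by (rule tendsto_eventually)
next
  case PInf
  then show ?thesis using negative[OF assms] by simp
next
  case MInf
  then have "- trunc (- real (Suc n)) z = real (Suc n)" for n
    using assms by (simp add: trunc_def max_def)
  then have "(\<lambda>n. ennreal (- trunc (- real (Suc n)) z)) = (\<lambda>n. of_nat (Suc n))"
    by (simp add: ennreal_of_nat_eq_real_of_nat)
  moreover have "(\<lambda>n. of_nat (Suc n) :: ennreal) \<longlonglongrightarrow> top"
    using LIMSEQ_Suc[OF of_nat_tendsto_top_ennreal] .
  ultimately show ?thesis using MInf by simp
qed

lemma borel_measurable_restrict: "u \<in> borel_measurable (restrict_space borel unit_disc)"
  by (rule borel_measurable_continuous_on_restrict[OF continuous])

lemma nn_integral_u_finite:
  assumes K: "compact K" "K \<subseteq> unit_disc"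
  shows "(\<integral>\<^sup>+ z\<in>K. e2ennreal \<bar>u z\<bar> \<partial>lborel) < \<infinity>"
proof -
  obtain C :: real where C: "\<And>r. r < 0 \<Longrightarrow> (\<integral>\<^sup>+ z\<in>K. ennreal (- trunc r z) \<partial>lborel) \<le> ennreal C"
    using trunc_integral_bound[OF K] by auto
  define g where "g n z = ennreal (- trunc (- real (Suc n)) z) * indicator K z" for n z
  have Kb [measurable]: "K \<in> sets borel" using K by (simp add: borel_compact)
  have gm: "g n \<in> borel_measurable lborel" for n
    unfolding g_def using borel_measurable_trunc[of "- real (Suc n)"] by measurable
  have "(\<integral>\<^sup>+ z\<in>K. e2ennreal \<bar>u z\<bar> \<partial>lborel) = (\<integral>\<^sup>+ z. liminf (\<lambda>n. g n z) \<partial>lborel)"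
  proof (intro nn_integral_cong)
    fix z
    show "e2ennreal \<bar>u z\<bar> * indicator K z = liminf (\<lambda>n. g n z)"
    proof (cases "z \<in> K")
      case True
      then have "norm z < 1" using K by auto
      from lim_imp_Liminf[OF _ trunc_tendsto[OF this]] show ?thesis using True by (simp add: g_def)
    next
      case False
      then show ?thesis using lim_imp_Liminf[of sequentially "\<lambda>n. 0::ennreal" 0] by (simp add: g_def)
    qed
  qed
  also have "\<dots> \<le> liminf (\<lambda>n. \<integral>\<^sup>+ z. g n z \<partial>lborel)"
    by (rule nn_integral_liminf) (rule gm)
  also have "\<dots> \<le> liminf (\<lambda>n. ennreal C)"
    using C by (intro Liminf_mono always_eventually allI) (simp add: g_def)
  also have "\<dots> = ennreal C" by (intro lim_imp_Liminf) auto
  finally show ?thesis by (auto simp: less_top[symmetric] top_unique)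
qed

text \<open>
  The value \<open>0\<close> where \<open>u = -\<infinity>\<close> matters on a null set only, by local integrability.
\<close>

definition val :: "complex \<Rightarrow> real" where
  "val z = (if norm z < 1 then real_of_ereal (u z) else 0)"

lemma borel_measurable_val [measurable]: "val \<in> borel_measurable borel"
proof -
  have "(\<lambda>z. u z * indicator unit_disc z) \<in> borel_measurable borel"
    using borel_measurable_restrict_space_iff_ereal[of unit_disc borel u] borel_measurable_restrict by simp
  then have "(\<lambda>z. real_of_ereal (u z * indicator unit_disc z)) \<in> borel_measurable borel"
    by measurable
  also have "(\<lambda>z. real_of_ereal (u z * indicator unit_disc z)) = val"
    by (auto simp: fun_eq_iff val_def indicator_def)
  finally show ?thesis .
qed

lemma integrable_val_on_compact:
  assumes K: "compact K" "K \<subseteq> unit_disc"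
  shows "integrable lborel (\<lambda>z. indicat_real K z * val z)"
proof (rule integrableI_bounded)
  have Kb [measurable]: "K \<in> sets borel" using K by (simp add: borel_compact)
  show "(\<lambda>z. indicat_real K z * val z) \<in> borel_measurable lborel" by measurable
  have "(\<integral>\<^sup>+ z. ennreal (norm (indicat_real K z * val z)) \<partial>lborel) \<le> (\<integral>\<^sup>+ z\<in>K. e2ennreal \<bar>u z\<bar> \<partial>lborel)"
  proof (rule nn_integral_mono)
    fix z
    show "ennreal (norm (indicat_real K z * val z)) \<le> e2ennreal \<bar>u z\<bar> * indicator K z"
      by (cases "u z") (auto simp: val_def indicator_def)
  qed
  also have "\<dots> < \<infinity>" by (rule nn_integral_u_finite[OF K])
  finally show "(\<integral>\<^sup>+ z. ennreal (norm (indicat_real K z * val z)) \<partial>lborel) < \<infinity>" .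
qed

lemma AE_finite_on_compact:
  assumes K: "compact K" "K \<subseteq> unit_disc"
  shows "AE z in lborel. z \<in> K \<longrightarrow> u z \<noteq> - \<infinity>"
proof -
  have Kb [measurable]: "K \<in> sets borel" using K by (simp add: borel_compact)
  have m: "(\<lambda>z. u z * indicator unit_disc z) \<in> borel_measurable borel"
    using borel_measurable_restrict_space_iff_ereal[of unit_disc borel u] borel_measurable_restrict by simp
  have "(\<lambda>z. e2ennreal \<bar>u z * indicator unit_disc z\<bar> * indicator K z) \<in> borel_measurable lborel"
    using m by measurable
  also have "(\<lambda>z. e2ennreal \<bar>u z * indicator unit_disc z\<bar> * indicator K z) = (\<lambda>z. e2ennreal \<bar>u z\<bar> * indicator K z)"
    using K(2) by (auto simp: fun_eq_iff indicator_def)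
  finally have "AE z in lborel. e2ennreal \<bar>u z\<bar> * indicator K z \<noteq> \<infinity>"
    using nn_integral_u_finite[OF K] by (intro nn_integral_PInf_AE) auto
  then show ?thesis by eventually_elim auto
qed

lemma
  assumes \<phi>: "test_function_on unit_disc \<phi>"
  shows integrable_val: "integrable lborel (\<lambda>z. val z * \<phi> z)"
    and integral_trunc_tendsto: "(\<lambda>n. \<integral>z. trunc (- real (Suc n)) z * \<phi> z \<partial>lborel) \<longlonglongrightarrow> (\<integral>z. val z * \<phi> z \<partial>lborel)"
proof -
  define K where "K = supp \<phi>"
  have K: "compact K" "K \<subseteq> unit_disc"
    using test_function_compact[OF \<phi>] test_function_supp[OF \<phi>] by (auto simp: K_def)
  obtain C where C: "0 \<le> C" "\<And>z. \<bar>\<phi> z\<bar> \<le> C" using test_function_bounded[OF \<phi>] by metis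
  have m\<phi> [measurable]: "\<phi> \<in> borel_measurable borel"
    by (rule borel_measurable_continuous_onI[OF test_function_continuous[OF \<phi>]])
  have out: "\<phi> z = 0" if "z \<notin> K" for z using that unfolding K_def by (rule notin_supp)
  define w where "w z = C * \<bar>indicat_real K z * val z\<bar>" for z
  have w: "integrable lborel w"
    unfolding w_def using integrable_val_on_compact[OF K] by simp
  have bound: "\<bar>x * \<phi> z\<bar> \<le> w z" if "\<bar>x\<bar> \<le> \<bar>val z\<bar>" for x z
  proof (cases "z \<in> K")
    case True
    have "\<bar>x\<bar> * \<bar>\<phi> z\<bar> \<le> \<bar>val z\<bar> * C" using that C by (intro mult_mono) auto
    then show ?thesis using True by (simp add: w_def abs_mult mult.commute)
  qed (use out C in \<open>simp add: w_def\<close>)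
  show "integrable lborel (\<lambda>z. val z * \<phi> z)"
    using bound C by (intro Bochner_Integration.integrable_bound[OF w]) (auto simp: w_def)
  show "(\<lambda>n. \<integral>z. trunc (- real (Suc n)) z * \<phi> z \<partial>lborel) \<longlonglongrightarrow> (\<integral>z. val z * \<phi> z \<partial>lborel)"
  proof (rule integral_dominated_convergence[OF _ _ w])
    show "(\<lambda>z. trunc (- real (Suc n)) z * \<phi> z) \<in> borel_measurable lborel" for n
      using borel_measurable_trunc[of "- real (Suc n)"] by measurable
    show "AE z in lborel. norm (trunc (- real (Suc n)) z * \<phi> z) \<le> w z" for n
      using AE_finite_on_compact[OF K]
    proof eventually_elim
      fix z assume z: "z \<in> K \<longrightarrow> u z \<noteq> - \<infinity>"
      show "norm (trunc (- real (Suc n)) z * \<phi> z) \<le> w z"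
      proof (cases "z \<in> K")
        case True
        then have d: "norm z < 1" using K by auto
        then have "\<bar>trunc (- real (Suc n)) z\<bar> \<le> \<bar>val z\<bar>"
          using z True negative[OF d] by (cases "u z") (auto simp: trunc_def val_def max_def)
        from bound[OF this] show ?thesis by simp
      qed (use out C in \<open>simp add: w_def\<close>)
    qed
    show "AE z in lborel. (\<lambda>n. trunc (- real (Suc n)) z * \<phi> z) \<longlonglongrightarrow> val z * \<phi> z"
      using AE_finite_on_compact[OF K]
    proof eventually_elim
      fix z assume z: "z \<in> K \<longrightarrow> u z \<noteq> - \<infinity>"
      show "(\<lambda>n. trunc (- real (Suc n)) z * \<phi> z) \<longlonglongrightarrow> val z * \<phi> z"
      proof (cases "z \<in> K")
        case True
        then have d: "norm z < 1" using K by auto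
        obtain x where x: "u z = ereal x" using z True negative[OF d] by (cases "u z") auto
        obtain N where "- x \<le> real N" using real_arch_simple by blast
        then have "eventually (\<lambda>n. trunc (- real (Suc n)) z = val z) sequentially"
          using x d by (intro eventually_sequentiallyI[of N]) (auto simp: trunc_def val_def max_def)
        then show ?thesis by (intro tendsto_mult tendsto_const tendsto_eventually)
      qed (simp add: out)
    qed
  qed simp
qed

lemma integral_val:
  "(LINT z:unit_disc|lborel. real_of_ereal (u z) * laplacian \<psi> z) = (\<integral>z. val z * laplacian \<psi> z \<partial>lborel)"
  unfolding set_lebesgue_integral_def
  by (intro Bochner_Integration.integral_cong) (auto simp: val_def indicator_def)

lemma is_distr_laplacian_u: "is_distr_laplacian u (distr_laplacian u)"
proof (rule is_distr_laplacian_of_nonneg[OF _ integrable_val integral_val])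
  show "locally_integrable_on unit_disc u"
    unfolding locally_integrable_on_def using borel_measurable_restrict nn_integral_u_finite by blast
  show "0 \<le> (\<integral>z. val z * laplacian \<phi> z \<partial>lborel)"
    if "test_function_on unit_disc \<phi>" "\<And>z. 0 \<le> \<phi> z" for \<phi>
    by (rule LIMSEQ_le_const[OF integral_trunc_tendsto[OF test_function_laplacian[OF that(1)]]])
       (use trunc_laplacian_nonneg[OF _ that] in auto)
qed

end

section \<open>Regularized powers and the comparison of Laplacians\<close>

lemma smooth_powr: "smooth g \<Longrightarrow> (\<And>z. 0 < g z) \<Longrightarrow> smooth (\<lambda>z. g z powr a)"
  using higher_differentiable_powr by simp

lemma directional_deriv_powr:
  assumes "smooth g" "\<And>z. 0 < g z"
  shows "directional_deriv v (\<lambda>z. g z powr a) = (\<lambda>z. a * g z powr (a - 1) * directional_deriv v g z)"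
proof (rule ext, rule directional_derivI)
  fix z
  have "((\<lambda>t. t powr a) has_derivative (\<lambda>h. a * g z powr (a - 1) * h)) (at (g z))"
    using has_real_derivative_powr[OF assms(2), of a z] by (simp add: has_field_derivative_def)
  from has_derivative_compose[OF smooth_has_derivative[OF assms(1)] this]
  show "((\<lambda>z. g z powr a) has_derivative (\<lambda>v. a * g z powr (a - 1) * directional_deriv v g z)) (at z)" .
qed

lemma laplacian_powr:
  assumes g: "smooth g" "\<And>z. 0 < g z"
  shows "laplacian (\<lambda>z. g z powr a) z = a * g z powr (a - 2) *
    ((a - 1) * ((directional_deriv 1 g z)\<^sup>2 + (directional_deriv \<i> g z)\<^sup>2) + g z * laplacian g z)"
proof -
  have e: "g z powr (a - 1) = g z powr (a - 2) * g z" for z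
  proof -
    have "g z powr (a - 1) = g z powr ((a - 2) + 1)" by simp
    also have "\<dots> = g z powr (a - 2) * g z powr 1" by (rule powr_add)
    finally show ?thesis using g(2)[of z] by (simp add: less_imp_le)
  qed
  have "directional_deriv v (directional_deriv v (\<lambda>z. g z powr a)) z =
     a * g z powr (a - 2) * ((a - 1) * (directional_deriv v g z)\<^sup>2 + g z * directional_deriv v (directional_deriv v g) z)" for v
  proof -
    have "directional_deriv v (directional_deriv v (\<lambda>z. g z powr a)) z =
       directional_deriv v (\<lambda>z. a * (g z powr (a - 1) * directional_deriv v g z)) z"
      by (simp add: directional_deriv_powr[OF g] mult.assoc)
    also have "\<dots> = a * (g z powr (a - 1) * directional_deriv v (directional_deriv v g) z
        + ((a - 1) * g z powr (a - 1 - 1) * directional_deriv v g z) * directional_deriv v g z)"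
      using g by (simp add: directional_deriv_cmult directional_deriv_mult directional_deriv_powr
          smooth_mult smooth_powr smooth_directional_deriv)
    finally show ?thesis by (simp add: e[of z] power2_eq_square algebra_simps)
  qed
  then show ?thesis by (simp add: laplacian_def algebra_simps)
qed

lemma smooth_entire:
  assumes "f holomorphic_on UNIV"
  shows "smooth (\<lambda>z. Re (f z))" "smooth (\<lambda>z. Im (f z))"
  using higher_differentiable_entire[OF assms] by auto

lemma directional_deriv_entire:
  assumes "f holomorphic_on UNIV"
  shows "directional_deriv v (\<lambda>z. Re (f z)) = (\<lambda>z. Re (deriv f z * v))"
    "directional_deriv v (\<lambda>z. Im (f z)) = (\<lambda>z. Im (deriv f z * v))"
proof -
  have d: "(f has_derivative (\<lambda>w. deriv f z * w)) (at z)" for z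
    using holomorphic_derivI[OF assms, of z] by (simp add: has_field_derivative_def)
  show "directional_deriv v (\<lambda>z. Re (f z)) = (\<lambda>z. Re (deriv f z * v))"
    by (rule ext, rule directional_derivI) (rule has_derivative_Re[OF d])
  show "directional_deriv v (\<lambda>z. Im (f z)) = (\<lambda>z. Im (deriv f z * v))"
    by (rule ext, rule directional_derivI) (rule has_derivative_Im[OF d])
qed

text \<open>
  The parameter \<open>a\<close> plays the role of \<open>p / 2\<close>; adding \<open>\<epsilon>\<close> removes the singularity at the zeros of \<open>f\<close>.
\<close>

definition regularized_power :: "real \<Rightarrow> real \<Rightarrow> (complex \<Rightarrow> complex) \<Rightarrow> complex \<Rightarrow> real" where
  "regularized_power a \<epsilon> f z = ((norm (f z))\<^sup>2 + \<epsilon>) powr a"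

lemma
  assumes f: "f holomorphic_on UNIV" and \<epsilon>: "0 < \<epsilon>" and a: "0 < a"
  shows smooth_regularized_power: "smooth (regularized_power a \<epsilon> f)"
    and laplacian_regularized_power: "0 \<le> laplacian (regularized_power a \<epsilon> f) z"
proof -
  define g where "g = (\<lambda>z. (Re (f z) * Re (f z) + Im (f z) * Im (f z)) + \<epsilon>)"
  have e: "regularized_power a \<epsilon> f = (\<lambda>z. g z powr a)"
    unfolding regularized_power_def[abs_def] g_def cmod_power2 by (simp add: power2_eq_square)
  have g: "smooth g" "\<And>z. 0 < g z"
    unfolding g_def using \<epsilon> by (intro smooth_add smooth_mult smooth_const smooth_entire[OF f])
      (rule add_nonneg_pos, simp, rule \<epsilon>)
  show "smooth (regularized_power a \<epsilon> f)"
    unfolding e by (rule smooth_powr[OF g])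
  have f': "deriv f holomorphic_on UNIV" "(\<lambda>z. deriv f z * v) holomorphic_on UNIV" for v
    by (intro holomorphic_intros f; simp)+
  note sm = smooth_entire[OF f] and sm' = smooth_entire[OF f'(2)]
  have dg: "directional_deriv v g = (\<lambda>z. 2 * (Re (f z) * Re (deriv f z * v) + Im (f z) * Im (deriv f z * v)))" for v
    unfolding g_def
    by (simp add: directional_deriv_add directional_deriv_mult smooth_add smooth_mult smooth_const sm
        directional_deriv_entire[OF f] directional_derivI[OF has_derivative_const] fun_eq_iff algebra_simps del: times_complex.sel)
  have ddg: "directional_deriv v (directional_deriv v g) z =
     2 * ((Re (deriv f z * v))\<^sup>2 + (Im (deriv f z * v))\<^sup>2 + Re (f z) * Re (deriv (\<lambda>z. deriv f z * v) z * v)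
        + Im (f z) * Im (deriv (\<lambda>z. deriv f z * v) z * v))" for v
    unfolding dg directional_deriv_cmult[OF smooth_add[OF smooth_mult[OF sm(1) sm'(1)] smooth_mult[OF sm(2) sm'(2)]]]
      directional_deriv_add[OF smooth_mult[OF sm(1) sm'(1)] smooth_mult[OF sm(2) sm'(2)]]
      directional_deriv_mult[OF sm(1) sm'(1)] directional_deriv_mult[OF sm(2) sm'(2)]
      directional_deriv_entire[OF f] directional_deriv_entire[OF f'(2)]
    by (simp add: power2_eq_square algebra_simps del: times_complex.sel)
  have dv: "deriv (\<lambda>z. deriv f z * v) z = deriv (deriv f) z * v" for v
    using f'(1) by (intro deriv_cmult_right) (auto simp: holomorphic_on_imp_differentiable_at)
  have lap: "laplacian g z = 4 * (norm (deriv f z))\<^sup>2"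
    unfolding laplacian_def ddg dv cmod_power2 by (simp add: power2_eq_square algebra_simps)
  have grad: "(directional_deriv 1 g z)\<^sup>2 + (directional_deriv \<i> g z)\<^sup>2 = 4 * (norm (f z))\<^sup>2 * (norm (deriv f z))\<^sup>2"
    unfolding dg cmod_power2 by (simp add: power2_eq_square algebra_simps)
  \<comment> \<open>With g = |f|^2 + eps, both the gradient term and the Laplacian of g carry the factor |f'|^2.\<close>
  have "laplacian (regularized_power a \<epsilon> f) z =
     a * g z powr (a - 2) * (4 * (norm (deriv f z))\<^sup>2 * (a * (norm (f z))\<^sup>2 + \<epsilon>))"
    unfolding e laplacian_powr[OF g] lap grad
    unfolding cmod_power2[of "f z"] by (simp add: g_def power2_eq_square[of "Re (f z)"] power2_eq_square[of "Im (f z)"] algebra_simps)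
  also have "\<dots> \<ge> 0" using a \<epsilon> by (intro mult_nonneg_nonneg add_nonneg_nonneg) auto
  finally show "0 \<le> laplacian (regularized_power a \<epsilon> f) z" .
qed

lemma nn_integral_add_measure:
  assumes s: "sets M = sets L" "sets N = sets L"
    and add: "\<And>A. A \<in> sets L \<Longrightarrow> emeasure L A = emeasure M A + emeasure N A"
    and f: "f \<in> borel_measurable L"
  shows "(\<integral>\<^sup>+ x. f x \<partial>L) = (\<integral>\<^sup>+ x. f x \<partial>M) + (\<integral>\<^sup>+ x. f x \<partial>N)"
  using f
proof (induction rule: borel_measurable_induct)
  case (cong f g)
  have "space M = space L" "space N = space L"
    using sets_eq_imp_space_eq[OF s(1)] sets_eq_imp_space_eq[OF s(2)] by simp_all
  then have "(\<integral>\<^sup>+ x. f x \<partial>Q) = (\<integral>\<^sup>+ x. g x \<partial>Q)" if "Q \<in> {L, M, N}" for Q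
    using that cong(3) by (intro nn_integral_cong) auto
  then show ?case using cong.IH by simp
next
  case (set A)
  then show ?case using s add by simp
next
  case (mult u c)
  then show ?case
    using s by (simp add: nn_integral_cmult distrib_left cong: measurable_cong_sets)
next
  case (add u v)
  then show ?case
    using s by (simp add: nn_integral_add add_ac cong: measurable_cong_sets)
next
  case (seq U)
  have "(\<integral>\<^sup>+ x. (SUP i. U i) x \<partial>Q) = (SUP i. \<integral>\<^sup>+ x. U i x \<partial>Q)" if "sets Q = sets L" for Q
    unfolding SUP_apply using seq.hyps(1) that
    by (intro nn_integral_monotone_convergence_SUP[OF seq.hyps(3)]) (simp cong: measurable_cong_sets)
  then show ?case
    using seq s
    by (simp add: ennreal_SUP_add incseq_nn_integral)
qed

text \<open>
  The constants \<open>1\<close> and \<open>-1\<close> both satisfy the sub-mean value inequality.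
\<close>

lemma laplacian_integral_0:
  assumes "test_function_on S \<psi>" "\<And>z. 0 \<le> \<psi> z" "open S"
  shows "(\<integral>z. laplacian \<psi> z \<partial>lborel) = 0"
proof -
  have "0 \<le> (\<integral>z. c * laplacian \<psi> z \<partial>lborel)" if "\<bar>c\<bar> \<le> 1" for c
    using assms that
    by (intro laplacian_integral_nonneg[where S = S and B = 1]) (auto simp: measure_def emeasure_circle_measure)
  from this[of 1] this[of "- 1"] show ?thesis by simp
qed

context exhaustion
begin

abbreviation \<Delta> :: "complex measure" where "\<Delta> \<equiv> distr_laplacian u"

lemma sets_\<Delta> [measurable_cong, simp]: "sets \<Delta> = sets borel"
  and \<Delta>_outside: "emeasure \<Delta> (- unit_disc) = 0"
  and \<Delta>_compact: "compact K \<Longrightarrow> K \<subseteq> unit_disc \<Longrightarrow> emeasure \<Delta> K < \<infinity>"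
  and integral_\<Delta>: "test_function_on unit_disc \<psi> \<Longrightarrow>
       (\<integral>z. \<psi> z \<partial>\<Delta>) = 1 / (2 * pi) * (\<integral>z. val z * laplacian \<psi> z \<partial>lborel)"
  using is_distr_laplacian_u by (simp_all add: is_distr_laplacian_def integral_val)

lemma sets_Lap [measurable_cong, simp]: "r < 0 \<Longrightarrow> sets (Lap r) = sets borel"
  and Lap_outside: "r < 0 \<Longrightarrow> emeasure (Lap r) (- unit_disc) = 0"
  and Lap_compact: "r < 0 \<Longrightarrow> compact K \<Longrightarrow> K \<subseteq> unit_disc \<Longrightarrow> emeasure (Lap r) K < \<infinity>"
  and integral_Lap: "r < 0 \<Longrightarrow> test_function_on unit_disc \<psi> \<Longrightarrow>
       (\<integral>z. \<psi> z \<partial>Lap r) = 1 / (2 * pi) * (\<integral>z. trunc r z * laplacian \<psi> z \<partial>lborel)"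
  using is_distr_laplacian_Lap[of r] by (simp_all add: is_distr_laplacian_def integral_trunc)

lemma space_\<Delta> [simp]: "space \<Delta> = UNIV"
  using sets_eq_imp_space_eq[OF sets_\<Delta>] by simp

lemma space_Lap [simp]: "r < 0 \<Longrightarrow> space (Lap r) = UNIV"
  using sets_eq_imp_space_eq[OF sets_Lap] by simp

lemma finite_\<Delta>: "finite_measure \<Delta>"
proof (rule finite_measureI)
  have "emeasure \<Delta> (unit_disc \<union> - unit_disc) \<le> emeasure \<Delta> unit_disc + emeasure \<Delta> (- unit_disc)"
    by (rule emeasure_subadditive) auto
  moreover have "emeasure \<Delta> unit_disc < \<infinity>"
    using exhaustion by (simp add: exhaustions_def)
  ultimately show "emeasure \<Delta> (space \<Delta>) \<noteq> \<infinity>"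
    by (auto simp: \<Delta>_outside top_unique)
qed

text \<open>
  On this open set the truncation at level \<open>r\<close> agrees with \<open>u\<close>.
\<close>

definition above :: "real \<Rightarrow> complex set" where "above r = {z \<in> unit_disc. ereal r < u z}"

lemma open_above: "open (above r)"
proof -
  have "open (unit_disc \<inter> u -` {ereal r<..})"
    using continuous_open_preimage[OF continuous] by simp
  then show ?thesis by (simp add: above_def vimage_def Int_def)
qed

lemma open_sublevel: "open (sublevel u r)"
proof -
  have "open (unit_disc \<inter> u -` {..<ereal r})"
    using continuous_open_preimage[OF continuous] by simp
  then show ?thesis by (simp add: sublevel_def vimage_def Int_def)
qed

lemma compact_closed_sublevel:
  assumes "r < 0"
  shows "compact {z \<in> unit_disc. u z \<le> ereal r}"
proof -
  obtain R where R: "0 < R" "R < 1" "\<And>z. R < norm z \<Longrightarrow> norm z < 1 \<Longrightarrow> ereal r < u z"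
    using near_boundary[OF assms] by metis
  have "closed {z \<in> cball 0 R. u z \<in> {..ereal r}}"
    using continuous_on_subset[OF continuous, of "cball 0 R"] R
    by (intro continuous_closed_preimage[unfolded vimage_def Int_def mem_Collect_eq, of "cball 0 R"]) (auto simp: subset_iff)
  also have "{z \<in> cball 0 R. u z \<in> {..ereal r}} = {z \<in> unit_disc. u z \<le> ereal r}"
    using R by (force simp: not_le[symmetric])
  finally have "closed {z \<in> unit_disc. u z \<le> ereal r}" .
  moreover have "bounded {z \<in> unit_disc. u z \<le> ereal r}"
    by (rule bounded_subset[OF bounded_ball[of 0 1]]) auto
  ultimately show ?thesis by (simp add: compact_eq_bounded_closed)
qed

lemma level_eq: "level u r = {z \<in> unit_disc. u z \<le> ereal r} - sublevel u r"
  by (auto simp: level_def sublevel_def)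

lemma compact_level: "r < 0 \<Longrightarrow> compact (level u r)"
  unfolding level_eq using compact_closed_sublevel open_sublevel by (intro compact_diff)

lemma above_sublevel_borel [measurable]: "above r \<in> sets borel" "sublevel u r \<in> sets borel" "unit_disc - sublevel u r \<in> sets borel"
  using open_above open_sublevel by auto

lemma borel_level [measurable]: "r < 0 \<Longrightarrow> level u r \<in> sets borel"
  using compact_level by (simp add: borel_compact)

text \<open>
  Both measures represent the same functional on test functions supported in the set, since the
  Laplacian of such a function has its support there too.
\<close>

lemma Lap_above:
  assumes r: "r < 0" and A: "A \<in> sets borel" "A \<subseteq> above r"
  shows "emeasure (Lap r) A = emeasure \<Delta> A"
proof (rule emeasure_eq_of_test_functions[OF open_above[of r]])
  have sub: "above r \<subseteq> unit_disc" by (auto simp: above_def)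
  show "emeasure \<Delta> K < \<infinity>" "emeasure (Lap r) K < \<infinity>" if "compact K" "K \<subseteq> above r" for K
    using order_trans[OF that(2) sub] by (rule \<Delta>_compact[OF that(1)], rule Lap_compact[OF r that(1)])
  fix \<psi> assume \<psi>: "test_function_on (above r) \<psi>"
  note \<psi>' = test_function_mono[OF \<psi> sub]
  have "trunc r z * laplacian \<psi> z = val z * laplacian \<psi> z" for z
  proof (cases "z \<in> above r")
    case True
    then show ?thesis by (auto simp: above_def trunc_def val_def max_def)
  next
    case False
    then have "z \<notin> supp (laplacian \<psi>)"
      using test_function_supp[OF test_function_laplacian[OF \<psi>]] by blast
    from notin_supp[OF this] show ?thesis by simp
  qed
  then show "(\<integral>z. \<psi> z \<partial>Lap r) = (\<integral>z. \<psi> z \<partial>\<Delta>)"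
    by (simp only: integral_Lap[OF r \<psi>'] integral_\<Delta>[OF \<psi>'])
qed (use r A in auto)

text \<open>
  Here the truncation is constant.
\<close>

lemma Lap_sublevel:
  assumes r: "r < 0"
  shows "emeasure (Lap r) (sublevel u r) = 0"
proof -
  have sub: "sublevel u r \<subseteq> unit_disc" by (auto simp: sublevel_def)
  have "emeasure (Lap r) (sublevel u r) \<le> emeasure (null_measure borel) (sublevel u r)"
  proof (rule emeasure_le_of_test_functions[OF open_sublevel[of r]])
    show "emeasure (Lap r) K < \<infinity>" if "compact K" "K \<subseteq> sublevel u r" for K
      by (rule Lap_compact[OF r that(1) order_trans[OF that(2) sub]])
    fix \<psi> assume \<psi>: "test_function_on (sublevel u r) \<psi>" "\<And>z. 0 \<le> \<psi> z"
    note \<psi>' = test_function_mono[OF \<psi>(1) sub]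
    have "trunc r z * laplacian \<psi> z = r * laplacian \<psi> z" for z
    proof (cases "z \<in> sublevel u r")
      case True
      then show ?thesis by (auto simp: sublevel_def trunc_def max_def)
    next
      case False
      then have "z \<notin> supp (laplacian \<psi>)"
        using test_function_supp[OF test_function_laplacian[OF \<psi>(1)]] by blast
      from notin_supp[OF this] show ?thesis by simp
    qed
    then have "(\<integral>z. trunc r z * laplacian \<psi> z \<partial>lborel) = r * (\<integral>z. laplacian \<psi> z \<partial>lborel)"
      by (simp only: integral_mult_right_zero)
    then show "(\<integral>z. \<psi> z \<partial>Lap r) \<le> (\<integral>z. \<psi> z \<partial>null_measure borel)"
      using laplacian_integral_0[OF \<psi>' \<psi>(2)] by (simp add: integral_Lap[OF r \<psi>'] integral_null_measure)
  qed (use r in auto)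
  then show ?thesis by simp
qed

lemma finite_Lap:
  assumes r: "r < 0" shows "finite_measure (Lap r)"
proof (rule finite_measureI)
  let ?K = "{z \<in> unit_disc. u z \<le> ereal r}"
  have K: "?K \<in> sets borel" using compact_closed_sublevel[OF r] by (simp add: borel_compact)
  have e: "space (Lap r) = ?K \<union> (above r \<union> - unit_disc)"
    using r by (auto simp: above_def)
  have "emeasure (Lap r) (?K \<union> (above r \<union> - unit_disc)) \<le> emeasure (Lap r) ?K + (emeasure (Lap r) (above r) + emeasure (Lap r) (- unit_disc))"
    using r K by (intro order_trans[OF emeasure_subadditive] add_left_mono emeasure_subadditive) auto
  also have "\<dots> = emeasure (Lap r) ?K + emeasure \<Delta> (above r)"
    by (simp only: Lap_outside[OF r] Lap_above[OF r above_sublevel_borel(1) subset_refl] add_0_right)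
  also have "\<dots> < \<infinity>"
    using Lap_compact[OF r compact_closed_sublevel[OF r] Collect_restrict] finite_measure.emeasure_finite[OF finite_\<Delta>, of "above r"]
    by (simp add: less_top)
  finally show "emeasure (Lap r) (space (Lap r)) \<noteq> \<infinity>" unfolding e by simp
qed

definition \<Delta>_above :: "real \<Rightarrow> complex measure" where
  "\<Delta>_above r = density \<Delta> (indicator (unit_disc - sublevel u r))"

lemma sets_\<Delta>_above [measurable_cong, simp]: "sets (\<Delta>_above r) = sets borel"
  by (simp add: \<Delta>_above_def)

lemma emeasure_\<Delta>_above: "A \<in> sets borel \<Longrightarrow> emeasure (\<Delta>_above r) A = emeasure \<Delta> ((unit_disc - sublevel u r) \<inter> A)"
  unfolding \<Delta>_above_def by (rule emeasure_restricted) auto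

lemma finite_\<Delta>_above: "finite_measure (\<Delta>_above r)"
  using finite_measure.emeasure_finite[OF finite_\<Delta>]
  by (intro finite_measureI) (simp add: emeasure_\<Delta>_above sets_eq_imp_space_eq[OF sets_\<Delta>_above])

lemma \<Delta>_above_le_Lap_less:
  assumes "s < r" "r < 0" "A \<in> sets borel"
  shows "emeasure (\<Delta>_above r) A \<le> emeasure (Lap s) A"
proof -
  have s: "s < 0" using assms by simp
  have "emeasure (\<Delta>_above r) A \<le> emeasure \<Delta> (above s \<inter> A)"
    unfolding emeasure_\<Delta>_above[OF assms(3)]
  proof (rule emeasure_mono)
    show "(unit_disc - sublevel u r) \<inter> A \<subseteq> above s \<inter> A"
    proof
      fix z assume z: "z \<in> (unit_disc - sublevel u r) \<inter> A"
      then have "ereal r \<le> u z" by (auto simp: sublevel_def)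
      then have "ereal s < u z" using assms(1) by (meson less_ereal.simps(1) less_le_trans)
      then show "z \<in> above s \<inter> A" using z by (auto simp: above_def)
    qed
  qed (use assms in auto)
  also have "\<dots> = emeasure (Lap s) (above s \<inter> A)"
    using assms(3) by (intro Lap_above[OF s, symmetric]) auto
  also have "\<dots> \<le> emeasure (Lap s) A"
    using s assms(3) by (intro emeasure_mono) auto
  finally show ?thesis .
qed

lemma trunc_Lipschitz:
  assumes "s < r" "r < 0"
  shows "\<bar>trunc s z - trunc r z\<bar> \<le> r - s"
proof (cases "norm z < 1")
  case True
  then show ?thesis using assms negative[OF True] by (cases "u z") (auto simp: trunc_def max_def)
qed (use assms in \<open>simp add: trunc_def\<close>)

lemma integral_Lap_tendsto:
  assumes r: "r < 0" and \<psi>: "test_function_on unit_disc \<psi>"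
  shows "(\<lambda>n. \<integral>z. \<psi> z \<partial>Lap (r - 1 / real (Suc n))) \<longlonglongrightarrow> (\<integral>z. \<psi> z \<partial>Lap r)"
proof -
  have s: "r - 1 / real (Suc n) < r" "r - 1 / real (Suc n) < 0" for n
  proof -
    have "0 < 1 / real (Suc n)" by simp
    then show "r - 1 / real (Suc n) < r" "r - 1 / real (Suc n) < 0" using r by linarith+
  qed
  note int = integrable_trunc[OF _ test_function_laplacian[OF \<psi>]]
  have m: "laplacian \<psi> \<in> borel_measurable borel"
    by (rule borel_measurable_continuous_onI[OF test_function_continuous[OF test_function_laplacian[OF \<psi>]]])
  have intl: "integrable lborel (\<lambda>z. \<bar>laplacian \<psi> z\<bar>)"
    using integrable_bounded_times_test_function[of "\<lambda>_. 1" 1, OF _ _ test_function_laplacian[OF \<psi>]] by simp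
  have le: "\<bar>(\<integral>z. trunc (r - 1 / real (Suc n)) z * laplacian \<psi> z \<partial>lborel) - (\<integral>z. trunc r z * laplacian \<psi> z \<partial>lborel)\<bar>
     \<le> 1 / real (Suc n) * (\<integral>z. \<bar>laplacian \<psi> z\<bar> \<partial>lborel)" for n
  proof -
    have "(\<integral>z. trunc (r - 1 / real (Suc n)) z * laplacian \<psi> z \<partial>lborel) - (\<integral>z. trunc r z * laplacian \<psi> z \<partial>lborel)
        = (\<integral>z. (trunc (r - 1 / real (Suc n)) z - trunc r z) * laplacian \<psi> z \<partial>lborel)"
      using int[OF s(2)] int[OF r] by (simp add: left_diff_distrib)
    also have "\<bar>\<dots>\<bar> \<le> (\<integral>z. 1 / real (Suc n) * \<bar>laplacian \<psi> z\<bar> \<partial>lborel)"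
    proof (rule integral_abs_bound_integral)
      show "integrable lborel (\<lambda>z. (trunc (r - 1 / real (Suc n)) z - trunc r z) * laplacian \<psi> z)"
        using int[OF s(2)] int[OF r] by (simp add: left_diff_distrib)
      show "integrable lborel (\<lambda>z. 1 / real (Suc n) * \<bar>laplacian \<psi> z\<bar>)" using intl by simp
      show "\<bar>(trunc (r - 1 / real (Suc n)) z - trunc r z) * laplacian \<psi> z\<bar> \<le> 1 / real (Suc n) * \<bar>laplacian \<psi> z\<bar>" for z
        unfolding abs_mult using trunc_Lipschitz[OF s(1) r, of n z] by (intro mult_right_mono) auto
    qed
    finally show ?thesis by simp
  qed
  have "(\<lambda>n. 1 / real (Suc n) * (\<integral>z. \<bar>laplacian \<psi> z\<bar> \<partial>lborel)) \<longlonglongrightarrow> 0 * (\<integral>z. \<bar>laplacian \<psi> z\<bar> \<partial>lborel)"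
    by (intro tendsto_mult tendsto_const LIMSEQ_Suc[OF lim_1_over_n])
  then have lim: "(\<lambda>n. 1 / real (Suc n) * (\<integral>z. \<bar>laplacian \<psi> z\<bar> \<partial>lborel)) \<longlonglongrightarrow> 0"
    by (simp only: mult_zero_left)
  have "(\<lambda>n. (\<integral>z. trunc (r - 1 / real (Suc n)) z * laplacian \<psi> z \<partial>lborel) - (\<integral>z. trunc r z * laplacian \<psi> z \<partial>lborel)) \<longlonglongrightarrow> 0"
  proof (rule Lim_null_comparison[OF always_eventually lim], rule allI)
    fix n
    show "norm ((\<integral>z. trunc (r - 1 / real (Suc n)) z * laplacian \<psi> z \<partial>lborel) - (\<integral>z. trunc r z * laplacian \<psi> z \<partial>lborel))
       \<le> 1 / real (Suc n) * (\<integral>z. \<bar>laplacian \<psi> z\<bar> \<partial>lborel)"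
      unfolding real_norm_def by (rule le)
  qed
  then have "(\<lambda>n. \<integral>z. trunc (r - 1 / real (Suc n)) z * laplacian \<psi> z \<partial>lborel) \<longlonglongrightarrow> (\<integral>z. trunc r z * laplacian \<psi> z \<partial>lborel)"
    by (rule LIM_zero_cancel)
  then show ?thesis
    unfolding integral_Lap[OF r \<psi>] integral_Lap[OF s(2) \<psi>] by (intro tendsto_mult tendsto_const)
qed

lemma integral_mono_emeasure:
  assumes "sets M = sets N" "\<And>A. A \<in> sets N \<Longrightarrow> emeasure M A \<le> emeasure N A"
    "integrable M f" "integrable N f" "\<And>x. 0 \<le> f x"
  shows "(\<integral>x. f x \<partial>M) \<le> (\<integral>x. (f x::real) \<partial>N)"
proof -
  have "M \<le> N" using assms(1,2) by (subst le_measure) auto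
  then have "(\<integral>\<^sup>+ x. ennreal (f x) \<partial>M) \<le> (\<integral>\<^sup>+ x. ennreal (f x) \<partial>N)"
    by (rule nn_integral_mono_measure[OF assms(1)])
  then show ?thesis
    using assms(3-5) by (simp add: nn_integral_eq_integral Bochner_Integration.integral_nonneg)
qed

text \<open>
  The strict version for levels \<open>s < r\<close> is the locality of the Laplacian on \<open>{u > s}\<close>; it is stable
  under the weak limit \<open>s \<rightarrow> r\<close>.  This is where the subtraction in the Demailly measure turns out to be a
  subtraction of a smaller measure.
\<close>

lemma \<Delta>_above_le_Lap:
  assumes r: "r < 0" and A: "A \<in> sets borel"
  shows "emeasure (\<Delta>_above r) A \<le> emeasure (Lap r) A"
proof -
  have fin: "emeasure (\<Delta>_above r) K < \<infinity>" for K
    using finite_measure.emeasure_finite[OF finite_\<Delta>_above, of r K] by (simp add: less_top)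
  have "emeasure (\<Delta>_above r) (A \<inter> unit_disc) \<le> emeasure (Lap r) (A \<inter> unit_disc)"
  proof (rule emeasure_le_of_test_functions[of unit_disc])
    fix \<psi> assume \<psi>: "test_function_on unit_disc \<psi>" "\<And>z. 0 \<le> \<psi> z"
    show "(\<integral>z. \<psi> z \<partial>\<Delta>_above r) \<le> (\<integral>z. \<psi> z \<partial>Lap r)"
    proof (rule LIMSEQ_le_const[OF integral_Lap_tendsto[OF r \<psi>(1)]], intro exI allI impI)
      fix n
      have s: "r - 1 / real (Suc n) < r" by simp
      then have s0: "r - 1 / real (Suc n) < 0" using r by linarith
      show "(\<integral>z. \<psi> z \<partial>\<Delta>_above r) \<le> (\<integral>z. \<psi> z \<partial>Lap (r - 1 / real (Suc n)))"
        using s0 \<Delta>_above_le_Lap_less[OF s r] \<psi>(2)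
        by (intro integral_mono_emeasure integrable_test_function[OF _ _ \<psi>(1)] fin Lap_compact) auto
    qed
  qed (use r A fin Lap_compact in auto)
  also have "\<dots> \<le> emeasure (Lap r) A"
    using r A by (intro emeasure_mono) auto
  also have "emeasure (\<Delta>_above r) (A \<inter> unit_disc) = emeasure (\<Delta>_above r) A"
    using A by (simp add: emeasure_\<Delta>_above) (rule arg_cong[where f = "emeasure \<Delta>"], auto)
  finally show ?thesis .
qed

end

section \<open>Monotonicity of the level integrals\<close>

context exhaustion
begin

abbreviation \<mu> :: "real \<Rightarrow> complex measure" where "\<mu> \<equiv> demailly_measure u"

lemma sets_\<mu> [measurable_cong, simp]: "r < 0 \<Longrightarrow> sets (\<mu> r) = sets borel"
  by (simp add: demailly_measure_def flip: Lap_def)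

lemma emeasure_\<mu>:
  assumes r: "r < 0" and A: "A \<in> sets borel"
  shows "emeasure (\<mu> r) A = emeasure (Lap r) A - emeasure (\<Delta>_above r) A"
  unfolding demailly_measure_def Lap_def[symmetric] \<Delta>_above_def[symmetric]
  by (rule emeasure_diff_measure[OF finite_Lap[OF r] finite_\<Delta>_above])
     (use r A \<Delta>_above_le_Lap[OF r] in auto)

lemma Lap_split:
  assumes r: "r < 0" and A: "A \<in> sets borel"
  shows "emeasure (Lap r) A = emeasure (\<mu> r) A + emeasure (\<Delta>_above r) A"
  unfolding emeasure_\<mu>[OF r A] using \<Delta>_above_le_Lap[OF r A] by (simp add: diff_add_cancel_ennreal)

lemma \<mu>_outside_level:
  assumes r: "r < 0"
  shows "emeasure (\<mu> r) (- level u r) = 0"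
proof -
  have 1: "emeasure (\<mu> r) (above r) = 0"
  proof -
    have "(unit_disc - sublevel u r) \<inter> above r = above r"
      by (auto simp: above_def sublevel_def)
    then have "emeasure (\<Delta>_above r) (above r) = emeasure \<Delta> (above r)"
      by (simp add: emeasure_\<Delta>_above)
    then show ?thesis
      using finite_measure.emeasure_finite[OF finite_\<Delta>, of "above r"]
      by (simp add: emeasure_\<mu>[OF r] Lap_above[OF r above_sublevel_borel(1) subset_refl])
  qed
  have 2: "emeasure (\<mu> r) (sublevel u r) = 0" by (simp add: emeasure_\<mu>[OF r] Lap_sublevel[OF r])
  have D: "- unit_disc \<in> sets (borel :: complex measure)" by (intro borel_comp borel_open) simp
  have 3: "emeasure (\<mu> r) (- unit_disc) = 0" using D by (simp add: emeasure_\<mu>[OF r] Lap_outside[OF r])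
  have e: "- level u r = above r \<union> (sublevel u r \<union> - unit_disc)"
    by (auto simp: level_def above_def sublevel_def)
  have "emeasure (\<mu> r) (- level u r) \<le> emeasure (\<mu> r) (above r) + (emeasure (\<mu> r) (sublevel u r) + emeasure (\<mu> r) (- unit_disc))"
    unfolding e using r D by (intro order_trans[OF emeasure_subadditive] add_left_mono emeasure_subadditive) auto
  then show ?thesis using 1 2 3 by simp
qed

lemma AE_\<mu>_level:
  assumes r: "r < 0" shows "AE z in \<mu> r. z \<in> level u r"
proof -
  have "AE z in \<mu> r. z \<notin> - level u r"
  proof (rule AE_not_in, rule null_setsI)
    show "- level u r \<in> sets (\<mu> r)" using r by (simp add: borel_comp)
  qed (rule \<mu>_outside_level[OF r])
  then show ?thesis by eventually_elim simp
qed

lemma finite_\<mu>: "r < 0 \<Longrightarrow> emeasure (\<mu> r) A < \<infinity>"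
proof -
  assume r: "r < 0"
  have "emeasure (\<mu> r) UNIV \<le> emeasure (Lap r) UNIV"
    by (simp add: emeasure_\<mu>[OF r] diff_le_self_ennreal)
  also have "\<dots> < \<infinity>"
    using finite_measure.emeasure_finite[OF finite_Lap[OF r], of UNIV] by (simp add: less_top)
  finally show "emeasure (\<mu> r) A < \<infinity>"
    using emeasure_space[of "\<mu> r" A] sets_eq_imp_space_eq[OF sets_\<mu>[OF r]] by (auto intro: le_less_trans)
qed

text \<open>
  Let \<open>F = \<eta> \<phi>\<close> with a cutoff \<open>\<eta>\<close> that is \<open>1\<close> near \<open>{u \<le> s}\<close>.  Since \<open>\<mu> t\<close> lives on its level set, the
  integral of \<open>\<phi>\<close> there is \<open>\<integral> F\<close> against \<open>\<Delta>u\<^sub>t\<close> minus \<open>\<integral> F\<close> over \<open>{u \<ge> t}\<close> against \<open>\<Delta>u\<close>.  From \<open>t = r\<close> to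
  \<open>t = s\<close> the first term increases, because \<open>u\<^sub>s - u\<^sub>r \<ge> 0\<close> is supported where \<open>\<Delta>F = \<Delta>\<phi> \<ge> 0\<close>, and the
  subtracted term decreases.
\<close>

lemma smooth_level_integral_mono:
  assumes rs: "r < s" "s < 0" and \<phi>: "smooth \<phi>" "\<And>z. 0 \<le> \<phi> z" "\<And>z. 0 \<le> laplacian \<phi> z"
  shows "(\<integral>\<^sup>+ z\<in>level u r. ennreal (\<phi> z) \<partial>\<mu> r) \<le> (\<integral>\<^sup>+ z\<in>level u s. ennreal (\<phi> z) \<partial>\<mu> s)"
proof -
  have r: "r < 0" using rs by simp
  define K where "K = {z \<in> unit_disc. u z \<le> ereal s}"
  have K: "compact K" "K \<subseteq> unit_disc" using compact_closed_sublevel[OF rs(2)] by (auto simp: K_def)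
  obtain \<eta> W where \<eta>: "test_function_on unit_disc \<eta>" "\<And>z. 0 \<le> \<eta> z" "open W" "K \<subseteq> W" "\<And>z. z \<in> W \<Longrightarrow> \<eta> z = 1"
    using smooth_Urysohn[OF K(1) open_ball K(2)] by metis
  define F where "F z = \<eta> z * \<phi> z" for z
  have F: "test_function_on unit_disc F" "\<And>z. 0 \<le> F z"
    using test_function_mult[OF \<eta>(1) \<phi>(1)] \<eta>(2) \<phi>(2) by (simp_all add: F_def[abs_def])
  have Fm [measurable]: "F \<in> borel_measurable borel"
    by (rule borel_measurable_continuous_onI[OF test_function_continuous[OF F(1)]])
  have split: "(\<integral>\<^sup>+ z. ennreal (F z) \<partial>Lap t) = (\<integral>\<^sup>+ z\<in>level u t. ennreal (\<phi> z) \<partial>\<mu> t) + (\<integral>\<^sup>+ z. ennreal (F z) \<partial>\<Delta>_above t)"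
    if t: "t < 0" "t \<le> s" for t
  proof -
    have "(\<integral>\<^sup>+ z. ennreal (F z) \<partial>Lap t) = (\<integral>\<^sup>+ z. ennreal (F z) \<partial>\<mu> t) + (\<integral>\<^sup>+ z. ennreal (F z) \<partial>\<Delta>_above t)"
      using t Lap_split[OF t(1)] by (intro nn_integral_add_measure) auto
    also have "(\<integral>\<^sup>+ z. ennreal (F z) \<partial>\<mu> t) = (\<integral>\<^sup>+ z\<in>level u t. ennreal (\<phi> z) \<partial>\<mu> t)"
      using AE_\<mu>_level[OF t(1)]
    proof (intro nn_integral_cong_AE, eventually_elim)
      fix z assume z: "z \<in> level u t"
      then have "z \<in> K" using t(2) by (auto simp: level_def K_def)
      then have "\<eta> z = 1" using \<eta>(4,5) by blast
      then show "ennreal (F z) = ennreal (\<phi> z) * indicator (level u t) z" using z by (simp add: F_def)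
    qed
    finally show ?thesis .
  qed
  have "(\<integral>z. F z \<partial>Lap r) \<le> (\<integral>z. F z \<partial>Lap s)"
  proof -
    have "(\<integral>z. trunc r z * laplacian F z \<partial>lborel) \<le> (\<integral>z. trunc s z * laplacian F z \<partial>lborel)"
    proof (rule integral_mono)
      fix z
      show "trunc r z * laplacian F z \<le> trunc s z * laplacian F z"
      proof (cases "z \<in> K")
        case True
        have "laplacian F z = laplacian \<phi> z"
          using \<eta>(3-5) True by (intro laplacian_cong_open[of W]) (auto simp: F_def)
        moreover have "trunc r z \<le> trunc s z"
        proof -
          have z: "norm z < 1" using True by (simp add: K_def)
          have "max (u z) (ereal r) \<le> max (u z) (ereal s)" using rs by (intro max.mono) auto
          then have "ereal (trunc r z) \<le> ereal (trunc s z)"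
            unfolding ereal_trunc[OF z r] ereal_trunc[OF z rs(2)] .
          then show ?thesis by simp
        qed
        ultimately show ?thesis using \<phi>(3)[of z] by (simp add: mult_right_mono)
      next
        case False
        have "trunc r z = trunc s z"
        proof (cases "norm z < 1")
          case True
          then have "ereal s < u z" using False by (auto simp: K_def)
          moreover from this have "ereal r < u z" using rs(1) by (meson less_ereal.simps(1) less_trans)
          ultimately show ?thesis using True by (simp add: trunc_def max_absorb1 less_imp_le)
        qed (simp add: trunc_def)
        then show ?thesis by simp
      qed
    qed (intro integrable_trunc[OF _ test_function_laplacian[OF F(1)]] r rs(2))+
    then show ?thesis
      unfolding integral_Lap[OF r F(1)] integral_Lap[OF rs(2) F(1)] by (intro mult_left_mono) auto
  qed
  moreover have "(\<integral>\<^sup>+ z. ennreal (F z) \<partial>Lap t) = ennreal (\<integral>z. F z \<partial>Lap t)" if "t < 0" for t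
    using that F Lap_compact[OF that] by (intro nn_integral_eq_integral integrable_test_function[OF _ _ F(1)]) auto
  ultimately have Y: "(\<integral>\<^sup>+ z. ennreal (F z) \<partial>Lap r) \<le> (\<integral>\<^sup>+ z. ennreal (F z) \<partial>Lap s)"
    using r rs by (simp add: ennreal_leI)
  have X: "(\<integral>\<^sup>+ z. ennreal (F z) \<partial>\<Delta>_above s) \<le> (\<integral>\<^sup>+ z. ennreal (F z) \<partial>\<Delta>_above r)"
  proof (rule nn_integral_mono_measure)
    have "emeasure (\<Delta>_above s) A \<le> emeasure (\<Delta>_above r) A" if "A \<in> sets borel" for A
      unfolding emeasure_\<Delta>_above[OF that]
    proof (rule emeasure_mono)
      show "(unit_disc - sublevel u s) \<inter> A \<subseteq> (unit_disc - sublevel u r) \<inter> A"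
      proof
        fix z assume z: "z \<in> (unit_disc - sublevel u s) \<inter> A"
        then have "ereal s \<le> u z" by (auto simp: sublevel_def)
        then have "ereal r \<le> u z" using rs(1) by (meson ereal_less_eq(3) less_imp_le order_trans)
        then show "z \<in> (unit_disc - sublevel u r) \<inter> A" using z by (auto simp: sublevel_def)
      qed
    qed (use that in auto)
    then show "\<Delta>_above s \<le> \<Delta>_above r" by (subst le_measure) auto
  qed simp
  have fin: "(\<integral>\<^sup>+ z. ennreal (F z) \<partial>\<Delta>_above r) \<noteq> \<infinity>"
  proof -
    have "integrable (\<Delta>_above r) F"
    proof (rule integrable_test_function[OF _ _ F(1)])
      show "emeasure (\<Delta>_above r) K < \<infinity>" for K
        using finite_measure.emeasure_finite[OF finite_\<Delta>_above, of r K] by (simp add: less_top)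
    qed simp
    then show ?thesis using F(2) by (simp add: nn_integral_eq_integral)
  qed
  let ?X = "\<integral>\<^sup>+ z. ennreal (F z) \<partial>\<Delta>_above r"
  have "?X + (\<integral>\<^sup>+ z\<in>level u r. ennreal (\<phi> z) \<partial>\<mu> r) = (\<integral>\<^sup>+ z. ennreal (F z) \<partial>Lap r)"
    using split[OF r] rs by (simp add: add.commute)
  also have "\<dots> \<le> (\<integral>\<^sup>+ z. ennreal (F z) \<partial>Lap s)" by (rule Y)
  also have "\<dots> = (\<integral>\<^sup>+ z\<in>level u s. ennreal (\<phi> z) \<partial>\<mu> s) + (\<integral>\<^sup>+ z. ennreal (F z) \<partial>\<Delta>_above s)"
    using split[OF rs(2)] by simp
  also have "\<dots> \<le> (\<integral>\<^sup>+ z\<in>level u s. ennreal (\<phi> z) \<partial>\<mu> s) + ?X"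
    by (intro add_left_mono X)
  also have "\<dots> = ?X + (\<integral>\<^sup>+ z\<in>level u s. ennreal (\<phi> z) \<partial>\<mu> s)" by (rule add.commute)
  finally show ?thesis using fin by (simp add: ennreal_add_left_cancel_le)
qed

lemma level_integrand_measurable:
  assumes r: "r < 0" and f: "f holomorphic_on unit_disc" "0 < p"
  shows "(\<lambda>z. ennreal (norm (f z) powr p) * indicator (level u r) z) \<in> borel_measurable (\<mu> r)"
proof -
  have "level u r \<subseteq> unit_disc" by (auto simp: level_def)
  then have "continuous_on (level u r) (\<lambda>z. norm (f z) powr p)"
    using holomorphic_on_imp_continuous_on[OF f(1)] f(2)
    by (intro continuous_on_powr' continuous_intros) (auto intro: continuous_on_subset)
  then have "(\<lambda>z. indicator (level u r) z *\<^sub>R (norm (f z) powr p)) \<in> borel_measurable borel"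
    by (rule borel_measurable_continuous_on_indicator[OF borel_level[OF r]])
  then have "(\<lambda>z. ennreal (indicator (level u r) z *\<^sub>R (norm (f z) powr p))) \<in> borel_measurable borel"
    by measurable
  also have "(\<lambda>z. ennreal (indicator (level u r) z *\<^sub>R (norm (f z) powr p))) = (\<lambda>z. ennreal (norm (f z) powr p) * indicator (level u r) z)"
    by (auto simp: fun_eq_iff indicator_def)
  finally show ?thesis using r by (simp cong: measurable_cong_sets)
qed

text \<open>
  Taylor polynomials replace \<open>f\<close> so that the regularized powers are smooth on the whole plane.  On a
  level set they converge pointwise and stay below a constant, so dominated convergence applies.
\<close>

proposition level_integral_mono:
  assumes rs: "r < s" "s < 0" and f: "f holomorphic_on unit_disc" and p: "0 < p"
  shows "level_integral u p f r \<le> level_integral u p f s"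
proof -
  define c where "c k = (deriv ^^ k) f 0 / fact k" for k
  define P where "P n z = (\<Sum>k<n. c k * z ^ k)" for n z
  define \<phi> where "\<phi> n = regularized_power (p / 2) (1 / real (Suc n)) (P n)" for n
  have entire: "P n holomorphic_on UNIV" for n
    unfolding P_def by (intro holomorphic_intros)
  have sums: "(\<lambda>k. c k * z ^ k) sums f z" if "norm z < 1" for z
    using holomorphic_power_series[OF f, of z] that by (simp add: c_def)
  have lim: "(\<lambda>n. \<integral>\<^sup>+ z\<in>level u t. ennreal (\<phi> n z) \<partial>\<mu> t) \<longlonglongrightarrow> level_integral u p f t" if t: "t < 0" for t
    unfolding level_integral_def
  proof -
    have lev: "level u t \<subseteq> unit_disc" by (auto simp: level_def)
    obtain R where R: "0 < R" "R < 1" "level u t \<subseteq> cball 0 R"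
      using compact_subset_disc[OF compact_level[OF t] lev] by metis
    have "summable (\<lambda>k. norm (c k * of_real R ^ k))"
    proof (rule powser_insidea)
      have "norm (complex_of_real ((1 + R) / 2)) < 1" using R unfolding norm_of_real by simp
      from sums_summable[OF sums[OF this]] show "summable (\<lambda>k. c k * of_real ((1 + R) / 2) ^ k)" .
      show "norm (complex_of_real R) < norm (complex_of_real ((1 + R) / 2))"
        using R unfolding norm_of_real by simp
    qed
    then have sb: "summable (\<lambda>k. norm (c k) * R ^ k)"
      using R by (simp add: norm_mult norm_power)
    define B where "B = (\<Sum>k. norm (c k) * R ^ k)"
    have PB: "norm (P n z) \<le> B" if "z \<in> level u t" for n z
    proof -
      have "norm (P n z) \<le> (\<Sum>k<n. norm (c k) * norm z ^ k)"
        unfolding P_def by (rule order_trans[OF norm_sum]) (simp add: norm_mult norm_power)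
      also have "\<dots> \<le> (\<Sum>k<n. norm (c k) * R ^ k)"
        using that R by (intro sum_mono mult_left_mono power_mono) auto
      also have "\<dots> \<le> B" unfolding B_def using R by (intro sum_le_suminf sb) auto
      finally show ?thesis .
    qed
    define w where "w z = ennreal ((B\<^sup>2 + 1) powr (p / 2)) * indicator (level u t) z" for z
    show "(\<lambda>n. \<integral>\<^sup>+ z\<in>level u t. ennreal (\<phi> n z) \<partial>\<mu> t) \<longlonglongrightarrow> (\<integral>\<^sup>+ z\<in>level u t. ennreal (norm (f z) powr p) \<partial>\<mu> t)"
    proof (rule nn_integral_dominated_convergence[where w = w])
      note borel_level[OF t, measurable] sets_\<mu>[OF t, measurable_cong]
      show "(\<lambda>z. ennreal (\<phi> n z) * indicator (level u t) z) \<in> borel_measurable (\<mu> t)" for n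
      proof -
        have "smooth (\<phi> n)" unfolding \<phi>_def using entire p by (intro smooth_regularized_power) auto
        then have "continuous_on UNIV (\<phi> n)" by (metis higher_differentiable_continuous)
        from borel_measurable_continuous_onI[OF this]
        have [measurable]: "\<phi> n \<in> borel_measurable borel" .
        show ?thesis using t by measurable
      qed
      show "(\<lambda>z. ennreal (norm (f z) powr p) * indicator (level u t) z) \<in> borel_measurable (\<mu> t)"
        by (rule level_integrand_measurable[OF t f p])
      show "w \<in> borel_measurable (\<mu> t)" unfolding w_def using t by measurable
      show "AE z in \<mu> t. ennreal (\<phi> n z) * indicator (level u t) z \<le> w z" for n
      proof (rule AE_I2)
        fix z
        show "ennreal (\<phi> n z) * indicator (level u t) z \<le> w z"
        proof (cases "z \<in> level u t")
          case True
          have "(norm (P n z))\<^sup>2 \<le> B\<^sup>2" using PB[OF True] by (intro power_mono) auto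
          moreover have "1 / real (Suc n) \<le> 1" by simp
          ultimately have "\<phi> n z \<le> (B\<^sup>2 + 1) powr (p / 2)"
            unfolding \<phi>_def regularized_power_def using p by (intro powr_mono2 add_mono) auto
          then show ?thesis using True by (simp add: w_def ennreal_leI)
        qed simp
      qed
      show "(\<integral>\<^sup>+ z. w z \<partial>\<mu> t) < \<infinity>"
        unfolding w_def using t finite_\<mu>[OF t, of "level u t"]
        by (subst nn_integral_cmult_indicator) (auto simp: ennreal_mult_less_top)
      show "AE z in \<mu> t. (\<lambda>n. ennreal (\<phi> n z) * indicator (level u t) z) \<longlonglongrightarrow> ennreal (norm (f z) powr p) * indicator (level u t) z"
      proof (rule AE_I2)
        fix z
        show "(\<lambda>n. ennreal (\<phi> n z) * indicator (level u t) z) \<longlonglongrightarrow> ennreal (norm (f z) powr p) * indicator (level u t) z"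
        proof (cases "z \<in> level u t")
          case True
          then have "norm z < 1" using R by auto
          from sums[OF this] have "(\<lambda>n. P n z) \<longlonglongrightarrow> f z" by (simp add: sums_def P_def)
          then have "(\<lambda>n. ((norm (P n z))\<^sup>2 + 1 / real (Suc n)) powr (p / 2)) \<longlonglongrightarrow> ((norm (f z))\<^sup>2 + 0) powr (p / 2)"
            using p by (intro tendsto_powr' tendsto_add tendsto_power tendsto_norm tendsto_const LIMSEQ_Suc[OF lim_1_over_n])
              (auto intro!: always_eventually add_nonneg_nonneg)
          also have "((norm (f z))\<^sup>2 + 0) powr (p / 2) = norm (f z) powr p"
            by (cases "f z = 0") (simp_all add: powr_powr flip: powr_numeral)
          finally have "(\<lambda>n. \<phi> n z) \<longlonglongrightarrow> norm (f z) powr p" by (simp only: \<phi>_def regularized_power_def)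
          then show ?thesis using True by (simp add: tendsto_ennrealI)
        qed simp
      qed
    qed
  qed
  have "(\<integral>\<^sup>+ z\<in>level u r. ennreal (\<phi> n z) \<partial>\<mu> r) \<le> (\<integral>\<^sup>+ z\<in>level u s. ennreal (\<phi> n z) \<partial>\<mu> s)" for n
  proof (rule smooth_level_integral_mono[OF rs])
    show "smooth (\<phi> n)" unfolding \<phi>_def using entire p by (intro smooth_regularized_power) auto
    show "0 \<le> laplacian (\<phi> n) z" for z unfolding \<phi>_def using entire p by (intro laplacian_regularized_power) auto
    show "0 \<le> \<phi> n z" for z by (simp add: \<phi>_def regularized_power_def)
  qed
  then show ?thesis
    using rs by (intro LIMSEQ_le[OF lim lim]) auto
qed

end

section \<open>Pointwise control by the Hardy norm\<close>

text \<open>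
  Functions in the Hardy space are unrestricted outside the disc.  The indicator makes the trace on
  the circle of radius \<open>R < 1\<close> a Borel function on the plane without changing it on the unit circle.
\<close>

definition circle_trace :: "(complex \<Rightarrow> complex) \<Rightarrow> real \<Rightarrow> complex \<Rightarrow> real" where
  "circle_trace g R \<zeta> = indicator (cball 0 1) \<zeta> *\<^sub>R norm (g (complex_of_real R * \<zeta>))"

lemma
  assumes g: "g holomorphic_on unit_disc" and R: "0 < R" "R < 1"
  shows circle_trace_measurable: "circle_trace g R \<in> borel_measurable borel"
    and circle_trace_continuous: "continuous_on (cball 0 1) (\<lambda>\<zeta>. g (complex_of_real R * \<zeta>))"
proof -
  have sub: "(\<lambda>\<zeta>. complex_of_real R * \<zeta>) ` cball 0 1 \<subseteq> unit_disc"
  proof clarify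
    fix \<zeta> :: complex assume "\<zeta> \<in> cball 0 1"
    then have "R * norm \<zeta> \<le> R * 1" using R by (intro mult_left_mono) auto
    then have "R * norm \<zeta> < 1" using R by linarith
    then show "complex_of_real R * \<zeta> \<in> unit_disc" using R by (simp add: norm_mult)
  qed
  show c: "continuous_on (cball 0 1) (\<lambda>\<zeta>. g (complex_of_real R * \<zeta>))"
    by (rule continuous_on_compose2[OF holomorphic_on_imp_continuous_on[OF g] _ sub]) (intro continuous_intros)
  show "circle_trace g R \<in> borel_measurable borel"
    unfolding circle_trace_def[abs_def]
    by (rule borel_measurable_continuous_on_indicator) (auto intro!: continuous_intros c)
qed

lemma circle_trace_circle: "norm \<zeta> = 1 \<Longrightarrow> circle_trace g R \<zeta> = norm (g (complex_of_real R * \<zeta>))"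
  by (simp add: circle_trace_def)

lemma circle_trace_nonneg: "0 \<le> circle_trace g R \<zeta>"
  by (simp add: circle_trace_def)

lemma integrable_circle_trace_powr:
  assumes g: "g holomorphic_on unit_disc" and R: "0 < R" "R < 1" and p: "0 < p"
  shows "integrable circle_measure (\<lambda>\<zeta>. circle_trace g R \<zeta> powr p)"
proof -
  have "bounded ((\<lambda>\<zeta>. g (complex_of_real R * \<zeta>)) ` cball 0 1)"
    using circle_trace_continuous[OF g R] by (intro compact_imp_bounded compact_continuous_image) auto
  then obtain B where B': "\<forall>\<zeta>\<in>cball 0 1. norm (g (complex_of_real R * \<zeta>)) \<le> B"
    by (auto simp: bounded_iff)
  have B: "norm (g (complex_of_real R * \<zeta>)) \<le> B" if "norm \<zeta> \<le> 1" for \<zeta>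
    using B' that by simp
  have "\<bar>circle_trace g R \<zeta> powr p\<bar> \<le> B powr p" if "norm \<zeta> = 1" for \<zeta>
    using B[of \<zeta>] that p by (auto simp: circle_trace_circle intro: powr_mono2)
  then show ?thesis
    using circle_trace_measurable[OF g R] by (intro integrable_on_circle) auto
qed

lemma Cauchy_circle_mean:
  assumes g: "g holomorphic_on unit_disc" and R: "0 < R" "R < 1" and a: "norm a < R"
  shows "norm (g a) \<le> R / (R - norm a) * (\<integral>\<zeta>. circle_trace g R \<zeta> \<partial>circle_measure)"
proof -
  have sub: "cball 0 R \<subseteq> unit_disc" using R by auto
  have "((\<lambda>w. g w / (w - a)) has_contour_integral (2 * of_real pi * \<i> * g a)) (circlepath 0 R)"
  proof (rule Cauchy_integral_circlepath)
    show "continuous_on (cball 0 R) g"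
      by (rule holomorphic_on_imp_continuous_on[OF holomorphic_on_subset[OF g sub]])
    show "g holomorphic_on ball 0 R"
      by (rule holomorphic_on_subset[OF g order_trans[OF ball_subset_cball sub]])
    show "norm (a - 0) < R" using a by simp
  qed
  then have hi: "((\<lambda>t. g (complex_of_real R * cis t) / (complex_of_real R * cis t - a) * R * \<i> * cis t) has_integral (2 * of_real pi * \<i> * g a)) {0..2 * pi}"
    unfolding circlepath_def by (subst (asm) has_contour_integral_part_circlepath_iff) auto
  have cont: "continuous_on {0..2 * pi} (\<lambda>t. norm (g (complex_of_real R * cis t)))"
    by (intro continuous_on_norm continuous_on_compose2[OF circle_trace_continuous[OF g R]] continuous_intros) auto
  have int: "(\<lambda>t. R / (R - norm a) * norm (g (complex_of_real R * cis t))) integrable_on {0..2 * pi}"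
    by (intro integrable_continuous_real continuous_intros cont)
  have "norm (2 * of_real pi * \<i> * g a) \<le> integral {0..2 * pi} (\<lambda>t. R / (R - norm a) * norm (g (complex_of_real R * cis t)))"
    unfolding integral_unique[OF hi, symmetric]
  proof (rule integral_norm_bound_integral[OF has_integral_integrable[OF hi] int])
    fix t
    have "R - norm a \<le> norm (complex_of_real R * cis t - a)"
      using norm_triangle_ineq2[of "complex_of_real R * cis t" a] R by (simp add: norm_mult)
    then have "norm (g (complex_of_real R * cis t)) * R / norm (complex_of_real R * cis t - a) \<le> norm (g (complex_of_real R * cis t)) * R / (R - norm a)"
      using a R by (intro divide_left_mono mult_pos_pos) auto
    then show "norm (g (complex_of_real R * cis t) / (complex_of_real R * cis t - a) * R * \<i> * cis t) \<le> R / (R - norm a) * norm (g (complex_of_real R * cis t))"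
      using R by (simp add: norm_mult norm_divide mult_ac)
  qed
  also have "\<dots> = R / (R - norm a) * integral {0..2 * pi} (\<lambda>t. norm (g (complex_of_real R * cis t)))"
    by simp
  also have "integral {0..2 * pi} (\<lambda>t. norm (g (complex_of_real R * cis t))) = 2 * pi * (\<integral>\<zeta>. circle_trace g R \<zeta> \<partial>circle_measure)"
  proof -
    have "continuous_on (sphere 0 1) (\<lambda>\<zeta>. norm (g (complex_of_real R * \<zeta>)))"
      by (intro continuous_on_norm continuous_on_subset[OF circle_trace_continuous[OF g R]]) auto
    then have "continuous_on (sphere 0 1) (circle_trace g R)"
      by (rule continuous_on_eq) (simp add: circle_trace_circle)
    from integral_circle_measure[OF circle_trace_measurable[OF g R] this] show ?thesis
      by (simp add: circle_trace_circle)
  qed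
  finally have "2 * pi * norm (g a) \<le> 2 * pi * (R / (R - norm a) * (\<integral>\<zeta>. circle_trace g R \<zeta> \<partial>circle_measure))"
    by (simp add: norm_mult mult_ac)
  then show ?thesis by (subst (asm) mult_le_cancel_left_pos) auto
qed

lemma integral_circle_trace_powr_le:
  assumes g: "g holomorphic_on unit_disc" and R: "0 < R" "R < 1" and p: "0 < p" and N: "0 \<le> N"
    and le: "(\<integral>\<^sup>+ \<zeta>. ennreal (norm (g (complex_of_real R * \<zeta>)) powr p) \<partial>circle_measure) \<le> ennreal N"
  shows "(\<integral>\<zeta>. circle_trace g R \<zeta> powr p \<partial>circle_measure) \<le> N"
proof -
  have "ennreal (\<integral>\<zeta>. circle_trace g R \<zeta> powr p \<partial>circle_measure) = (\<integral>\<^sup>+ \<zeta>. ennreal (circle_trace g R \<zeta> powr p) \<partial>circle_measure)"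
    using integrable_circle_trace_powr[OF g R p] by (intro nn_integral_eq_integral[symmetric]) auto
  also have "\<dots> = (\<integral>\<^sup>+ \<zeta>. ennreal (norm (g (complex_of_real R * \<zeta>)) powr p) \<partial>circle_measure)"
    using AE_circle_measure by (intro nn_integral_cong_AE, eventually_elim) (simp add: circle_trace_circle)
  finally have "ennreal (\<integral>\<zeta>. circle_trace g R \<zeta> powr p \<partial>circle_measure) \<le> ennreal N"
    using le by (rule ord_eq_le_trans)
  then show ?thesis by (subst (asm) ennreal_le_iff[OF N])
qed

text \<open>
  For \<open>p \<ge> 1\<close> the pointwise inequality \<open>x \<le> t + t\<^bsup>1-p\<^esup> x\<^sup>p\<close> replaces Jensen's inequality.  The free
  parameter \<open>t\<close> is what makes the bound small when \<open>N\<close> is.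
\<close>

lemma hardy_bound_ge_1:
  assumes g: "g holomorphic_on unit_disc" and R: "0 < R" "R < 1" and a: "norm a < R" and p: "1 \<le> p" and t: "0 < t"
    and N: "(\<integral>\<zeta>. circle_trace g R \<zeta> powr p \<partial>circle_measure) \<le> N"
  shows "norm (g a) \<le> R / (R - norm a) * (t + t powr (1 - p) * N)"
proof -
  have pt: "x \<le> t + t powr (1 - p) * x powr p" if "0 \<le> x" for x
  proof (cases "x \<le> t")
    case True
    then show ?thesis using that by (simp add: add_increasing2)
  next
    case False
    have "x = x powr (1 - p) * x powr p" using False t by (simp add: powr_add[symmetric])
    also have "\<dots> \<le> t powr (1 - p) * x powr p"
      using False t p by (intro mult_right_mono powr_mono2') auto
    finally show ?thesis using t by simp
  qed
  have i1: "integrable circle_measure (circle_trace g R)"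
    using integrable_circle_trace_powr[OF g R, of 1] circle_trace_nonneg by simp
  have i2: "integrable circle_measure (\<lambda>\<zeta>. circle_trace g R \<zeta> powr p)"
    using p by (intro integrable_circle_trace_powr[OF g R]) auto
  have ic: "integrable circle_measure (\<lambda>_. t)"
    by (rule finite_measure.integrable_const[OF finite_measure_circle_measure])
  have "(\<integral>\<zeta>. circle_trace g R \<zeta> \<partial>circle_measure) \<le> (\<integral>\<zeta>. t + t powr (1 - p) * circle_trace g R \<zeta> powr p \<partial>circle_measure)"
    using i1 i2 ic pt circle_trace_nonneg by (intro integral_mono) auto
  also have "\<dots> = t + t powr (1 - p) * (\<integral>\<zeta>. circle_trace g R \<zeta> powr p \<partial>circle_measure)"
    using i2 ic by (simp add: measure_def emeasure_circle_measure)
  also have "\<dots> \<le> t + t powr (1 - p) * N" using N by (intro add_left_mono mult_left_mono) auto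
  finally have "R / (R - norm a) * (\<integral>\<zeta>. circle_trace g R \<zeta> \<partial>circle_measure) \<le> R / (R - norm a) * (t + t powr (1 - p) * N)"
    using R a by (intro mult_left_mono) auto
  then show ?thesis using Cauchy_circle_mean[OF g R a] by linarith
qed

text \<open>
  The Hardy--Littlewood argument for \<open>p < 1\<close>.  Let \<open>b\<close> maximize \<open>\<Phi> z = (R\<^sub>0 - |z|)\<^bsup>1/p\<^esup> |g z|\<close>, and let \<open>R\<close>
  be halfway between \<open>|b|\<close> and \<open>R\<^sub>0\<close>.  On the circle of radius \<open>R\<close> maximality bounds \<open>|g|\<close> by a constant
  \<open>A\<close>, whence \<open>|g| \<le> A\<^bsup>1-p\<^esup> |g|\<^sup>p\<close> there, and Cauchy's formula gives \<open>\<Phi> b \<le> 2\<^bsup>1/p\<^esup> N (\<Phi> b)\<^bsup>1-p\<^esup>\<close>.  The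
  exponent \<open>1/p\<close> in the weight is the one for which the powers of the distance cancel.
\<close>

lemma hardy_bound_less_1:
  assumes g: "g holomorphic_on unit_disc" and R0: "0 < R0" "R0 < 1" and a: "norm a < R0" and p: "0 < p" "p < 1" and N0: "0 \<le> N"
    and N: "\<And>R. 0 < R \<Longrightarrow> R < 1 \<Longrightarrow> (\<integral>\<zeta>. circle_trace g R \<zeta> powr p \<partial>circle_measure) \<le> N"
  shows "((R0 - norm a) powr (1 / p) * norm (g a)) powr p \<le> 2 powr (1 / p) * N"
proof -
  define \<Phi> where "\<Phi> z = (R0 - norm z) powr (1 / p) * norm (g z)" for z
  have "continuous_on (cball 0 R0) \<Phi>"
    unfolding \<Phi>_def using p R0 holomorphic_on_imp_continuous_on[OF g]
    by (intro continuous_on_mult continuous_on_powr' continuous_intros) (auto intro: continuous_on_subset)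
  then obtain b where b: "b \<in> cball 0 R0" "\<And>z. z \<in> cball 0 R0 \<Longrightarrow> \<Phi> z \<le> \<Phi> b"
    using continuous_attains_sup[OF compact_cball, of 0 R0 \<Phi>] R0 by force
  have nn: "0 \<le> \<Phi> z" for z by (simp add: \<Phi>_def)
  have "\<Phi> b powr p \<le> 2 powr (1 / p) * N"
  proof (cases "\<Phi> b = 0")
    case False
    then have pos: "0 < \<Phi> b" using nn[of b] by simp
    have bR: "norm b < R0"
      using b(1) False p by (cases "norm b = R0") (auto simp: \<Phi>_def)
    define d where "d = (R0 - norm b) / 2"
    define R where "R = norm b + d"
    have d: "0 < d" "R0 - R = d" "R0 - norm b = 2 * d" "R - norm b = d"
      using bR by (simp_all add: d_def R_def field_simps)
    have R: "0 < R" "R < 1" "norm b < R" "R < R0"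
      using d R0 norm_ge_zero[of b] by linarith+
    define A where "A = \<Phi> b / d powr (1 / p)"
    have A: "0 < A" using pos d by (simp add: A_def)
    have le: "circle_trace g R \<zeta> \<le> A powr (1 - p) * circle_trace g R \<zeta> powr p" if "norm \<zeta> = 1" for \<zeta>
    proof -
      have "\<Phi> (complex_of_real R * \<zeta>) \<le> \<Phi> b"
        using R that by (intro b(2)) (simp add: norm_mult)
      then have x: "circle_trace g R \<zeta> \<le> A"
        using R that d(1) by (simp add: \<Phi>_def norm_mult circle_trace_circle A_def d(2) pos_le_divide_eq mult.commute)
      show ?thesis
      proof (cases "circle_trace g R \<zeta> = 0")
        case False
        then have x0: "0 < circle_trace g R \<zeta>" using circle_trace_nonneg[of g R \<zeta>] by simp
        have "circle_trace g R \<zeta> = circle_trace g R \<zeta> powr (1 - p) * circle_trace g R \<zeta> powr p"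
          using x0 by (simp add: powr_add[symmetric])
        also have "\<dots> \<le> A powr (1 - p) * circle_trace g R \<zeta> powr p"
          using x x0 p by (intro mult_right_mono powr_mono2) auto
        finally show ?thesis .
      qed simp
    qed
    have i1: "integrable circle_measure (circle_trace g R)"
      using integrable_circle_trace_powr[OF g R(1,2), of 1] circle_trace_nonneg by simp
    have i2: "integrable circle_measure (\<lambda>\<zeta>. circle_trace g R \<zeta> powr p)"
      using p by (intro integrable_circle_trace_powr[OF g R(1,2)]) auto
    have "(\<integral>\<zeta>. circle_trace g R \<zeta> \<partial>circle_measure) \<le> (\<integral>\<zeta>. A powr (1 - p) * circle_trace g R \<zeta> powr p \<partial>circle_measure)"
    proof (rule integral_mono_AE)
      show "AE \<zeta> in circle_measure. circle_trace g R \<zeta> \<le> A powr (1 - p) * circle_trace g R \<zeta> powr p"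
        using AE_circle_measure by eventually_elim (rule le)
    qed (use i1 i2 in auto)
    also have "\<dots> = A powr (1 - p) * (\<integral>\<zeta>. circle_trace g R \<zeta> powr p \<partial>circle_measure)" by simp
    also have "\<dots> \<le> A powr (1 - p) * N" using N[OF R(1,2)] by (intro mult_left_mono) auto
    finally have "R / (R - norm b) * (\<integral>\<zeta>. circle_trace g R \<zeta> \<partial>circle_measure) \<le> 1 / d * (A powr (1 - p) * N)"
      unfolding d(4) using R d by (intro mult_mono divide_right_mono Bochner_Integration.integral_nonneg circle_trace_nonneg) auto
    then have gb: "norm (g b) \<le> 1 / d * (A powr (1 - p) * N)"
      using Cauchy_circle_mean[OF g R(1-3)] by linarith
    have "\<Phi> b = (2 * d) powr (1 / p) * norm (g b)" by (simp add: \<Phi>_def d(3))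
    also have "\<dots> \<le> (2 * d) powr (1 / p) * (1 / d * (A powr (1 - p) * N))"
      using gb by (intro mult_left_mono) auto
    also have "\<dots> = 2 powr (1 / p) * N * \<Phi> b powr (1 - p)"
    proof -
      have "A powr (1 - p) = \<Phi> b powr (1 - p) / d powr ((1 / p) * (1 - p))"
        using nn d by (simp add: A_def powr_divide powr_powr)
      moreover have "(1 / p) * (1 - p) = 1 / p - 1" using p by (simp add: field_simps)
      moreover have "d powr (1 / p - 1) = d powr (1 / p) / d" using d by (simp add: powr_diff)
      ultimately show ?thesis using d by (simp add: powr_mult)
    qed
    finally have "\<Phi> b powr p * \<Phi> b powr (1 - p) \<le> 2 powr (1 / p) * N * \<Phi> b powr (1 - p)"
      using pos by (simp add: powr_add[symmetric])
    then show ?thesis using pos by (simp add: mult_le_cancel_right)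
  qed (use N0 in simp)
  moreover have "\<Phi> a powr p \<le> \<Phi> b powr p"
    using b(2)[of a] a nn p by (intro powr_mono2) auto
  ultimately show ?thesis by (simp add: \<Phi>_def)
qed

proposition small_hardy_norm_imp_small_value:
  assumes p: "0 < p" and a: "norm (a::complex) < 1" and e: "0 < (e::real)"
  shows "\<exists>\<delta>>0. \<forall>g. g holomorphic_on unit_disc \<longrightarrow>
      (\<forall>\<rho>\<in>{0..<1}. (\<integral>\<^sup>+ \<zeta>. ennreal (norm (g (complex_of_real \<rho> * \<zeta>)) powr p) \<partial>circle_measure) \<le> ennreal \<delta>) \<longrightarrow>
      norm (g a) \<le> e"
proof -
  define R where "R = (1 + norm a) / 2"
  have R: "0 < R" "R < 1" "norm a < R"
    using a norm_ge_zero[of a] by (simp_all add: R_def add_pos_nonneg)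
  show ?thesis
  proof (cases "1 \<le> p")
    case True
    define C where "C = R / (R - norm a)"
    have C: "0 < C" using R by (simp add: C_def)
    \<comment> \<open>Both summands of the bound C (t + t^(1-p) N) are made equal to e / 2.\<close>
    define t where "t = e / (2 * C)"
    have t: "0 < t" using e C by (simp add: t_def)
    have pos: "0 < t / t powr (1 - p)" using t by simp
    have "norm (g a) \<le> e" if g: "g holomorphic_on unit_disc" and
        N: "\<forall>\<rho>\<in>{0..<1}. (\<integral>\<^sup>+ \<zeta>. ennreal (norm (g (complex_of_real \<rho> * \<zeta>)) powr p) \<partial>circle_measure) \<le> ennreal (t / t powr (1 - p))" for g
    proof -
      have "(\<integral>\<zeta>. circle_trace g R \<zeta> powr p \<partial>circle_measure) \<le> t / t powr (1 - p)"
        using N R pos p by (intro integral_circle_trace_powr_le[OF g R(1,2)]) auto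
      from hardy_bound_ge_1[OF g R True t this]
      have "norm (g a) \<le> C * (t + t powr (1 - p) * (t / t powr (1 - p)))" by (simp add: C_def)
      also have "\<dots> = e" using t C by (simp add: t_def)
      finally show "norm (g a) \<le> e" .
    qed
    with pos show ?thesis by blast
  next
    case False
    define m where "m = e * (R - norm a) powr (1 / p)"
    have m: "0 < m" using e R by (simp add: m_def)
    have pos: "0 < m powr p / 2 powr (1 / p)" using m by simp
    have "norm (g a) \<le> e" if g: "g holomorphic_on unit_disc" and
        N: "\<forall>\<rho>\<in>{0..<1}. (\<integral>\<^sup>+ \<zeta>. ennreal (norm (g (complex_of_real \<rho> * \<zeta>)) powr p) \<partial>circle_measure) \<le> ennreal (m powr p / 2 powr (1 / p))" for g
    proof -
      have "((R - norm a) powr (1 / p) * norm (g a)) powr p \<le> 2 powr (1 / p) * (m powr p / 2 powr (1 / p))"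
        using N pos p False
        by (intro hardy_bound_less_1[OF g R] integral_circle_trace_powr_le[OF g]) auto
      then have "((R - norm a) powr (1 / p) * norm (g a)) powr p \<le> m powr p" by simp
      then have "(R - norm a) powr (1 / p) * norm (g a) \<le> m"
        using p m by (meson not_le powr_less_mono2 less_imp_le)
      then have "(R - norm a) powr (1 / p) * norm (g a) \<le> (R - norm a) powr (1 / p) * e"
        by (simp add: m_def mult.commute)
      then show "norm (g a) \<le> e"
        using R by (simp add: mult_le_cancel_left_pos)
    qed
    with pos show ?thesis by blast
  qed
qed

lemma ennreal_root_le:
  assumes "0 < p" "0 \<le> c" "ennreal_root p x \<le> ennreal c"
  shows "x \<le> ennreal (c powr p)"
proof (cases x)
  case (real y)
  then have "y powr (1 / p) \<le> c" using assms by (simp add: ennreal_root_def ennreal_le_iff split: if_splits)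
  then have "(y powr (1 / p)) powr p \<le> c powr p" using assms by (intro powr_mono2) auto
  then show ?thesis using real assms by (simp add: powr_powr ennreal_leI)
qed (use assms in \<open>simp add: ennreal_root_def top_unique\<close>)

proposition hardy_convergence_imp_pointwise:
  assumes p: "0 < p" and hol: "\<And>j. G j holomorphic_on unit_disc"
    and lim: "(\<lambda>j::nat. hardy_norm p (G j)) \<longlonglongrightarrow> 0" and a: "norm a < 1"
  shows "(\<lambda>j. G j a) \<longlonglongrightarrow> 0"
proof (rule LIMSEQ_I)
  fix e :: real assume e: "0 < e"
  then have e2: "0 < e / 2" by simp
  obtain \<delta> where \<delta>: "0 < \<delta>" "\<forall>g. g holomorphic_on unit_disc \<longrightarrow>
      (\<forall>\<rho>\<in>{0..<1}. (\<integral>\<^sup>+ \<zeta>. ennreal (norm (g (complex_of_real \<rho> * \<zeta>)) powr p) \<partial>circle_measure) \<le> ennreal \<delta>) \<longrightarrow>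
      norm (g a) \<le> e / 2"
    using small_hardy_norm_imp_small_value[OF p a e2] by auto
  have "eventually (\<lambda>j. hardy_norm p (G j) < ennreal (\<delta> powr (1 / p))) sequentially"
    using \<delta>(1) by (intro order_tendstoD(2)[OF lim]) simp
  then obtain j0 where j0: "\<And>j. j0 \<le> j \<Longrightarrow> hardy_norm p (G j) < ennreal (\<delta> powr (1 / p))"
    by (auto simp: eventually_sequentially)
  have "norm (G j a) \<le> e / 2" if "j0 \<le> j" for j
  proof (rule \<delta>(2)[rule_format, OF hol])
    fix \<rho> :: real assume \<rho>: "\<rho> \<in> {0..<1}"
    have "(SUP \<rho>\<in>{0..<1}. \<integral>\<^sup>+ \<zeta>. ennreal (norm (G j (complex_of_real \<rho> * \<zeta>)) powr p) \<partial>circle_measure) \<le> ennreal ((\<delta> powr (1 / p)) powr p)"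
      by (rule ennreal_root_le[OF p _ less_imp_le[OF j0[OF that, unfolded hardy_norm_def]]]) simp
    also have "(\<delta> powr (1 / p)) powr p = \<delta>" using p \<delta>(1) by (simp add: powr_powr)
    finally show "(\<integral>\<^sup>+ \<zeta>. ennreal (norm (G j (complex_of_real \<rho> * \<zeta>)) powr p) \<partial>circle_measure) \<le> ennreal \<delta>"
      using SUP_upper[OF \<rho>] by (rule order_trans[rotated])
  qed
  then show "\<exists>j0. \<forall>j\<ge>j0. norm (G j a - 0) < e"
    using e by (intro exI[of _ j0]) force
qed

section \<open>Closedness of the unit ball\<close>

lemma tendsto_SUP_at_left_0:
  fixes g :: "real \<Rightarrow> ennreal"
  assumes mono: "\<And>r s. r < s \<Longrightarrow> s < 0 \<Longrightarrow> g r \<le> g s"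
  shows "(g \<longlongrightarrow> (SUP r\<in>{..<0}. g r)) (at_left 0)"
proof (rule order_tendstoI)
  fix a assume "a < (SUP r\<in>{..<0}. g r)"
  then obtain r where r: "r < 0" "a < g r" by (auto simp: less_SUP_iff)
  have "eventually (\<lambda>s. s \<in> {r<..<0}) (at_left 0)"
    using r(1) by (rule eventually_at_left_real)
  then show "eventually (\<lambda>s. a < g s) (at_left 0)"
  proof eventually_elim
    fix s assume "s \<in> {r<..<0}"
    then have "g r \<le> g s" by (intro mono) auto
    then show "a < g s" using r(2) by simp
  qed
next
  fix a assume a: "(SUP r\<in>{..<0}. g r) < a"
  have "eventually (\<lambda>s. s \<in> {- 1<..<0::real}) (at_left 0)"
    by (rule eventually_at_left_real) simp
  then show "eventually (\<lambda>s. g s < a) (at_left 0)"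
  proof eventually_elim
    fix s :: real assume "s \<in> {- 1<..<0}"
    then have "g s \<le> (SUP r\<in>{..<0}. g r)" by (intro SUP_upper) simp
    then show "g s < a" using a by simp
  qed
qed

context exhaustion
begin

lemma level_integral_tendsto:
  assumes "f holomorphic_on unit_disc" "0 < p"
  shows "(level_integral u p f \<longlongrightarrow> (SUP r\<in>{..<0}. level_integral u p f r)) (at_left 0)"
  by (rule tendsto_SUP_at_left_0) (rule level_integral_mono[OF _ _ assms])

text \<open>
  By monotonicity the limit that defines the norm is a supremum, so the norm bound is a bound on each
  level integral.
\<close>

lemma mem_hardy_unit_ball_u_iff:
  assumes p: "0 < p"
  shows "f \<in> hardy_unit_ball_u u p \<longleftrightarrow>
    f holomorphic_on unit_disc \<and> (\<forall>r<0. level_integral u p f r \<le> 1)"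
proof (cases "f holomorphic_on unit_disc")
  case True
  define L where "L = (SUP r\<in>{..<0}. level_integral u p f r)"
  have lim: "(level_integral u p f \<longlongrightarrow> L) (at_left 0)"
    unfolding L_def by (rule level_integral_tendsto[OF True p])
  have Lim: "Lim (at_left 0) (level_integral u p f) = L"
    by (rule tendsto_Lim[OF _ lim]) simp
  have "f \<in> hardy_unit_ball_u u p \<longleftrightarrow> L \<le> 1"
  proof
    assume "f \<in> hardy_unit_ball_u u p"
    then have "ennreal_root p L \<le> ennreal 1"
      by (simp add: hardy_unit_ball_u_def hardy_norm_u_def Lim)
    from ennreal_root_le[OF p _ this] show "L \<le> 1" by simp
  next
    assume L: "L \<le> 1"
    then have "L < \<infinity>" by (auto simp: less_top[symmetric] top_unique)
    moreover have "ennreal_root p L \<le> 1"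
    proof (cases L)
      case (real y)
      then have "y \<le> 1" using L by simp
      then have "y powr (1 / p) \<le> 1" using real p by (intro powr_le1) auto
      then show ?thesis using real by (simp add: ennreal_root_def)
    qed (use \<open>L < \<infinity>\<close> in simp)
    ultimately show "f \<in> hardy_unit_ball_u u p"
      using True lim by (auto simp: hardy_unit_ball_u_def hardy_space_u_def hardy_norm_u_def Lim)
  qed
  also have "L \<le> 1 \<longleftrightarrow> (\<forall>r<0. level_integral u p f r \<le> 1)"
    unfolding L_def by (auto simp: SUP_le_iff)
  finally show ?thesis using True by simp
qed (simp add: hardy_unit_ball_u_def hardy_space_u_def)

lemma level_integral_le_of_pointwise_limit:
  assumes r: "r < 0" and p: "0 < p"
    and hol: "\<And>j. F j holomorphic_on unit_disc"
    and lim: "\<And>z. norm z < 1 \<Longrightarrow> (\<lambda>j. F j z) \<longlonglongrightarrow> f z"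
    and le: "\<And>j. level_integral u p (F j) r \<le> C"
  shows "level_integral u p f r \<le> C"
proof -
  define g where "g j z = ennreal (norm (F j z) powr p) * indicator (level u r) z" for j z
  have "level_integral u p f r = (\<integral>\<^sup>+ z. liminf (\<lambda>j. g j z) \<partial>\<mu> r)"
    unfolding level_integral_def
  proof (intro nn_integral_cong)
    fix z
    have "(\<lambda>j. g j z) \<longlonglongrightarrow> ennreal (norm (f z) powr p) * indicator (level u r) z"
    proof (cases "z \<in> level u r")
      case True
      then have "norm z < 1" by (auto simp: level_def)
      then have "(\<lambda>j. norm (F j z) powr p) \<longlonglongrightarrow> norm (f z) powr p"
        using p by (intro tendsto_powr' tendsto_norm lim tendsto_const) auto
      then show ?thesis using True by (simp add: g_def tendsto_ennrealI)
    qed (simp add: g_def)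
    then show "ennreal (norm (f z) powr p) * indicator (level u r) z = liminf (\<lambda>j. g j z)"
      by (rule lim_imp_Liminf[symmetric, rotated]) simp
  qed
  also have "\<dots> \<le> liminf (\<lambda>j. \<integral>\<^sup>+ z. g j z \<partial>\<mu> r)"
    unfolding g_def by (rule nn_integral_liminf) (rule level_integrand_measurable[OF r hol p])
  also have "\<dots> \<le> liminf (\<lambda>j. C)"
    using le by (intro Liminf_mono always_eventually allI) (simp add: g_def level_integral_def)
  also have "\<dots> = C" by (intro lim_imp_Liminf) auto
  finally show ?thesis .
qed

end

theorem theorem7p1:
  fixes u :: "complex \<Rightarrow> ereal" and p :: real
  assumes "u \<in> exhaustions" and "0 < p"
  shows "closed_in_hardy_space p (hardy_unit_ball_u u p)"
proof -
  interpret exhaustion u by standard (rule assms(1))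
  show ?thesis
    unfolding closed_in_hardy_space_def
  proof (intro allI impI, elim conjE)
    fix F :: "nat \<Rightarrow> complex \<Rightarrow> complex" and f
    assume F: "\<forall>j. F j \<in> hardy_unit_ball_u u p" and f: "f \<in> hardy_space p"
      and lim: "(\<lambda>j. hardy_norm p (\<lambda>z. F j z - f z)) \<longlonglongrightarrow> 0"
    have Fh: "F j holomorphic_on unit_disc" and F1: "r < 0 \<Longrightarrow> level_integral u p (F j) r \<le> 1" for j r
      using F mem_hardy_unit_ball_u_iff[OF assms(2)] by auto
    have fh: "f holomorphic_on unit_disc" using f by (simp add: hardy_space_def)
    have pointwise: "(\<lambda>j. F j z) \<longlonglongrightarrow> f z" if z: "norm z < 1" for z
    proof -
      have "(\<lambda>j. F j z - f z) \<longlonglongrightarrow> 0"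
        using Fh fh by (intro hardy_convergence_imp_pointwise[OF assms(2) _ lim z] holomorphic_on_diff)
      then show ?thesis by (rule LIM_zero_cancel)
    qed
    have "level_integral u p f r \<le> 1" if "r < 0" for r
      by (rule level_integral_le_of_pointwise_limit[OF that assms(2) Fh pointwise F1[OF that]])
    then show "f \<in> hardy_unit_ball_u u p"
      using fh mem_hardy_unit_ball_u_iff[OF assms(2)] by simp
  qed
qed

end
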